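(* Let $q$ be an odd prime power, let $n\geq 1$ and $t\geq 1$ be integers, and let $\ell\in\mathbb{F}_{q^n}[x]$ be an exceptional $t$-normalized $t$-scattered $q$-linearized polynomial of linearized degree $r$. Let $d\coloneqq\max\{r,t\}$ and suppose that $d$ is an odd prime. Then $\ell=x$.
   Context: A $q$-linearized polynomial is one of the form $\sum_{i=0}^r a_i x^{q^i}$; if $a_r\neq 0$ its linearized degree is $r$. For a prime power $q$, positive integers $n,m$ and a non-negative integer $t$, a $q$-linearized $\ell\in\mathbb{F}_{q^n}[x]$ is called $(q,n,m,t)$-scattered if for every $s_0\in\mathbb{F}_{q^{nm}}$ the polynomial $\ell-s_0x^{q^t}$ has at most $q$ roots in $\mathbb{F}_{q^{nm}}$. It is called exceptional $t$-scattered if (for the fixed $q,n,t$) it is $(q,n,m,t)$-scattered for infinitely many positive integers $m$. It is called $t$-normalized if it is monic, its coefficient of $x^{q^t}$ is zero, and, when $t>0$, its coefficient of $x$ is non-zero. *)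

theory Defs
  imports
    "HOL-Algebra.Algebraic_Closure_Type"
    "HOL-Number_Theory.Number_Theory"
begin

(* For 'a with q^n elements and k > 0, this is the copy of F_{q^k} in the algebraic closure
   of 'a, see card_gf, gf_subfield and range_to_ac_eq_gf below. *)
definition gf :: "nat \<Rightarrow> 'a::field alg_closure set" where
  "gf N = {x. x ^ N = x}"

definition q_linearized :: "nat \<Rightarrow> 'a::field poly \<Rightarrow> bool" where
  "q_linearized q f \<longleftrightarrow> (\<exists>r a. f = (\<Sum>i\<le>r. monom (a i) (q ^ i)))"

definition has_linearized_degree :: "nat \<Rightarrow> 'a::field poly \<Rightarrow> nat \<Rightarrow> bool" where
  "has_linearized_degree q f r \<longleftrightarrow>
     (\<exists>a. f = (\<Sum>i\<le>r. monom (a i) (q ^ i)) \<and> a r \<noteq> 0)"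

(* Meaningful when 'a has q^n elements and m > 0. Roots are counted without multiplicity. *)
definition scattered :: "nat \<Rightarrow> nat \<Rightarrow> nat \<Rightarrow> nat \<Rightarrow> 'a::field poly \<Rightarrow> bool" where
  "scattered q n m t f \<longleftrightarrow> q_linearized q f \<and>
     (\<forall>s0 \<in> gf (q ^ (n * m)).
        card {x \<in> gf (q ^ (n * m)). poly (map_poly to_ac f - monom s0 (q ^ t)) x = 0} \<le> q)"

definition exceptional_scattered :: "nat \<Rightarrow> nat \<Rightarrow> nat \<Rightarrow> 'a::field poly \<Rightarrow> bool" where
  "exceptional_scattered q n t f \<longleftrightarrow> infinite {m. m > 0 \<and> scattered q n m t f}"

definition t_normalized :: "nat \<Rightarrow> nat \<Rightarrow> 'a::field poly \<Rightarrow> bool" where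
  "t_normalized q t f \<longleftrightarrow>
     lead_coeff f = 1 \<and> coeff f (q ^ t) = 0 \<and> (t > 0 \<longrightarrow> coeff f 1 \<noteq> 0)"

lemma finite_gf:
  assumes "N > 1"
  shows "finite (gf N :: 'a::field alg_closure set)"
proof -
  let ?p = "monom 1 N - monom 1 1 :: 'a alg_closure poly"
  have "coeff ?p N = 1" using assms by simp
  hence "?p \<noteq> 0" by (metis coeff_0 zero_neq_one)
  hence "finite {x. poly ?p x = 0}" by (rule poly_roots_finite)
  thus ?thesis by (simp add: gf_def poly_monom)
qed

lemma card_roots_separable:
  fixes p :: "'a::alg_closed_field poly"
  assumes "p \<noteq> 0" and sep: "\<And>x. poly p x = 0 \<Longrightarrow> poly (pderiv p) x \<noteq> 0"
  shows "card {x. poly p x = 0} = degree p"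
proof -
  obtain A where A: "size A = degree p" "p = smult (lead_coeff p) (\<Prod>x\<in>#A. [:-x, 1:])"
    using alg_closed_imp_factorization[OF assms(1)] by blast
  have eval: "poly p x = lead_coeff p * (\<Prod>y\<in>#A. x - y)" for x
    by (subst A(2)) (simp add: poly_prod_mset image_mset.compositionality o_def)
  have roots: "{x. poly p x = 0} = set_mset A"
    using assms(1) by (auto simp: eval prod_mset_zero_iff)
  have "count A a \<le> 1" for a
  proof (rule ccontr)
    assume "\<not> count A a \<le> 1"
    hence "replicate_mset 2 a \<subseteq># A"
      by (simp flip: count_le_replicate_mset_subset_eq)
    then obtain B where "A = {#a, a#} + B"
      by (auto simp: subset_mset.le_iff_add numeral_2_eq_2)
    hence "\<exists>R. p = [:-a, 1:] * ([:-a, 1:] * R)"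
      by (intro exI[of _ "smult (lead_coeff p) (\<Prod>x\<in>#B. [:-x, 1:])"], subst A(2)) simp
    then obtain R where R: "p = [:-a, 1:] * ([:-a, 1:] * R)" by blast
    have "poly p a = 0" "poly (pderiv p) a = 0"
      by (simp_all only: R pderiv_mult) simp_all
    with sep show False by blast
  qed
  hence "count A x = count (mset_set (set_mset A)) x" for x
    by (cases "x \<in># A") (simp_all add: le_antisym not_in_iff Suc_le_eq)
  hence "A = mset_set (set_mset A)"
    by (rule multiset_eqI)
  hence "size A = card (set_mset A)"
    by (metis size_mset_set)
  thus ?thesis using A(1) roots by simp
qed

context
  fixes q n :: nat
  assumes q: "primepow q" and card: "card (UNIV :: 'a::finite_field set) = q ^ n"
begin

lemma exponent_pos: "n > 0"
  using card CHAR_dvd_CARD[where 'a='a] CHAR_prime[where 'a='a]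
  by (cases n) (auto simp: prime_nat_iff)

lemma q_power_CHAR: obtains e where "e > 0" "q = CHAR('a alg_closure) ^ e"
proof -
  obtain p e where pe: "prime p" "e > 0" "q = p ^ e"
    using q by (auto simp: primepow_def)
  have "CHAR('a) dvd p ^ (e * n)"
    using CHAR_dvd_CARD[where 'a='a] card pe by (simp add: power_mult)
  moreover have "prime CHAR('a)" by (simp add: CHAR_prime)
  ultimately have "CHAR('a) = p"
    using pe(1) prime_dvd_power primes_dvd_imp_eq by blast
  thus ?thesis using pe that by simp
qed

lemma card_gf:
  assumes "k > 0"
  shows "card (gf (q ^ k) :: 'a alg_closure set) = q ^ k"
proof -
  obtain e where e: "e > 0" "q = CHAR('a alg_closure) ^ e" by (rule q_power_CHAR)
  let ?N = "q ^ k"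
  have N: "?N > 1" using q assms primepow_gt_Suc_0[of q] by (metis One_nat_def one_less_power)
  let ?p = "monom 1 ?N - monom 1 1 :: 'a alg_closure poly"
  have "of_nat ?N = (0 :: 'a alg_closure)"
    using e assms by (simp add: of_nat_eq_0_iff_char_dvd dvd_power)
  hence "pderiv ?p = -1"
    by (auto simp: pderiv_diff pderiv_monom one_pCons monom_0 power_0_left)
  moreover have deg: "degree ?p = ?N"
    using N by (simp add: diff_conv_add_uminus degree_add_eq_left degree_monom_eq
        del: add_uminus_conv_diff)
  moreover from deg have "?p \<noteq> 0" using N by (metis degree_0 not_one_less_zero)
  ultimately have "card {x. poly ?p x = 0} = ?N"
    using card_roots_separable[of ?p] by simp
  thus ?thesis by (simp add: gf_def poly_monom)
qed

lemma gf_subfield: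
  fixes x y :: "'a alg_closure"
  shows "0 \<in> (gf (q ^ k) :: 'a alg_closure set)" "1 \<in> (gf (q ^ k) :: 'a alg_closure set)"
    and "x \<in> gf (q ^ k) \<Longrightarrow> y \<in> gf (q ^ k) \<Longrightarrow> x - y \<in> gf (q ^ k)"
    and "x \<in> gf (q ^ k) \<Longrightarrow> y \<in> gf (q ^ k) \<Longrightarrow> x * y \<in> gf (q ^ k)"
    and "x \<in> gf (q ^ k) \<Longrightarrow> inverse x \<in> gf (q ^ k)"
proof -
  obtain e where e: "e > 0" "q = CHAR('a alg_closure) ^ e" by (rule q_power_CHAR)
  have p: "prime CHAR('a alg_closure)" by (simp add: CHAR_prime)
  have N: "q ^ k = CHAR('a alg_closure) ^ (e * k)" using e by (simp add: power_mult)
  have add: "(u + v) ^ (q ^ k) = u ^ (q ^ k) + v ^ (q ^ k)" for u v :: "'a alg_closure"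
    by (rule freshmans_dream'[OF p N])
  have "q > 0" using q primepow_gt_Suc_0[of q] by simp
  then show "0 \<in> (gf (q ^ k) :: 'a alg_closure set)" by (simp add: gf_def)
  show "x - y \<in> gf (q ^ k)" if "x \<in> gf (q ^ k)" "y \<in> gf (q ^ k)"
    using add[of "x - y" y] that by (simp add: gf_def algebra_simps)
qed (auto simp: gf_def power_mult_distrib power_inverse)

lemma range_to_ac_eq_gf: "range (to_ac :: 'a \<Rightarrow> _) = gf (q ^ n)"
proof (rule card_subset_eq)
  have "q ^ n > 1" using q exponent_pos primepow_gt_Suc_0[of q] by (metis One_nat_def one_less_power)
  thus "finite (gf (q ^ n) :: 'a alg_closure set)" by (rule finite_gf)
  show "range (to_ac :: 'a \<Rightarrow> _) \<subseteq> gf (q ^ n)"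
    by (auto simp: gf_def card[symmetric] finite_field_power_card_eq_same simp flip: to_ac_power)
  show "card (range (to_ac :: 'a \<Rightarrow> _)) = card (gf (q ^ n) :: 'a alg_closure set)"
    using card_gf[OF exponent_pos] card by (simp add: card_image inj_to_ac)
qed

end

end

theory Submission
  imports Defs
begin

text \<open>
  If \<open>l\<close> is scattered over the field with \<open>Q\<close> elements, then the plane curve
  \<open>l y * x ^ q ^ t = l x * y ^ q ^ t\<close>, freed of the lines \<open>x = 0\<close>, \<open>y = c * x\<close>
  with \<open>c ^ q = c\<close>, has no rational points off the axes. For \<open>l\<close> different from \<open>x\<close> the curve
  is absolutely irreducible, and Stepanov's method then produces a rational point as soon as
  \<open>Q\<close> is large.

  For \<open>t = d > r > 0\<close>, irreducibility is an Eisenstein argument at the roots of \<open>l\<close>. For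
  \<open>r = d > t \<ge> 2\<close>, every factor shows up on an edge of the Newton polygon, so that the factors
  are separated by roots of unity; they are permuted by \<open>GL\<^sub>2\<close> over the field with
  \<open>q\<close> elements, and following the branches of the curve at the origin one sees that enough
  of this group fixes each factor to leave room for only one. The case \<open>t = 1\<close> is
  reduced to \<open>t = d - 1\<close> by passing to the adjoint polynomial.
\<close>

section \<open>Stepanov's method\<close>

text \<open>Primality of \<open>d\<close> makes \<open>d\<close> coprime to the other index, so that
  elements fixed by both powers of Frobenius lie in F_q; this excludes factors in one variable alone
  and makes the two weights of the Newton edge coprime. For \<open>r = d\<close> the branches at the
  origin have slopes in F_(q^t) outside F_q. There are none for \<open>t = 1\<close>, and the
  adjoint exchanges \<open>t\<close> with \<open>d - t\<close>. The edge is untouched by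
  translations of the slope, but not by inversion. So translations fix each factor outright, while
  inversion is only known to permute factors. Translations and their conjugates by inversion
  generate SL_2, whose diagonal part scales slopes by squares only. To move any root on the edge to
  any other with these scalings, 2 must be invertible modulo (q^d - 1) / (q - 1); this is where both
  \<open>q\<close> and \<open>d\<close> have to be odd. Lines with slope in F_q need no separate
  treatment: after division by the corresponding factor, differentiating the equation of the curve
  shows that no such point is left over an admissible abscissa, and that the remaining points are
  simple.\<close>

lemma homogeneous_system_solution:
  fixes M :: "'i \<Rightarrow> 'j \<Rightarrow> 'a::field"
  assumes "finite B" "finite A" "card B < card A"
  shows "\<exists>c. (\<exists>a\<in>A. c a \<noteq> 0) \<and> (\<forall>b\<in>B. (\<Sum>a\<in>A. c a * M a b) = 0)"
  using assms
proof (induction B arbitrary: A M rule: finite_induct)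
  case empty
  then have "A \<noteq> {}" by auto
  then show ?case by (intro exI[of _ "\<lambda>_. 1"]) auto
next
  case (insert b B)
  show ?case
  proof (cases "\<forall>a\<in>A. M a b = 0")
    case True
    from insert have "card B < card A" by simp
    from insert.IH[OF insert.prems(1) this, of M] True show ?thesis by auto
  next
    case False
    then obtain a0 where a0: "a0 \<in> A" "M a0 b \<noteq> 0" by auto
    define A' where "A' = A - {a0}"
    have A: "A = insert a0 A'" "a0 \<notin> A'" "finite A'"
      using a0 insert.prems by (auto simp: A'_def)
    have "card B < card A'" using insert A by simp
    \<comment> \<open>Gaussian elimination: equation \<open>b\<close> expresses the unknown at
      \<open>a0\<close> through the others, and substituting it leaves this system.\<close>
    from insert.IH[OF A(3) this, of "\<lambda>a b'. M a b' - M a b / M a0 b * M a0 b'"]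
    obtain c where c: "\<exists>a\<in>A'. c a \<noteq> 0"
      "\<forall>b'\<in>B. (\<Sum>a\<in>A'. c a * (M a b' - M a b / M a0 b * M a0 b')) = 0"
      by blast
    define c0 where "c0 = - (\<Sum>a\<in>A'. c a * M a b) / M a0 b"
    define c' where "c' = c(a0 := c0)"
    have split: "(\<Sum>a\<in>A. c' a * N a) = c0 * N a0 + (\<Sum>a\<in>A'. c a * N a)" for N
    proof -
      have "(\<Sum>a\<in>A'. c' a * N a) = (\<Sum>a\<in>A'. c a * N a)"
        using A by (intro sum.cong) (auto simp: c'_def)
      then show ?thesis using A by (simp add: c'_def)
    qed
    have "(\<Sum>a\<in>A. c' a * M a b') = 0" if "b' \<in> insert b B" for b'
    proof (cases "b' = b")
      case True
      then show ?thesis using a0 by (simp add: split c0_def)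
    next
      case False
      with that have "b' \<in> B" by simp
      with c(2) have "(\<Sum>a\<in>A'. c a * M a b') = (\<Sum>a\<in>A'. c a * M a b) / M a0 b * M a0 b'"
        by (simp add: algebra_simps sum_subtractf sum_distrib_left sum_distrib_right sum_divide_distrib)
      then show ?thesis by (simp add: split c0_def)
    qed
    moreover have "\<exists>a\<in>A. c' a \<noteq> 0" using c(1) A by (auto simp: c'_def)
    ultimately show ?thesis by blast
  qed
qed

text \<open>Convention for \<open>poly poly\<close>: the outer variable is y, the inner one x, and
  the value at (x, y) is \<open>poly (poly P [:y:]) x\<close>. The predicate bounds the degree in
  x.\<close>

definition inner_degree_le :: "nat \<Rightarrow> 'a::zero poly poly \<Rightarrow> bool" where
  "inner_degree_le n P \<longleftrightarrow> (\<forall>i. degree (coeff P i) \<le> n)"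

lemma inner_degree_leD: "inner_degree_le n P \<Longrightarrow> degree (coeff P i) \<le> n"
  by (simp add: inner_degree_le_def)

lemma inner_degree_le_mono: "inner_degree_le m P \<Longrightarrow> m \<le> n \<Longrightarrow> inner_degree_le n P"
  unfolding inner_degree_le_def by (meson le_trans)

lemma inner_degree_le_0 [simp]: "inner_degree_le n 0"
  by (simp add: inner_degree_le_def)

lemma inner_degree_le_add:
  "inner_degree_le n P \<Longrightarrow> inner_degree_le n Q \<Longrightarrow> inner_degree_le n (P + Q)"
  by (auto simp: inner_degree_le_def intro: degree_add_le)

lemma inner_degree_le_minus:
  fixes P :: "'a::ab_group_add poly poly"
  shows "inner_degree_le n P \<Longrightarrow> inner_degree_le n (- P)"
  by (auto simp: inner_degree_le_def)

lemma inner_degree_le_diff: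
  fixes P :: "'a::ab_group_add poly poly"
  shows "inner_degree_le n P \<Longrightarrow> inner_degree_le n Q \<Longrightarrow> inner_degree_le n (P - Q)"
  by (auto simp: inner_degree_le_def intro: degree_diff_le)

lemma inner_degree_le_sum:
  "(\<And>i. i \<in> A \<Longrightarrow> inner_degree_le n (P i)) \<Longrightarrow> inner_degree_le n (\<Sum>i\<in>A. P i)"
  by (induction A rule: infinite_finite_induct) (auto intro: inner_degree_le_add)

lemma inner_degree_le_mult:
  fixes P Q :: "'a::comm_semiring_0 poly poly"
  assumes "inner_degree_le m P" "inner_degree_le n Q"
  shows "inner_degree_le (m + n) (P * Q)"
  unfolding inner_degree_le_def coeff_mult
proof (intro allI degree_sum_le)
  fix i j
  have "degree (coeff P j * coeff Q (i - j)) \<le> degree (coeff P j) + degree (coeff Q (i - j))"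
    by (rule degree_mult_le)
  also have "\<dots> \<le> m + n" using assms by (auto simp: inner_degree_le_def intro: add_mono)
  finally show "degree (coeff P j * coeff Q (i - j)) \<le> m + n" .
qed auto

lemma inner_degree_le_power:
  fixes P :: "'a::comm_semiring_1 poly poly"
  assumes "inner_degree_le m P"
  shows "inner_degree_le (k * m) (P ^ k)"
proof (induction k)
  case 0
  show ?case by (simp add: inner_degree_le_def coeff_1)
next
  case (Suc k)
  then show ?case using inner_degree_le_mult[OF assms Suc] by simp
qed

lemma inner_degree_le_monom: "degree p \<le> n \<Longrightarrow> inner_degree_le n (monom p k)"
  by (auto simp: inner_degree_le_def)

lemma inner_degree_le_exists: "\<exists>n. inner_degree_le n P"
proof -
  have "degree (coeff P i) \<le> Max ((\<lambda>i. degree (coeff P i)) ` {..degree P})" for i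
  proof (cases "i \<le> degree P")
    case False
    then show ?thesis by (simp add: coeff_eq_0)
  qed simp
  then show ?thesis by (auto simp: inner_degree_le_def)
qed

text \<open>Each division step multiplies a coefficient into \<open>f\<close>, which costs at most
  \<open>k\<close> in the inner degree, and at most \<open>b\<close> steps occur.\<close>

lemma reduce_modulo_monic:
  fixes f P :: "'a::idom poly poly"
  assumes f: "lead_coeff f = 1" "degree f > 0" "inner_degree_le k f"
    and "degree P \<le> b" "inner_degree_le a P"
  shows "\<exists>r. f dvd P - r \<and> degree r < degree f \<and> inner_degree_le (a + k * b) r"
  using assms(4,5)
proof (induction b arbitrary: P a)
  case 0
  then show ?case using f by (intro exI[of _ P]) auto
next
  case (Suc b)
  show ?case
  proof (cases "degree P < degree f")
    case True
    then show ?thesis using Suc.prems by (intro exI[of _ P]) (auto intro: inner_degree_le_mono)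
  next
    case False
    define S where "S = monom (lead_coeff P) (degree P - degree f) * f"
    have P0: "degree P > 0" using False f by linarith
    then have "P \<noteq> 0" by auto
    moreover have "f \<noteq> 0" using f by auto
    ultimately have S: "degree S = degree P" "lead_coeff S = lead_coeff P"
      using False f by (auto simp: S_def degree_mult_eq degree_monom_eq coeff_monom_mult)
    have "degree (P - S) < degree P"
      using S P0 by (metis coeff_diff degree_diff_le diff_self leading_coeff_0_iff
          le_neq_implies_less order_refl degree_0)
    then have deg: "degree (P - S) \<le> b" using Suc.prems by linarith
    have "inner_degree_le (a + k) S"
      unfolding S_def using Suc.prems f
      by (intro inner_degree_le_mult inner_degree_le_monom inner_degree_leD) auto
    then have "inner_degree_le (a + k) (P - S)"
      using Suc.prems by (intro inner_degree_le_diff) (auto intro: inner_degree_le_mono)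
    from Suc.IH[OF deg this] obtain r where
      r: "f dvd P - S - r" "degree r < degree f" "inner_degree_le (a + k + k * b) r" by blast
    have "f dvd (P - S - r) + S" using r(1) by (intro dvd_add) (auto simp: S_def)
    then show ?thesis using r by (intro exI[of _ r]) (auto simp: algebra_simps)
  qed
qed

text \<open>Reduction modulo \<open>f\<close> is linear over the constants, so this is a linear
  system: one equation for each \<open>j\<close>, each outer exponent in \<open>S\<close> and each
  inner exponent. Omitting only the exponent 0 from \<open>S\<close> leaves a residue in x alone;
  taking all exponents forces divisibility by \<open>f\<close>.\<close>

lemma combination_with_vanishing_residues:
  fixes f :: "'a::field poly poly" and p :: "'i \<Rightarrow> 'j \<Rightarrow> 'a poly poly"
  assumes f: "lead_coeff f = 1" "degree f > 0" "inner_degree_le k f"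
    and fin: "finite A" "finite J" "finite S"
    and p: "\<And>i j. i \<in> A \<Longrightarrow> j \<in> J \<Longrightarrow> degree (p i j) \<le> b \<and> inner_degree_le a (p i j)"
    and count: "card J * (card S * (a + k * b + 1)) < card A"
  shows "\<exists>c. (\<exists>i\<in>A. c i \<noteq> 0) \<and> (\<forall>j\<in>J. \<exists>r. f dvd (\<Sum>i\<in>A. smult [:c i:] (p i j)) - r
           \<and> degree r < degree f \<and> inner_degree_le (a + k * b) r \<and> (\<forall>s\<in>S. coeff r s = 0))"
proof -
  have "\<exists>r. f dvd p i j - r \<and> degree r < degree f \<and> inner_degree_le (a + k * b) r"
    if "i \<in> A" "j \<in> J" for i j
    using reduce_modulo_monic[OF f] p[OF that] by blast
  then obtain red where red: "\<And>i j. i \<in> A \<Longrightarrow> j \<in> J \<Longrightarrow>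
      f dvd p i j - red i j \<and> degree (red i j) < degree f \<and> inner_degree_le (a + k * b) (red i j)"
    by metis
  define B where "B = J \<times> S \<times> {..a + k * b}"
  have "finite B" "card B < card A"
    using fin count by (auto simp: B_def card_cartesian_product)
  from homogeneous_system_solution[OF this(1) fin(1) this(2),
      of "\<lambda>i (j, s, l). coeff (coeff (red i j) s) l"]
  obtain c where c: "\<exists>i\<in>A. c i \<noteq> 0"
    "\<forall>x\<in>B. (\<Sum>i\<in>A. c i * (case x of (j, s, l) \<Rightarrow> coeff (coeff (red i j) s) l)) = 0"
    by blast
  have "\<exists>r. f dvd (\<Sum>i\<in>A. smult [:c i:] (p i j)) - r
           \<and> degree r < degree f \<and> inner_degree_le (a + k * b) r \<and> (\<forall>s\<in>S. coeff r s = 0)"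
    if j: "j \<in> J" for j
  proof (intro exI conjI ballI)
    let ?r = "\<Sum>i\<in>A. smult [:c i:] (red i j)"
    have "(\<Sum>i\<in>A. smult [:c i:] (p i j)) - ?r = (\<Sum>i\<in>A. smult [:c i:] (p i j - red i j))"
      by (simp add: sum_subtractf smult_diff_right)
    also have "f dvd \<dots>" using red j by (intro dvd_sum dvd_smult) auto
    finally show "f dvd (\<Sum>i\<in>A. smult [:c i:] (p i j)) - ?r" .
    show "degree ?r < degree f"
      using red j f(2) by (intro degree_sum_less) (auto intro: le_less_trans[OF degree_smult_le])
    show deg: "inner_degree_le (a + k * b) ?r"
    proof (intro inner_degree_le_sum)
      fix i assume "i \<in> A"
      then have "inner_degree_le (a + k * b) (red i j)" using red j by blast
      then show "inner_degree_le (a + k * b) (smult [:c i:] (red i j))"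
        by (auto simp: inner_degree_le_def)
    qed
    fix s assume s: "s \<in> S"
    show "coeff ?r s = 0"
    proof (rule poly_eqI)
      fix l
      show "coeff (coeff ?r s) l = coeff 0 l"
      proof (cases "l \<le> a + k * b")
        case True
        then have "(j, s, l) \<in> B" using j s by (auto simp: B_def)
        with c(2) have "(\<Sum>i\<in>A. c i * coeff (coeff (red i j) s) l) = 0" by fastforce
        then show ?thesis by (simp add: coeff_sum)
      next
        case False
        then show ?thesis using inner_degree_leD[OF deg, of s] by (simp add: coeff_eq_0)
      qed
    qed
  qed
  with c(1) show ?thesis by blast
qed

definition monomial2 :: "nat \<Rightarrow> nat \<Rightarrow> 'a::comm_semiring_1 poly poly" where
  "monomial2 a b = monom (monom 1 a) b"

lemma inner_degree_le_monomial2: "inner_degree_le a (monomial2 a b)"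
  unfolding monomial2_def by (intro inner_degree_le_monom degree_monom_le)

lemma degree_monomial2_le: "degree (monomial2 a b) \<le> b"
  unfolding monomial2_def by (rule degree_monom_le)

lemma poly_monomial2: "poly (monomial2 a b) H = monom 1 a * H ^ b"
  by (simp add: monomial2_def poly_monom)

lemma coeff_sum_monomial2:
  fixes c :: "nat \<Rightarrow> nat \<Rightarrow> 'a::comm_ring_1"
  shows "coeff (coeff (\<Sum>b<D. \<Sum>a<L. smult [:c a b:] (monomial2 a b)) j) i
           = (if i < L \<and> j < D then c i j else 0)"
proof -
  have "coeff (coeff (\<Sum>b<D. \<Sum>a<L. smult [:c a b:] (monomial2 a b)) j) i
       = (\<Sum>b<D. \<Sum>a<L. if b = j then (if a = i then c a b else 0) else 0)"
    by (simp add: coeff_sum monomial2_def smult_monom coeff_monom if_distrib[of "\<lambda>x. coeff x i"]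
        cong: if_cong)
  also have "\<dots> = (\<Sum>b<D. if b = j then (if i < L then c i b else 0) else 0)"
    by (intro sum.cong) auto
  finally show ?thesis by auto
qed

lemma degree_sum_monomial2_less:
  fixes c :: "nat \<Rightarrow> nat \<Rightarrow> 'a::comm_ring_1"
  assumes "D > 0"
  shows "degree (\<Sum>b<D. \<Sum>a<L. smult [:c a b:] (monomial2 a b)) < D"
  using assms degree_monomial2_le
  by (intro degree_sum_less) (auto intro: le_less_trans[OF degree_smult_le] le_less_trans)

text \<open>A substitute for the norm of \<open>u\<close> over the rational function field in \<open>x\<close>.\<close>

lemma bounded_norm_multiple:
  fixes f u :: "'a::field poly poly"
  assumes f: "lead_coeff f = 1" "degree f > 0" "inner_degree_le k f" "prime_elem f"
    and u: "u \<noteq> 0" "degree u < degree f" "inner_degree_le L u"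
  shows "\<exists>v n. f dvd u * v - [:n:] \<and> n \<noteq> 0
           \<and> degree n \<le> L + degree f * (L + 2 * k * degree f) + 2 * k * degree f"
proof -
  define D where "D = degree f"
  \<comment> \<open>The multiplier has \<open>D * (L' + 1)\<close> unknown coefficients, against
    \<open>(D - 1) * (L + L' + 2 * k * D + 1)\<close> equations that kill the outer exponents from 1
    to \<open>D - 1\<close>; this \<open>L'\<close> makes the unknowns prevail.\<close>
  define L' where "L' = D * (L + 2 * k * D)"
  have D: "D > 0" using f by (simp add: D_def)
  let ?A = "{..<D} \<times> {..<Suc L'}"
  let ?p = "\<lambda>(b, a) (_::unit). u * monomial2 a b"
  have deg: "degree (?p i j) \<le> 2 * D \<and> inner_degree_le (L + L') (?p i j)" if iA: "i \<in> ?A" for i j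
  proof -
    obtain b a where i: "i = (b, a)" "b < D" "a \<le> L'" using iA by (cases i) auto
    have "degree (u * monomial2 a b) \<le> degree u + degree (monomial2 a b :: 'a poly poly)"
      by (rule degree_mult_le)
    also have "\<dots> \<le> 2 * D" using u(2) i degree_monomial2_le[of a b, where 'a='a] by (simp add: D_def)
    finally show ?thesis using i u(3)
      by (auto intro!: inner_degree_le_mult intro: inner_degree_le_mono[OF inner_degree_le_monomial2])
  qed
  have "card {()} * (card {1..<D} * (L + L' + k * (2 * D) + 1)) < card ?A"
  proof -
    obtain D' where D': "D = Suc D'" using D by (cases D) auto
    show ?thesis by (simp add: card_cartesian_product L'_def D' algebra_simps)
  qed
  from combination_with_vanishing_residues[where J="{()}" and S="{1..<D}" and p = ?p,
      OF f(1-3) _ _ _ deg this]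
  obtain c where c: "\<exists>i\<in>?A. c i \<noteq> 0"
    and "\<exists>r. f dvd (\<Sum>i\<in>?A. smult [:c i:] (?p i ())) - r
           \<and> degree r < degree f \<and> inner_degree_le (L + L' + k * (2 * D)) r \<and> (\<forall>s\<in>{1..<D}. coeff r s = 0)"
    by auto
  then obtain r where r: "f dvd (\<Sum>i\<in>?A. smult [:c i:] (?p i ())) - r" "degree r < degree f"
     "inner_degree_le (L + L' + k * (2 * D)) r" "\<forall>s\<in>{1..<D}. coeff r s = 0"
    by blast
  define v where "v = (\<Sum>b<D. \<Sum>a<Suc L'. smult [:c (b, a):] (monomial2 a b))"
  have "(\<Sum>i\<in>?A. smult [:c i:] (?p i ())) = (\<Sum>(b, a)\<in>?A. u * smult [:c (b, a):] (monomial2 a b))"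
    by (intro sum.cong) auto
  also have "\<dots> = u * v"
    unfolding v_def sum.cartesian_product by (simp add: sum_distrib_left case_prod_unfold)
  finally have uv: "f dvd u * v - r" using r(1) by simp
  have "coeff r s = 0" if "s > 0" for s
    using r(2,4) that by (cases "s < D") (auto simp: D_def coeff_eq_0)
  then have rn: "r = [:coeff r 0:]"
    by (metis (no_types, lifting) degree_eq_zeroE le_degree leading_coeff_neq_0 coeff_pCons_0
        degree_0 gr0I)
  have vc: "coeff (coeff v j) i = (if i < Suc L' \<and> j < D then c (j, i) else 0)" for i j
    unfolding v_def by (rule coeff_sum_monomial2)
  from c obtain b a where "b < D" "a < Suc L'" "c (b, a) \<noteq> 0" by auto
  with vc[of b a] have v: "v \<noteq> 0" by auto
  have vd: "degree v < D" unfolding v_def using D by (rule degree_sum_monomial2_less)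
  have "r \<noteq> 0"
  proof
    assume "r = 0"
    with uv have "f dvd u * v" by simp
    with f(4) have "f dvd u \<or> f dvd v" by (rule prime_elem_dvd_multD)
    then show False using u v vd by (auto dest: dvd_imp_degree_le simp: D_def)
  qed
  then show ?thesis
    using uv rn inner_degree_leD[OF r(3), of 0]
    by (intro exI[of _ v] exI[of _ "coeff r 0"]) (auto simp: L'_def D_def algebra_simps)
qed

section \<open>Local expansion at a smooth point of the curve\<close>

lemma poly_dvd_poly: "p dvd q \<Longrightarrow> poly p x dvd poly q x"
  for p :: "'a::comm_semiring_1 poly"
  by (auto elim!: dvdE)

lemma taylor_quadratic:
  fixes f :: "'a::idom poly"
  shows "\<exists>k. poly f (H + e) = poly f H + e * poly (pderiv f) H + e ^ 2 * k"
proof (induction f)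
  case 0
  then show ?case by simp
next
  case (pCons a f)
  then obtain k where "poly f (H + e) = poly f H + e * poly (pderiv f) H + e ^ 2 * k" by blast
  then show ?case
    by (intro exI[of _ "poly (pderiv f) H + (H + e) * k"])
      (simp add: pderiv_pCons algebra_simps power2_eq_square)
qed

lemma poly_poly_specialize: "poly (poly P H) x = poly (poly P [:poly H x:]) x"
  for P :: "'a::comm_ring_1 poly poly"
  by (induction P) simp_all

lemma poly_poly_const: "poly (poly P [:y:]) x = poly (map_poly (\<lambda>c. poly c x) P) y"
  for P :: "'a::comm_ring_1 poly poly"
  by (induction P) (simp_all add: map_poly_pCons)

lemma pderiv_map_poly_poly:
  "pderiv (map_poly (\<lambda>c. poly c x) P) = map_poly (\<lambda>c. poly c x) (pderiv P)"
  for P :: "'a::idom poly poly"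
  by (intro poly_eqI) (simp add: coeff_pderiv coeff_map_poly)

text \<open>Newton iteration along the branch through a smooth point: the Taylor remainder vanishes
  to twice the order of the correction \<open>e\<close>, and \<open>c\<close> solves the first-order
  equation.\<close>

lemma truncated_hensel:
  fixes f :: "'a::field poly poly"
  assumes "poly (poly f [:y0:]) x0 = 0" "poly (poly (pderiv f) [:y0:]) x0 \<noteq> 0"
  shows "\<exists>H. [:-x0, 1:] ^ Suc N dvd poly f H \<and> poly H x0 = y0"
proof (induction N)
  case 0
  then show ?case using assms by (intro exI[of _ "[:y0:]"]) (simp add: poly_eq_0_iff_dvd)
next
  case (Suc N)
  define z where "z = [:-x0, 1:]"
  from Suc obtain H g where H: "poly f H = z ^ Suc N * g" "poly H x0 = y0"
    by (auto simp: z_def elim: dvdE)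
  define d where "d = poly (pderiv f) H"
  have d: "poly d x0 \<noteq> 0"
    unfolding d_def using assms H by (subst poly_poly_specialize) simp
  define c where "c = - poly g x0 / poly d x0"
  define e where "e = z ^ Suc N * [:c:]"
  obtain k where k: "poly f (H + e) = poly f H + e * d + e ^ 2 * k"
    using taylor_quadratic d_def by blast
  have "poly (g + [:c:] * d) x0 = 0" using d by (simp add: c_def)
  then have "z dvd g + [:c:] * d" unfolding z_def by (simp only: poly_eq_0_iff_dvd)
  then have "z ^ Suc N * z dvd z ^ Suc N * (g + [:c:] * d)" by (rule mult_dvd_mono[OF dvd_refl])
  also have "z ^ Suc N * (g + [:c:] * d) = poly f H + e * d" by (simp only: H e_def distrib_left mult.assoc)
  finally have 1: "z ^ Suc (Suc N) dvd poly f H + e * d" by (simp add: mult_ac)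
  have "z ^ Suc (Suc N) dvd z ^ (2 * Suc N)" by (intro le_imp_power_dvd) simp
  moreover have "e ^ 2 = z ^ (2 * Suc N) * [:c:] ^ 2"
    unfolding e_def power_mult_distrib by (simp only: power_mult[symmetric] mult.commute)
  ultimately have "z ^ Suc (Suc N) dvd e ^ 2 * k" by auto
  with 1 have "z ^ Suc (Suc N) dvd poly f (H + e)" unfolding k by (rule dvd_add)
  moreover have "poly (H + e) x0 = y0" using H by (simp add: e_def z_def)
  ultimately show ?case unfolding z_def by blast
qed

text \<open>Raising to a power of the characteristic is additive, so such a power agrees with a
  constant to order \<open>CHAR('a) ^ e\<close> at any point.\<close>

lemma poly_frobenius_power:
  fixes g :: "'a::idom poly"
  assumes "prime CHAR('a)"
  shows "[:-x0, 1:] ^ (CHAR('a) ^ e) dvd g ^ (CHAR('a) ^ e) - [:poly g x0:] ^ (CHAR('a) ^ e)"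
proof -
  let ?N = "CHAR('a) ^ e"
  have "[:-x0, 1:] dvd g - [:poly g x0:]" by (simp flip: poly_eq_0_iff_dvd)
  then have 1: "[:-x0, 1:] ^ ?N dvd (g - [:poly g x0:]) ^ ?N" by (rule dvd_power_same)
  have "((g - [:poly g x0:]) + [:poly g x0:]) ^ ?N = (g - [:poly g x0:]) ^ ?N + [:poly g x0:] ^ ?N"
    using assms by (intro freshmans_dream') auto
  then have "g ^ ?N - [:poly g x0:] ^ ?N = (g - [:poly g x0:]) ^ ?N" by simp
  with 1 show ?thesis by simp
qed

text \<open>A relation, expanded at a smooth point of the curve \<open>f = 0\<close>, would force a nonzero
  combination of the monomials to vanish there to order \<open>N\<close>.\<close>

lemma monomials_independent_over_frobenius_powers:
  fixes f :: "'a::field poly poly" and g :: "nat \<Rightarrow> nat \<Rightarrow> 'a poly poly"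
  assumes char: "prime CHAR('a)"
    and f: "lead_coeff f = 1" "degree f > 0" "inner_degree_le k f" "prime_elem f"
    and pt: "poly (poly f [:y0:]) x0 = 0" "poly (poly (pderiv f) [:y0:]) x0 \<noteq> 0"
    and g: "\<And>a b. degree (g a b) < degree f"
    and nz: "a0 < L" "b0 < degree f" "g a0 b0 \<noteq> 0"
    and N: "N = CHAR('a) ^ e" "L + degree f * (L + 2 * k * degree f) + 2 * k * degree f < N"
  shows "\<not> f dvd (\<Sum>b<degree f. \<Sum>a<L. monomial2 a b * g a b ^ N)"
proof
  assume dvd: "f dvd (\<Sum>b<degree f. \<Sum>a<L. monomial2 a b * g a b ^ N)"
  define D where "D = degree f"
  define z where "z = [:-x0, 1:]"
  have z: "degree z = 1" "z \<noteq> 0" by (auto simp: z_def)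
  have N0: "N > 0" using N(2) by linarith
  \<comment> \<open>Along the branch \<open>H\<close>, modulo the equation of the curve,
    \<open>u\<close> divides the nonzero \<open>n\<close> in x alone. Its order of vanishing is
    therefore at most \<open>degree n\<close>, as far as the precision \<open>m'\<close> of
    \<open>H\<close> reaches.\<close>
  have order_bound: "\<exists>n :: 'a poly. n \<noteq> 0 \<and> degree n \<le> l + D * (l + 2 * k * D) + 2 * k * D \<and>
      (\<forall>H m m'. z ^ m' dvd poly f H \<longrightarrow> m \<le> m' \<longrightarrow> z ^ m dvd poly u H \<longrightarrow> m \<le> degree n)"
    if u: "u \<noteq> 0" "degree u < D" "inner_degree_le l u" for u l
  proof -
    from bounded_norm_multiple[OF f u(1) u(2)[unfolded D_def] u(3)] obtain v n
      where vn: "f dvd u * v - [:n:]" "n \<noteq> 0" "degree n \<le> l + D * (l + 2 * k * D) + 2 * k * D"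
      unfolding D_def by blast
    have "m \<le> degree n" if m: "z ^ m' dvd poly f H" "m \<le> m'" "z ^ m dvd poly u H" for H m m'
    proof -
      from vn(1) obtain w where "u * v - [:n:] = f * w" by (elim dvdE)
      then have "u * v = [:n:] + f * w" by (simp add: algebra_simps)
      then have "poly (u * v) H = poly ([:n:] + f * w) H" by simp
      then have "poly u H * poly v H = n + poly f H * poly w H" by simp
      moreover have "z ^ m dvd poly u H * poly v H" using m(3) by simp
      moreover have "z ^ m dvd poly f H * poly w H"
        using m(1,2) by (meson dvd_mult2 dvd_trans le_imp_power_dvd)
      ultimately have "z ^ m dvd n" by (metis dvd_add_left_iff)
      then have "degree (z ^ m) \<le> degree n" using vn(2) by (rule dvd_imp_degree_le)
      then show ?thesis using z by (simp add: degree_power_eq)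
    qed
    then show ?thesis using vn(2,3) by (intro exI[of _ n]) auto
  qed
  obtain l where "inner_degree_le l (g a0 b0)" using inner_degree_le_exists by blast
  from order_bound[OF nz(3) _ this] g obtain n0 :: "'a poly" where
    n0: "\<And>H m m'. z ^ m' dvd poly f H \<Longrightarrow> m \<le> m' \<Longrightarrow> z ^ m dvd poly (g a0 b0) H \<Longrightarrow> m \<le> degree n0"
    unfolding D_def by blast
  \<comment> \<open>Enough precision to divide by \<open>z ^ (m * N)\<close>, where \<open>m\<close>
    is at most \<open>degree n0\<close>, and still to compare \<open>N\<close> further
    orders.\<close>
  define M where "M = N * Suc (Suc (degree n0))"
  obtain H where H: "z ^ Suc M dvd poly f H"
    using truncated_hensel[OF pt] unfolding z_def by blast
  define P where "P = (\<lambda>m. \<forall>a<L. \<forall>b<D. z ^ m dvd poly (g a b) H)"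
  have "\<not> P (Suc (degree n0))"
  proof
    assume "P (Suc (degree n0))"
    then have "z ^ Suc (degree n0) dvd poly (g a0 b0) H" using nz by (simp add: P_def D_def)
    moreover have "Suc (degree n0) \<le> Suc M"
    proof -
      have "1 * Suc (degree n0) \<le> N * Suc (Suc (degree n0))" using N0 by (intro mult_le_mono) auto
      then show ?thesis by (simp add: M_def)
    qed
    ultimately have "Suc (degree n0) \<le> degree n0" using n0[OF H] by blast
    then show False by simp
  qed
  moreover have "P 0" by (simp add: P_def)
  ultimately obtain m where m: "m < Suc (degree n0)" "P m" "\<not> P (Suc m)"
    using ex_least_nat_less[of "\<lambda>m. \<not> P m"] by (metis order_refl)
  have "\<exists>\<gamma>. poly (g a b) H = z ^ m * \<gamma>" if "a < L" "b < D" for a b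
    using m(2) that unfolding P_def dvd_def by blast
  then obtain \<gamma> where \<gamma>: "\<And>a b. a < L \<Longrightarrow> b < D \<Longrightarrow> poly (g a b) H = z ^ m * \<gamma> a b" by metis
  obtain a1 b1 where ab1: "a1 < L" "b1 < D" "poly (\<gamma> a1 b1) x0 \<noteq> 0"
  proof -
    from m(3) obtain a b where ab: "a < L" "b < D" "\<not> z ^ Suc m dvd poly (g a b) H"
      by (auto simp: P_def)
    have "\<not> z dvd \<gamma> a b"
    proof
      assume "z dvd \<gamma> a b"
      then have "z ^ m * z dvd z ^ m * \<gamma> a b" by (rule mult_dvd_mono[OF dvd_refl])
      then show False using ab \<gamma>[OF ab(1,2)] by (simp add: mult.commute)
    qed
    then show ?thesis using that ab by (simp add: z_def poly_eq_0_iff_dvd)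
  qed
  \<comment> \<open>Here \<open>m\<close> is the least order among all \<open>g a b\<close> along
    the branch, so some \<open>\<gamma> a b\<close> is nonzero at \<open>x0\<close>. To order
    \<open>N\<close> each power \<open>\<gamma> a b ^ N\<close> is its constant term, which turns
    the relation into the vanishing of the nonzero \<open>u\<close> to order
    \<open>N\<close>.\<close>
  define u where "u = (\<Sum>b<D. \<Sum>a<L. smult [:poly (\<gamma> a b) x0 ^ N:] (monomial2 a b))"
  have uc: "coeff (coeff u j) i = (if i < L \<and> j < D then poly (\<gamma> i j) x0 ^ N else 0)" for i j
    unfolding u_def by (rule coeff_sum_monomial2)
  have u0: "u \<noteq> 0" using uc[of b1 a1] ab1 by auto
  have D: "D > 0" using f by (simp add: D_def)
  have ud: "degree u < D" unfolding u_def using D by (rule degree_sum_monomial2_less)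
  have ui: "inner_degree_le L u"
    unfolding inner_degree_le_def
  proof
    fix i
    show "degree (coeff u i) \<le> L" by (rule degree_le) (simp add: uc)
  qed
  have "poly f H dvd poly (\<Sum>b<D. \<Sum>a<L. monomial2 a b * g a b ^ N) H"
    using dvd unfolding D_def by (rule poly_dvd_poly)
  also have "poly (\<Sum>b<D. \<Sum>a<L. monomial2 a b * g a b ^ N) H
      = (\<Sum>b<D. \<Sum>a<L. monom 1 a * H ^ b * (z ^ m * \<gamma> a b) ^ N)"
    by (simp add: poly_sum poly_monomial2 \<gamma>)
  also have "\<dots> = z ^ (m * N) * (\<Sum>b<D. \<Sum>a<L. monom 1 a * H ^ b * \<gamma> a b ^ N)"
    unfolding power_mult power_mult_distrib by (simp add: sum_distrib_left mult_ac)
  finally have "z ^ Suc M dvd z ^ (m * N) * (\<Sum>b<D. \<Sum>a<L. monom 1 a * H ^ b * \<gamma> a b ^ N)"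
    using H dvd_trans by blast
  moreover have "m * N + N \<le> Suc M"
  proof -
    have "N * Suc m \<le> N * Suc (Suc (degree n0))" using m(1) by (intro mult_le_mono) auto
    then show ?thesis by (simp add: M_def algebra_simps)
  qed
  ultimately have "z ^ (m * N) * z ^ N dvd z ^ (m * N) * (\<Sum>b<D. \<Sum>a<L. monom 1 a * H ^ b * \<gamma> a b ^ N)"
    unfolding power_add[symmetric] by (blast intro: dvd_trans le_imp_power_dvd)
  then have 1: "z ^ N dvd (\<Sum>b<D. \<Sum>a<L. monom 1 a * H ^ b * \<gamma> a b ^ N)"
    using z by simp
  have "poly u H = (\<Sum>b<D. \<Sum>a<L. monom 1 a * H ^ b * [:poly (\<gamma> a b) x0:] ^ N)"
    by (simp add: u_def poly_sum poly_monomial2 poly_const_pow mult_ac)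
  then have "(\<Sum>b<D. \<Sum>a<L. monom 1 a * H ^ b * \<gamma> a b ^ N) - poly u H
      = (\<Sum>b<D. \<Sum>a<L. monom 1 a * H ^ b * (\<gamma> a b ^ N - [:poly (\<gamma> a b) x0:] ^ N))"
    by (simp add: sum_subtractf right_diff_distrib)
  also have "z ^ N dvd \<dots>"
    unfolding z_def N(1) by (intro dvd_sum dvd_mult poly_frobenius_power char)
  finally have "z ^ N dvd poly u H" using 1 dvd_diff[of "z ^ N"] by fastforce
  moreover obtain n :: "'a poly" where n: "degree n \<le> L + D * (L + 2 * k * D) + 2 * k * D"
    "\<And>H m m'. z ^ m' dvd poly f H \<Longrightarrow> m \<le> m' \<Longrightarrow> z ^ m dvd poly u H \<Longrightarrow> m \<le> degree n"
    using order_bound[OF u0 ud ui] by blast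
  moreover have "N \<le> Suc M" by (simp add: M_def)
  ultimately have "N \<le> degree n" using H by blast
  with n(1) N(2) show False by (simp add: D_def)
qed

text \<open>Each difference of powers is divisible by \<open>Y - y\<close>, and the double sum is
  regrouped by the exponent of \<open>Y\<close>. This is the relation of degree
  \<open>degree f - 1\<close> satisfied by a conjugate of \<open>y\<close> other than
  \<open>y\<close>.\<close>

lemma difference_quotient_sum:
  fixes f :: "'a::comm_ring_1 poly"
  shows "(Y - y) * (\<Sum>j<degree f. (\<Sum>i=Suc j..degree f. coeff f i * y ^ (i - Suc j)) * Y ^ j)
           = poly f Y - poly f y"
proof -
  let ?D = "degree f"
  have "(\<Sum>j<?D. (\<Sum>i=Suc j..?D. coeff f i * y ^ (i - Suc j)) * Y ^ j)
      = (\<Sum>j<?D. \<Sum>i=Suc j..?D. coeff f i * (y ^ (i - Suc j) * Y ^ j))"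
    by (simp add: sum_distrib_right mult.assoc)
  also have "\<dots> = (\<Sum>i\<le>?D. \<Sum>j<i. coeff f i * (y ^ (i - Suc j) * Y ^ j))"
    unfolding sum.Sigma[OF finite_lessThan ballI, OF finite_atLeastAtMost]
      sum.Sigma[OF finite_atMost ballI, OF finite_lessThan]
    by (intro sum.reindex_bij_witness[of _ prod.swap prod.swap]) auto
  also have "(Y - y) * \<dots> = (\<Sum>i\<le>?D. coeff f i * ((Y - y) * (\<Sum>j<i. y ^ (i - Suc j) * Y ^ j)))"
    by (simp add: sum_distrib_left mult_ac)
  also have "\<dots> = (\<Sum>i\<le>?D. coeff f i * (Y ^ i - y ^ i))"
    by (simp only: power_diff_sumr2)
  also have "\<dots> = poly f Y - poly f y"
    by (simp add: poly_altdef sum_subtractf algebra_simps)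
  finally show ?thesis .
qed

text \<open>Conditions on the left, unknowns on the right, both with a common factor
  \<open>D\<close>. Since \<open>I\<close> is at least \<open>R * (1 - 1 / (2 * D))\<close>, having
  \<open>D - 1\<close> instead of \<open>D\<close> conditions leaves a surplus of half of
  \<open>L * R\<close> with \<open>L = Suc (8 * k * D * D)\<close>. It absorbs the remaining terms,
  at most \<open>4 * k * D * R\<close> for each of the \<open>D - 1\<close> conditions; hence the
  constant 8.\<close>

lemma stepanov_count:
  fixes D R I k :: nat
  assumes "2 * D * R \<le> 2 * D * I + R" "I \<le> R" "R > 0" "D > 0" "k > 0"
  shows "(D - 1) * (D * (8 * k * D * D * R + I + k + k * (D * (R + 1)) + 1))
           < D * (D * (Suc (8 * k * D * D) * I))"
proof -
  obtain D' where D: "D = Suc D'" using assms by (cases D) auto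
  define M where "M = 8 * k * D * D"
  define kDR where "kDR = k * D * R"
  have "k * D * 1 \<le> kDR" "k * 1 * 1 \<le> kDR" "1 * 1 * 1 \<le> kDR"
    unfolding kDR_def using assms by (intro mult_le_mono; simp)+
  then have "k * D \<le> kDR" "k \<le> kDR" "1 \<le> kDR" by linarith+
  moreover have "k * (D * (R + 1)) = kDR + k * D" by (simp add: kDR_def algebra_simps)
  moreover have "Suc M * R = M * R + R" by simp
  ultimately have "M * R + I + k + k * (D * (R + 1)) + 1 \<le> Suc M * R + 4 * kDR"
    using assms(2) by linarith
  then have "2 * (D' * (M * R + I + k + k * (D * (R + 1)) + 1))
      \<le> 2 * (D' * (Suc M * R + 4 * kDR))"
    by (intro mult_le_mono2)
  also have "\<dots> = 2 * D' * (Suc M * R) + 8 * k * D * D' * R" by (simp add: kDR_def algebra_simps)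
  also have "\<dots> < 2 * D' * (Suc M * R) + Suc M * R"
  proof -
    have "8 * k * D * D' < Suc M" by (simp add: M_def D)
    then have "8 * k * D * D' * R < Suc M * R" using assms(3) by (rule mult_less_mono1)
    then show ?thesis by linarith
  qed
  also have "\<dots> = Suc M * (2 * D * R - R)" by (simp add: D algebra_simps)
  also have "\<dots> \<le> Suc M * (2 * D * I)" using assms(1) by (intro mult_le_mono) auto
  also have "\<dots> = 2 * (D * (Suc M * I))" by (simp only: mult_ac)
  finally have "D' * (M * R + I + k + k * (D * (R + 1)) + 1) < D * (Suc M * I)"
    by linarith
  then have "D * (D' * (M * R + I + k + k * (D * (R + 1)) + 1)) < D * (D * (Suc M * I))"
    using assms(4) by (intro mult_less_mono2)
  moreover have "D - 1 = D'" using D by simp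
  ultimately show ?thesis unfolding M_def by (simp only: mult.left_commute[of D'])
qed

text \<open>The auxiliary function is a sum of \<open>x^a y^b\<close> times \<open>N\<close>-th
  powers. Over a rational x its \<open>R\<close>-th power is a sum of \<open>W j * Y ^ j\<close>
  with \<open>Y = y ^ Q\<close>, and \<open>Y\<close> satisfies the monic relation with coefficients
  \<open>\<Gamma> j\<close>. So it vanishes once \<open>W j = \<Gamma> j * W (D - 1)\<close> on the
  curve for \<open>j < D - 1\<close>. These linear conditions have a nonzero solution; the function
  then has more zeros than its degree permits, so \<open>f\<close> divides it, against the
  independence of the monomials.\<close>

lemma stepanov_contradiction:
  fixes f :: "'a::alg_closed_field poly poly"
  assumes char: "prime CHAR('a)"
    and f: "lead_coeff f = 1" "degree f > 0" "inner_degree_le k f" "prime_elem f" and k: "k > 0"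
    and pt: "poly (poly f [:y0:]) x0 = 0" "poly (poly (pderiv f) [:y0:]) x0 \<noteq> 0"
    and D: "D = degree f" and L: "L = Suc (8 * k * D * D)"
    and N: "N = CHAR('a) ^ n" "L + D * (L + 2 * k * D) + 2 * k * D < N"
    and R: "R = CHAR('a) ^ m" and Q: "Q = R * N"
    and large: "2 * D * (L + k * (D * Suc N) + card bad) < Q"
    and bad: "finite bad"
    and card_Q: "card {x::'a. x ^ Q = x} = Q"
    and roots: "\<And>x. x \<notin> bad \<Longrightarrow> card {y. poly (poly f [:y:]) x = 0} = D"
    and conj: "\<And>x y. x \<notin> bad \<Longrightarrow> x ^ Q = x \<Longrightarrow> poly (poly f [:y:]) x = 0 \<Longrightarrow> poly (poly f [:y ^ Q:]) x = 0"
    and nofix: "\<And>x y. x \<notin> bad \<Longrightarrow> x ^ Q = x \<Longrightarrow> poly (poly f [:y:]) x = 0 \<Longrightarrow> y ^ Q \<noteq> y"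
  shows False
proof -
  have p: "CHAR('a) > 1" using char by (rule prime_gt_1_nat)
  have D0: "D > 0" using f D by simp
  have R0: "R > 0" using p R by simp
  \<comment> \<open>Slightly below \<open>R\<close>: then \<open>N * I\<close> falls short of
    \<open>Q\<close> by about \<open>Q / (2 * D)\<close>, which lets the zeros outnumber the degree,
    while enough unknowns remain.\<close>
  define I where "I = R - R div (2 * D)"
  have Idiv: "2 * D * (R div (2 * D)) \<le> R" "R < 2 * D * (R div (2 * D)) + 2 * D"
    using D0 dividend_less_times_div[of "2 * D" R] by auto
  have "R div (2 * D) \<le> R" by simp
  then have IR: "I + R div (2 * D) = R" by (simp add: I_def)
  have I1: "2 * D * R \<le> 2 * D * I + R" "I \<le> R" "2 * D * I + R \<le> 2 * D * R + 2 * D"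
  proof -
    have "2 * D * I + 2 * D * (R div (2 * D)) = 2 * D * R" by (simp only: IR flip: distrib_left)
    then show "2 * D * R \<le> 2 * D * I + R" "2 * D * I + R \<le> 2 * D * R + 2 * D"
      using Idiv by linarith+
    show "I \<le> R" by (simp add: I_def)
  qed
  define L0 where "L0 = 8 * k * D * D"
  define mono where "mono = (\<lambda>b a i. monomial2 (a * R + i) (b * R) :: 'a poly poly)"
  define \<gamma> where "\<gamma> = (\<lambda>j. \<Sum>i=Suc j..D. monom (coeff f i) (i - Suc j))"
  \<comment> \<open>The contribution of one unknown to
    \<open>W j' - \<Gamma> j' * W (D - 1)\<close>.\<close>
  define cond where "cond = (\<lambda>(j, b, a, i) j'.
      (if j = j' then mono b a i else 0) - (if j = D - 1 then \<gamma> j' * mono b a i else 0))"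
  define A where "A = {..<D} \<times> {..<D} \<times> {..<L} \<times> {..<I}"
  have finA: "finite A" by (simp add: A_def)
  have mono_deg: "degree (mono b a i) \<le> D * R" "inner_degree_le (L0 * R + I) (mono b a i)"
    if "b < D" "a < L" "i < I" for a b i
  proof -
    have "b * R \<le> D * R" "a * R + i \<le> L0 * R + I"
      using that L by (auto intro!: add_mono mult_le_mono simp: L0_def)
    then show "degree (mono b a i) \<le> D * R" "inner_degree_le (L0 * R + I) (mono b a i)"
      unfolding mono_def
      by (meson degree_monomial2_le le_trans, meson inner_degree_le_mono inner_degree_le_monomial2)
  qed
  have \<gamma>_deg: "degree (\<gamma> j) \<le> D" "inner_degree_le k (\<gamma> j)" for j
    unfolding \<gamma>_def using f(3)
    by (auto intro!: degree_sum_le order.trans[OF degree_monom_le] inner_degree_le_sum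
        inner_degree_le_monom inner_degree_leD)
  have cond_deg: "degree (cond idx j') \<le> D * (R + 1) \<and> inner_degree_le (L0 * R + I + k) (cond idx j')"
    if idxA: "idx \<in> A" for idx j'
  proof -
    obtain j b a i where idx: "idx = (j, b, a, i)" "b < D" "a < L" "i < I"
      using idxA unfolding A_def by fastforce
    note md = mono_deg[OF idx(2-4)]
    have 1: "degree (mono b a i) \<le> D * (R + 1)" "inner_degree_le (L0 * R + I + k) (mono b a i)"
      using md by (auto intro: inner_degree_le_mono)
    have "degree (\<gamma> j' * mono b a i) \<le> degree (\<gamma> j') + degree (mono b a i)" by (rule degree_mult_le)
    also have "\<dots> \<le> D * (R + 1)" using md(1) \<gamma>_deg(1)[of j'] by simp
    finally have 2: "degree (\<gamma> j' * mono b a i) \<le> D * (R + 1)" .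
    have 3: "inner_degree_le (L0 * R + I + k) (\<gamma> j' * mono b a i)"
      using inner_degree_le_mult[OF md(2) \<gamma>_deg(2)] by (simp add: mult.commute)
    show ?thesis unfolding cond_def idx(1) using 1 2 3
      by (auto intro!: degree_diff_le inner_degree_le_diff inner_degree_le_minus)
  qed
  have "card {..<D - 1} * (card {..<D} * (L0 * R + I + k + k * (D * (R + 1)) + 1)) < card A"
    using stepanov_count[OF I1(1,2) R0 D0 k]
    by (simp add: A_def card_cartesian_product L0_def L)
  from combination_with_vanishing_residues[where J="{..<D - 1}" and S="{..<D}" and p=cond,
      OF f(1-3) finA finite_lessThan finite_lessThan cond_deg this]
  obtain c where c: "\<exists>idx\<in>A. c idx \<noteq> 0" and cr: "\<forall>j\<in>{..<D - 1}. \<exists>r. f dvd (\<Sum>idx\<in>A. smult [:c idx:] (cond idx j)) - r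
           \<and> degree r < degree f \<and> inner_degree_le (L0 * R + I + k + k * (D * (R + 1))) r \<and> (\<forall>s\<in>{..<D}. coeff r s = 0)"
    by blast
  have c0: "f dvd (\<Sum>idx\<in>A. smult [:c idx:] (cond idx j))" if jD: "j < D - 1" for j
  proof -
    from cr jD obtain r where r: "f dvd (\<Sum>idx\<in>A. smult [:c idx:] (cond idx j)) - r"
      "degree r < D" "\<forall>s\<in>{..<D}. coeff r s = 0" by (auto simp: D)
    have "coeff r (degree r) = 0" using r(2,3) by blast
    then have "r = 0" by simp
    then show ?thesis using r(1) by simp
  qed
  have Q0: "Q > 0" using large by linarith
  \<comment> \<open>The coefficients of \<open>g\<close> get raised to the power
    \<open>N * R = Q\<close> in the end, so they are taken to be \<open>Q\<close>-th roots of the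
    solution \<open>c\<close>.\<close>
  have "\<forall>idx. \<exists>y. y ^ Q = c idx" using nth_root_exists[OF Q0] by blast
  from choice[OF this] obtain \<kappa> where \<kappa>: "\<And>idx. \<kappa> idx ^ Q = c idx" by blast
  define g where "g = (\<lambda>a b. \<Sum>j<D. \<Sum>i<I. smult [:\<kappa> (j, b, a, i):] (monomial2 i j))"
  define G where "G = (\<Sum>b<D. \<Sum>a<L. monomial2 a b * g a b ^ N)"
  have g_deg: "degree (g a b) < degree f" for a b
    unfolding g_def D[symmetric] using D0 by (rule degree_sum_monomial2_less)
  have g_coeff: "coeff (coeff (g a b) j) i = (if i < I \<and> j < D then \<kappa> (j, b, a, i) else 0)" for a b i j
    unfolding g_def by (rule coeff_sum_monomial2)
  have g_inner: "inner_degree_le (I - 1) (g a b)" for a b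
    unfolding inner_degree_le_def
  proof
    fix i
    show "degree (coeff (g a b) i) \<le> I - 1" by (rule degree_le) (auto simp: g_coeff)
  qed
  have "\<not> f dvd G"
  proof -
    from c obtain j b a i where idx: "j < D" "b < D" "a < L" "i < I" "c (j, b, a, i) \<noteq> 0"
      unfolding A_def by fastforce
    then have "\<kappa> (j, b, a, i) \<noteq> 0" using \<kappa>[of "(j, b, a, i)"] Q0 by (auto simp: zero_power)
    then have "g a b \<noteq> 0" using g_coeff[of a b j i] idx by auto
    then show ?thesis
      unfolding G_def D
      using monomials_independent_over_frobenius_powers[OF char f pt g_deg idx(3) _ _ N(1), of b]
        idx(2) N(2) by (simp add: D)
  qed
  have vanish: "poly (poly G [:y:]) x = 0" if x: "x \<notin> bad" "x ^ Q = x" and y: "poly (poly f [:y:]) x = 0" for x y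
  proof -
    define Y where "Y = y ^ Q"
    define \<Gamma> where "\<Gamma> = (\<lambda>j. poly (poly (\<gamma> j) [:y:]) x)"
    define W where "W = (\<lambda>j. \<Sum>b<D. \<Sum>a<L. \<Sum>i<I. c (j, b, a, i) * (x ^ (a * R + i) * y ^ (b * R)))"
    have ev_mono: "poly (poly (mono b a i) [:y:]) x = x ^ (a * R + i) * y ^ (b * R)" for b a i
      by (simp add: mono_def poly_monomial2 poly_monom poly_const_pow)
    have ev_cond: "poly (poly (cond (j, b, a, i) j') [:y:]) x
        = (if j = j' then x ^ (a * R + i) * y ^ (b * R) else 0)
          - (if j = D - 1 then \<Gamma> j' * (x ^ (a * R + i) * y ^ (b * R)) else 0)" for j b a i j'
      by (simp add: cond_def ev_mono \<Gamma>_def)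
    have W: "W j' = \<Gamma> j' * W (D - 1)" if j': "j' < D - 1" for j'
    proof -
      from c0[OF j'] have "poly (poly f [:y:]) x dvd poly (poly (\<Sum>idx\<in>A. smult [:c idx:] (cond idx j')) [:y:]) x"
        by (intro poly_dvd_poly)
      then have "0 = poly (poly (\<Sum>idx\<in>A. smult [:c idx:] (cond idx j')) [:y:]) x" using y by simp
      also have "\<dots> = (\<Sum>j<D. \<Sum>b<D. \<Sum>a<L. \<Sum>i<I. c (j, b, a, i) * poly (poly (cond (j, b, a, i) j') [:y:]) x)"
        by (simp add: A_def poly_sum sum.cartesian_product case_prod_unfold)
      also have "\<dots> = (\<Sum>j<D. (if j = j' then W j else 0) - (if j = D - 1 then \<Gamma> j' * W j else 0))"
        by (intro sum.cong refl)
          (auto simp: ev_cond W_def sum_distrib_left sum_subtractf right_diff_distrib mult_ac)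
      also have "\<dots> = W j' - \<Gamma> j' * W (D - 1)"
        using j' by (simp add: sum_subtractf)
      finally show ?thesis by simp
    qed
    have "coeff f D = 1" using f by (simp add: D)
    then have \<Gamma>1: "\<Gamma> (D - 1) = 1" using D0 by (simp add: \<Gamma>_def \<gamma>_def monom_0)
    have fx: "degree (map_poly (\<lambda>c. poly c x) f) = D"
      unfolding D using f by (intro map_poly_degree_eq) auto
    have \<Gamma>_eq: "\<Gamma> j = (\<Sum>i=Suc j..D. poly (coeff f i) x * y ^ (i - Suc j))" for j
      by (simp add: \<Gamma>_def \<gamma>_def poly_sum poly_monom poly_const_pow mult.commute)
    have "(Y - y) * (\<Sum>j<D. \<Gamma> j * Y ^ j) = poly (poly f [:Y:]) x - poly (poly f [:y:]) x"
      using difference_quotient_sum[of Y y "map_poly (\<lambda>c. poly c x) f"] unfolding fx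
      by (simp add: poly_poly_const coeff_map_poly \<Gamma>_eq)
    also have "\<dots> = 0" using conj[OF x y] y by (simp add: Y_def)
    finally have \<Gamma>0: "(\<Sum>j<D. \<Gamma> j * Y ^ j) = 0" using nofix[OF x y] by (simp add: Y_def)
    have Wj: "W j = \<Gamma> j * W (D - 1)" if "j < D" for j
      using W[of j] \<Gamma>1 that by (cases "j = D - 1") auto
    have "W j * Y ^ j = \<Gamma> j * Y ^ j * W (D - 1)" if "j < D" for j
      unfolding Wj[OF that] by (rule mult.commute[THEN trans]) (simp only: mult_ac)
    then have "(\<Sum>j<D. W j * Y ^ j) = (\<Sum>j<D. \<Gamma> j * Y ^ j) * W (D - 1)"
      unfolding sum_distrib_right by (intro sum.cong) auto
    then have 0: "(\<Sum>j<D. W j * Y ^ j) = 0" using \<Gamma>0 by simp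
    have "poly (poly G [:y:]) x = (\<Sum>b<D. \<Sum>a<L. x ^ a * y ^ b * (\<Sum>j<D. \<Sum>i<I. \<kappa> (j, b, a, i) * (x ^ i * y ^ j)) ^ N)"
      by (simp add: G_def g_def poly_sum poly_monomial2 poly_monom poly_const_pow mult_ac)
    then have "poly (poly G [:y:]) x ^ R
        = (\<Sum>b<D. \<Sum>a<L. (x ^ a * y ^ b) ^ R * (\<Sum>j<D. \<Sum>i<I. \<kappa> (j, b, a, i) * (x ^ i * y ^ j)) ^ (N * R))"
      by (simp add: freshmans_dream_sum'[OF char R] power_mult_distrib power_mult)
    also have "\<dots> = (\<Sum>b<D. \<Sum>a<L. (x ^ a * y ^ b) ^ R * (\<Sum>j<D. \<Sum>i<I. c (j, b, a, i) * (x ^ i * Y ^ j)))"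
    proof -
      have NR: "N * R = CHAR('a) ^ (n + m)" by (simp add: N R power_add)
      have "(\<Sum>j<D. \<Sum>i<I. \<kappa> (j, b, a, i) * (x ^ i * y ^ j)) ^ (N * R)
          = (\<Sum>j<D. \<Sum>i<I. c (j, b, a, i) * (x ^ i * Y ^ j))" for a b
      proof -
        have "(\<Sum>j<D. \<Sum>i<I. \<kappa> (j, b, a, i) * (x ^ i * y ^ j)) ^ (N * R)
            = (\<Sum>j<D. \<Sum>i<I. \<kappa> (j, b, a, i) ^ Q * ((x ^ Q) ^ i * (y ^ Q) ^ j))"
          by (simp add: freshmans_dream_sum'[OF char NR] power_mult_distrib Q flip: power_mult)
            (simp add: mult_ac)
        then show ?thesis using \<kappa> x(2) by (simp add: Y_def)
      qed
      then show ?thesis by simp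
    qed
    also have "\<dots> = (\<Sum>b<D. \<Sum>a<L. \<Sum>j<D. \<Sum>i<I. c (j, b, a, i) * (x ^ (a * R + i) * y ^ (b * R)) * Y ^ j)"
      by (simp add: sum_distrib_left power_mult_distrib power_add mult_ac flip: power_mult)
    also have "\<dots> = (\<Sum>b<D. \<Sum>j<D. \<Sum>a<L. \<Sum>i<I. c (j, b, a, i) * (x ^ (a * R + i) * y ^ (b * R)) * Y ^ j)"
      by (intro sum.cong refl sum.swap)
    also have "\<dots> = (\<Sum>j<D. W j * Y ^ j)"
      by (subst sum.swap) (simp add: W_def sum_distrib_right)
    finally show ?thesis using 0 R0 by simp
  qed
  have G_deg: "degree G \<le> D * Suc N" "inner_degree_le (L + N * (I - 1)) G"
  proof -
    have 1: "degree (monomial2 a b * g a b ^ N) \<le> D * Suc N" if "b < D" for a b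
    proof -
      have "degree (monomial2 a b * g a b ^ N) \<le> degree (monomial2 a b :: 'a poly poly) + degree (g a b ^ N)"
        by (rule degree_mult_le)
      also have "\<dots> \<le> b + degree (g a b) * N" by (intro add_mono degree_monomial2_le degree_power_le)
      also have "\<dots> \<le> D + D * N" using that g_deg[of a b] by (intro add_mono mult_le_mono) (auto simp: D)
      finally show ?thesis by simp
    qed
    have 2: "inner_degree_le (L + N * (I - 1)) (monomial2 a b * g a b ^ N)" if "a < L" for a b
      using that by (intro inner_degree_le_mult inner_degree_le_power g_inner
          inner_degree_le_mono[OF inner_degree_le_monomial2]) auto
    show "degree G \<le> D * Suc N" unfolding G_def using 1 by (intro degree_sum_le) auto
    show "inner_degree_le (L + N * (I - 1)) G" unfolding G_def using 2 by (intro inner_degree_le_sum) auto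
  qed
  from reduce_modulo_monic[OF f(1-3) G_deg] obtain r where
    r: "f dvd G - r" "degree r < D" "inner_degree_le (L + N * (I - 1) + k * (D * Suc N)) r"
    unfolding D by blast
  \<comment> \<open>Over a rational x outside \<open>bad\<close> the residue has degree below
    \<open>D\<close> in y but vanishes at all \<open>D\<close> points of the curve.\<close>
  have r_vanish: "poly (coeff r i) x = 0" if x: "x \<notin> bad" "x ^ Q = x" for x i
  proof -
    let ?rx = "map_poly (\<lambda>c. poly c x) r"
    have "?rx = 0"
    proof (rule ccontr)
      assume nz: "?rx \<noteq> 0"
      have "{y. poly (poly f [:y:]) x = 0} \<subseteq> {y. poly ?rx y = 0}"
      proof safe
        fix y assume y: "poly (poly f [:y:]) x = 0"
        obtain w where "G - r = f * w" using r(1) by (elim dvdE)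
        then have "r = G - f * w" by (simp add: algebra_simps)
        then have "poly (poly r [:y:]) x = 0" using vanish[OF x y] y by simp
        then show "poly ?rx y = 0" by (simp add: poly_poly_const)
      qed
      then have "D \<le> card {y. poly ?rx y = 0}"
        using card_mono[OF poly_roots_finite[OF nz]] roots[OF x(1)] by fastforce
      also have "\<dots> \<le> degree ?rx" using nz by (rule card_poly_roots_bound)
      also have "\<dots> \<le> degree r" by (rule map_poly_degree_leq)
      finally show False using r(2) by simp
    qed
    then have "coeff ?rx i = 0" by simp
    then show ?thesis by (simp add: coeff_map_poly)
  qed
  have "r = 0"
  proof (rule poly_eqI)
    fix i
    show "coeff r i = coeff 0 i"
    proof (rule ccontr)
      assume nz: "coeff r i \<noteq> coeff 0 i"
      let ?X = "{x::'a. x ^ Q = x}"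
      have finX: "finite ?X" using card_Q Q0 card.infinite[of ?X] by auto
      have "Q - card bad \<le> card (?X - bad)" using diff_card_le_card_Diff[OF bad, of ?X] card_Q by simp
      also have "\<dots> \<le> card {x. poly (coeff r i) x = 0}"
        using r_vanish nz by (intro card_mono poly_roots_finite) auto
      also have "\<dots> \<le> degree (coeff r i)" using nz by (intro card_poly_roots_bound) simp
      also have "\<dots> \<le> L + N * (I - 1) + k * (D * Suc N)" using r(3) by (rule inner_degree_leD)
      finally have "Q \<le> L + N * (I - 1) + k * (D * Suc N) + card bad" by simp
      then have "2 * D * Q \<le> 2 * D * (L + N * (I - 1) + k * (D * Suc N) + card bad)" by simp
      also have "\<dots> = 2 * D * (L + k * (D * Suc N) + card bad) + N * (2 * D * (I - 1))"
        by (simp add: algebra_simps)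
      also have "\<dots> < Q + N * (2 * D * (I - 1))" using large by simp
      also have "\<dots> \<le> Q + N * (2 * D * R - R)"
      proof -
        have "2 * D * (I - 1) + R \<le> 2 * D * R"
          using I1 D0 R0 IR by (cases I) (auto simp: algebra_simps)
        then have "2 * D * (I - 1) \<le> 2 * D * R - R" by simp
        then show ?thesis by (intro add_mono mult_le_mono) auto
      qed
      also have "\<dots> = 2 * D * Q"
      proof -
        have "1 * R \<le> 2 * D * R" using D0 by (intro mult_le_mono) auto
        then have "R + (2 * D * R - R) = 2 * D * R" by simp
        then have "N * R + N * (2 * D * R - R) = N * (2 * D * R)" by (simp flip: distrib_left)
        then show ?thesis by (simp add: Q mult_ac)
      qed
      finally show False by simp
    qed
  qed
  then show False using r(1) \<open>\<not> f dvd G\<close> by simp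
qed

text \<open>Stepanov's method. If no point over a large field were rational, every conjugate
  \<open>y ^ Q\<close> would be a root of the difference quotient, which has degree one less than \<open>f\<close>;
  this is what makes the number of unknowns exceed the number of conditions.\<close>

theorem stepanov_rational_point:
  fixes f :: "'a::alg_closed_field poly poly"
  assumes char: "prime CHAR('a)"
    and f: "lead_coeff f = 1" "degree f > 0" "prime_elem f"
    and bad: "finite bad"
    and sep: "\<And>x y. x \<notin> bad \<Longrightarrow> poly (poly f [:y:]) x = 0 \<Longrightarrow> poly (poly (pderiv f) [:y:]) x \<noteq> 0"
    and inf: "infinite (UNIV :: 'a set)"
  obtains Q0 where "\<And>e Q. Q = CHAR('a) ^ e \<Longrightarrow> Q \<ge> Q0 \<Longrightarrow> card {x::'a. x ^ Q = x} = Q \<Longrightarrow>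
    (\<And>x y. x \<notin> bad \<Longrightarrow> x ^ Q = x \<Longrightarrow> poly (poly f [:y:]) x = 0 \<Longrightarrow> poly (poly f [:y ^ Q:]) x = 0) \<Longrightarrow>
    (\<exists>x y. x \<notin> bad \<and> x ^ Q = x \<and> poly (poly f [:y:]) x = 0 \<and> y ^ Q = y)"
proof -
  define p where "p = CHAR('a)"
  have p: "p > 1" unfolding p_def using char by (rule prime_gt_1_nat)
  define D where "D = degree f"
  have D: "D > 0" using f by (simp add: D_def)
  obtain k0 where "inner_degree_le k0 f" using inner_degree_le_exists by blast
  define k where "k = Suc k0"
  have fk: "inner_degree_le k f" and k: "k > 0"
    using inner_degree_le_mono[OF \<open>inner_degree_le k0 f\<close>] by (auto simp: k_def)
  have map_f: "degree (map_poly (\<lambda>c. poly c x) f) = D" "map_poly (\<lambda>c. poly c x) f \<noteq> 0" for x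
  proof -
    show "degree (map_poly (\<lambda>c. poly c x) f) = D"
      unfolding D_def using f by (intro map_poly_degree_eq) auto
    then show "map_poly (\<lambda>c. poly c x) f \<noteq> 0" using D by auto
  qed
  have roots: "card {y. poly (poly f [:y:]) x = 0} = D" if "x \<notin> bad" for x
    using card_roots_separable[OF map_f(2), of x] sep[OF that] map_f(1)[of x]
    by (simp add: poly_poly_const pderiv_map_poly_poly)
  obtain x0 where x0: "x0 \<notin> bad" using bad inf by (metis ex_new_if_finite)
  have "{y. poly (poly f [:y:]) x0 = 0} \<noteq> {}" using roots[OF x0] D by force
  then obtain y0 where "poly (poly f [:y0:]) x0 = 0" by blast
  with sep x0 have pt: "poly (poly f [:y0:]) x0 = 0" "poly (poly (pderiv f) [:y0:]) x0 \<noteq> 0"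
    by blast+
  define L where "L = Suc (8 * k * D * D)"
  \<comment> \<open>The bound that \<open>N\<close> has to exceed also serves as the exponent of the
    characteristic, because \<open>n < p ^ n\<close>.\<close>
  define n where "n = L + D * (L + 2 * k * D) + 2 * k * D"
  have n: "n < p ^ n" using p by (intro power_gt_expt) auto
  define N where "N = p ^ n"
  define Q0 where "Q0 = 2 * D * (L + k * (D * Suc N) + card bad) + N + 1"
  show ?thesis
  proof (rule that[of Q0])
    fix e Q
    assume Q: "Q = CHAR('a) ^ e" "Q \<ge> Q0" "card {x::'a. x ^ Q = x} = Q"
      and conj: "\<And>x y. x \<notin> bad \<Longrightarrow> x ^ Q = x \<Longrightarrow> poly (poly f [:y:]) x = 0 \<Longrightarrow> poly (poly f [:y ^ Q:]) x = 0"
    have "N < Q" using Q by (simp add: Q0_def)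
    then have "n < e" using p by (simp add: N_def Q p_def)
    then have QR: "Q = CHAR('a) ^ (e - n) * N" by (simp add: Q N_def p_def flip: power_add)
    show "\<exists>x y. x \<notin> bad \<and> x ^ Q = x \<and> poly (poly f [:y:]) x = 0 \<and> y ^ Q = y"
    proof (rule ccontr)
      assume "\<not> ?thesis"
      then have nofix: "\<And>x y. x \<notin> bad \<Longrightarrow> x ^ Q = x \<Longrightarrow> poly (poly f [:y:]) x = 0 \<Longrightarrow> y ^ Q \<noteq> y"
        by blast
      show False
        by (rule stepanov_contradiction[OF char f(1,2) fk f(3) k pt D_def L_def, where N=N and Q=Q,
              OF N_def[unfolded p_def] _ refl QR _ bad Q(3) roots conj nofix])
          (use n Q(2) in \<open>auto simp: n_def N_def Q0_def\<close>)
    qed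
  qed
qed

section \<open>Polynomials in two variables\<close>

lemma poly_eqI_infinite:
  fixes p s :: "'a::idom poly"
  assumes "infinite (UNIV :: 'a set)" "\<And>x. poly p x = poly s x"
  shows "p = s"
proof (rule ccontr)
  assume "p \<noteq> s"
  then have "finite {x. poly (p - s) x = 0}" by (intro poly_roots_finite) simp
  then show False using assms by simp
qed

lemma pderiv_sum_distrib:
  "pderiv (\<Sum>i\<in>A. p i) = (\<Sum>i\<in>A. pderiv (p i))" for p :: "_ \<Rightarrow> 'a::idom poly"
  by (induction A rule: infinite_finite_induct) (simp_all add: pderiv_add)

lemma poly_poly_eqI:
  fixes P Q :: "'a::idom poly poly"
  assumes "infinite A" "infinite B"
    and "\<And>x y. x \<in> A \<Longrightarrow> y \<in> B \<Longrightarrow> poly (poly P [:y:]) x = poly (poly Q [:y:]) x"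
  shows "P = Q"
proof -
  have "coeff (P - Q) i = 0" for i
  proof (rule ccontr)
    assume nz: "coeff (P - Q) i \<noteq> 0"
    have "A \<subseteq> {x. poly (coeff (P - Q) i) x = 0}"
    proof safe
      fix x assume x: "x \<in> A"
      have "map_poly (\<lambda>c. poly c x) (P - Q) = 0"
      proof (rule ccontr)
        assume nz: "map_poly (\<lambda>c. poly c x) (P - Q) \<noteq> 0"
        have "B \<subseteq> {y. poly (map_poly (\<lambda>c. poly c x) (P - Q)) y = 0}"
          using assms(3)[OF x] by (auto simp flip: poly_poly_const)
        then show False using poly_roots_finite[OF nz] assms(2) finite_subset by blast
      qed
      then have "coeff (map_poly (\<lambda>c. poly c x) (P - Q)) i = 0" by simp
      then show "poly (coeff (P - Q) i) x = 0" by (simp add: coeff_map_poly)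
    qed
    then show False using poly_roots_finite[OF nz] assms(1) finite_subset by blast
  qed
  then show ?thesis by (intro poly_eqI) simp
qed

section \<open>Exchanging the two variables\<close>

definition swap_vars :: "'a::comm_ring_1 poly poly \<Rightarrow> 'a poly poly" where
  "swap_vars P = (\<Sum>j\<le>degree P. map_poly (\<lambda>a. monom a j) (coeff P j))"

lemma coeff_swap_vars: "coeff (coeff (swap_vars P) i) j = coeff (coeff P j) i"
proof -
  have "coeff (coeff (swap_vars P) i) j
      = (\<Sum>l\<le>degree P. if l = j then coeff (coeff P l) i else 0)"
    by (simp add: swap_vars_def coeff_sum coeff_map_poly coeff_monom)
  also have "\<dots> = coeff (coeff P j) i" by (auto simp: coeff_eq_0)
  finally show ?thesis .
qed

lemma swap_vars_swap_vars [simp]: "swap_vars (swap_vars P) = P"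
  by (intro poly_eqI) (simp add: coeff_swap_vars)

lemma poly_map_poly_monom:
  "poly (poly (map_poly (\<lambda>a. monom a j) c) [:x:]) y = y ^ j * poly c x"
  for c :: "'a::comm_ring_1 poly"
  by (induction c) (simp_all add: map_poly_pCons poly_monom algebra_simps)

lemma poly_swap_vars: "poly (poly (swap_vars P) [:x:]) y = poly (poly P [:y:]) x"
proof -
  have "poly (poly (swap_vars P) [:x:]) y = (\<Sum>j\<le>degree P. y ^ j * poly (coeff P j) x)"
    by (simp add: swap_vars_def poly_sum poly_map_poly_monom)
  also have "\<dots> = poly (poly P [:y:]) x"
    unfolding poly_altdef[of P] by (simp add: poly_sum poly_const_pow mult.commute)
  finally show ?thesis .
qed

lemma swap_vars_mult:
  fixes P Q :: "'a::idom poly poly"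
  assumes "infinite (UNIV :: 'a set)"
  shows "swap_vars (P * Q) = swap_vars P * swap_vars Q"
  by (rule poly_poly_eqI[OF assms assms]) (simp add: poly_swap_vars)

lemma swap_vars_0 [simp]: "swap_vars 0 = 0"
  by (simp add: swap_vars_def)

lemma swap_vars_eq_0_iff [simp]: "swap_vars P = 0 \<longleftrightarrow> P = 0"
proof
  assume "swap_vars P = 0"
  then have "swap_vars (swap_vars P) = swap_vars 0" by (rule arg_cong)
  then show "P = 0" by simp
qed simp

lemma swap_vars_1 [simp]: "swap_vars 1 = 1"
  by (simp add: swap_vars_def one_pCons map_poly_pCons monom_0)

lemma is_unit_poly_poly_iff:
  fixes P :: "'a::field poly poly"
  shows "P dvd 1 \<longleftrightarrow> (\<exists>c. c \<noteq> 0 \<and> P = [:[:c:]:])"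
proof
  assume "P dvd 1"
  then obtain p where "P = [:p:]" "p dvd 1" by (metis is_unit_polyE)
  then show "\<exists>c. c \<noteq> 0 \<and> P = [:[:c:]:]" by (metis is_unit_polyE is_unit_pCons_iff is_unit_triv dvd_0_left_iff zero_neq_one)
next
  assume "\<exists>c. c \<noteq> 0 \<and> P = [:[:c:]:]"
  then obtain c where "c \<noteq> 0" "P = [:[:c:]:]" by blast
  then have "P * [:[:inverse c:]:] = 1" by (simp add: one_pCons)
  then show "P dvd 1" by (metis dvd_triv_left)
qed

lemma swap_vars_unit_iff:
  fixes P :: "'a::field poly poly"
  assumes "infinite (UNIV :: 'a set)"
  shows "swap_vars P dvd 1 \<longleftrightarrow> P dvd 1"
proof -
  have *: "swap_vars P dvd 1" if "P dvd 1" for P :: "'a poly poly"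
  proof -
    from that obtain S where "1 = P * S" by (elim dvdE)
    then have "swap_vars P * swap_vars S = 1" by (metis swap_vars_mult[OF assms] swap_vars_1)
    then show ?thesis by (metis dvd_triv_left)
  qed
  show ?thesis using *[of P] *[of "swap_vars P"] by auto
qed

lemma irreducible_swap_vars:
  fixes P :: "'a::field poly poly"
  assumes inf: "infinite (UNIV :: 'a set)" and P: "irreducible P"
  shows "irreducible (swap_vars P)"
proof (rule irreducibleI)
  show "swap_vars P \<noteq> 0" using P by auto
  show "\<not> swap_vars P dvd 1" using P swap_vars_unit_iff[OF inf] by (auto simp: irreducible_def)
  fix S T assume "swap_vars P = S * T"
  then have "swap_vars (swap_vars P) = swap_vars S * swap_vars T" by (simp add: swap_vars_mult[OF inf])
  then have "P = swap_vars S * swap_vars T" by simp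
  then show "S dvd 1 \<or> T dvd 1" using P swap_vars_unit_iff[OF inf] by (auto dest: irreducibleD)
qed

text \<open>The fields with \<open>q ^ a\<close> and \<open>q ^ b\<close> elements meet in the one
  with \<open>q\<close> elements: by Bezout some iterates of the two Frobenius maps differ by one
  step.\<close>

lemma frobenius_fixed_coprime:
  fixes x :: "'a::monoid_mult"
  assumes "x ^ (q ^ a) = x" "x ^ (q ^ b) = x" "coprime a b" "a > 0"
  shows "x ^ q = x"
proof -
  have iter: "x ^ (q ^ (c * u)) = x" if "x ^ (q ^ c) = x" for c u
  proof (induction u)
    case (Suc u)
    have "x ^ (q ^ (c * Suc u)) = (x ^ (q ^ c)) ^ (q ^ (c * u))"
      by (simp add: power_add flip: power_mult)
    then show ?case using Suc that by simp
  qed simp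
  obtain u v where uv: "a * u = b * v + 1"
    using bezout_nat[of a b] assms(3,4) by auto
  have "x = x ^ (q ^ (b * v + 1))" using iter[OF assms(1), of u] uv by simp
  also have "\<dots> = (x ^ (q ^ (b * v))) ^ q" by (simp add: mult.commute flip: power_mult)
  also have "\<dots> = x ^ q" using iter[OF assms(2)] by simp
  finally show ?thesis by simp
qed

text \<open>This is (q^b - q^a) / (q - 1), written as a sum to avoid division.\<close>

definition geometric_weight :: "nat \<Rightarrow> nat \<Rightarrow> nat \<Rightarrow> nat" where
  "geometric_weight q a b = (\<Sum>i=a..<b. q ^ i)"

lemma geometric_weight:
  assumes "a \<le> b" "q > 0"
  shows "(q - 1) * geometric_weight q a b + q ^ a = q ^ b"
  using assms(1)
proof (induction b rule: dec_induct)
  case (step b)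
  have "(q - 1) * geometric_weight q a (Suc b) + q ^ a
      = ((q - 1) * geometric_weight q a b + q ^ a) + (q - 1) * q ^ b"
    using step.hyps by (simp add: geometric_weight_def algebra_simps)
  also have "\<dots> = q ^ b + (q - 1) * q ^ b" by (simp only: step.IH)
  also have "\<dots> = q ^ Suc b" using assms(2) by (cases q) auto
  finally show ?case .
qed (simp add: geometric_weight_def)

lemma geometric_weight_pos: "a < b \<Longrightarrow> q > 0 \<Longrightarrow> geometric_weight q a b > 0"
  unfolding geometric_weight_def by (intro sum_pos) auto

lemma of_nat_geometric_weight_0:
  assumes "of_nat q = (0 :: 'a::comm_ring_1)" "d > 0"
  shows "of_nat (geometric_weight q 0 d) = (1 :: 'a)"
proof -
  have "geometric_weight q 0 d = 1 + (\<Sum>i=1..<d. q ^ i)"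
    using assms(2) by (simp add: geometric_weight_def sum.atLeast_Suc_lessThan)
  then show ?thesis using assms(1) by (simp add: power_0_left)
qed

text \<open>The quotient of x^((q - 1) * n) - 1 by x^(q - 1) - 1. Passing to it strips the lines
  through the origin with slope in F_q from the curve.\<close>

definition geometric_poly :: "nat \<Rightarrow> nat \<Rightarrow> 'a::comm_ring_1 poly" where
  "geometric_poly q n = (\<Sum>j<n. monom 1 ((q - 1) * j))"

lemma poly_geometric_poly: "(x ^ (q - 1) - 1) * poly (geometric_poly q n) x = x ^ ((q - 1) * n) - 1"
  using power_diff_1_eq[of "x ^ (q - 1)" n]
  by (simp add: geometric_poly_def poly_sum poly_monom power_mult)

lemma poly_geometric_poly_eq_1: "x ^ (q - 1) = 1 \<Longrightarrow> poly (geometric_poly q n) x = of_nat n"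
  by (simp add: geometric_poly_def poly_sum poly_monom power_mult)

lemma coeff_geometric_poly:
  assumes "q > 1"
  shows "coeff (geometric_poly q n) i = (if (q - 1) dvd i \<and> i < (q - 1) * n then 1 else 0)"
proof -
  have "coeff (geometric_poly q n) i = (\<Sum>j<n. if (q - 1) * j = i then 1 else 0)"
    by (simp add: geometric_poly_def coeff_sum coeff_monom)
  also have "\<dots> = (if (q - 1) dvd i \<and> i < (q - 1) * n then 1 else 0)"
  proof (cases "(q - 1) dvd i")
    case True
    then obtain l where "i = (q - 1) * l" by (elim dvdE)
    then show ?thesis using assms by auto
  next
    case False
    then have "(q - 1) * j \<noteq> i" for j by auto
    then show ?thesis using False by simp
  qed
  finally show ?thesis .
qed

section \<open>Irreducibility for t = d\<close>

text \<open>The polynomial \<open>coincidence_A\<close> in \<open>x\<close> (outer) and \<open>k\<close> (inner) satisfies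
  \<open>(k ^ (q - 1) - 1) * coincidence_A = \<Sum>i\<le>r. a i * x ^ (q ^ i - 1) * (k ^ (q ^ d - q ^ i) - 1)\<close>;
  its zeros are the \<open>k = x / y\<close> with \<open>l y * x ^ (q ^ d) = l x * y ^ (q ^ d)\<close>.\<close>

definition coincidence_A :: "nat \<Rightarrow> nat \<Rightarrow> nat \<Rightarrow> (nat \<Rightarrow> 'a::comm_ring_1) \<Rightarrow> 'a poly poly" where
  "coincidence_A q d r a = (\<Sum>i\<le>r. monom (smult (a i) (geometric_poly q (geometric_weight q i d))) (q ^ i - 1))"

lemma poly_coincidence_A:
  assumes "r \<le> d" "q > 1"
  shows "(k ^ (q - 1) - 1) * poly (poly (coincidence_A q d r a) [:x:]) k
           = (\<Sum>i\<le>r. a i * x ^ (q ^ i - 1) * (k ^ (q ^ d - q ^ i) - 1))"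
proof -
  have "(k ^ (q - 1) - 1) * (a i * (poly (geometric_poly q (geometric_weight q i d)) k * x ^ (q ^ i - 1)))
      = a i * x ^ (q ^ i - 1) * (k ^ (q ^ d - q ^ i) - 1)" if "i \<le> r" for i
  proof -
    have "(q - 1) * geometric_weight q i d = q ^ d - q ^ i"
      using geometric_weight[of i d q] that assms by simp
    then have "(k ^ (q - 1) - 1) * poly (geometric_poly q (geometric_weight q i d)) k = k ^ (q ^ d - q ^ i) - 1"
      using poly_geometric_poly[of k q "geometric_weight q i d"] by simp
    moreover have "(k ^ (q - 1) - 1) * (a i * (poly (geometric_poly q (geometric_weight q i d)) k * x ^ (q ^ i - 1)))
      = a i * x ^ (q ^ i - 1) * ((k ^ (q - 1) - 1) * poly (geometric_poly q (geometric_weight q i d)) k)"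
      by (simp only: mult_ac)
    ultimately show ?thesis by simp
  qed
  then show ?thesis
    by (simp add: coincidence_A_def poly_sum poly_monom poly_const_pow sum_distrib_left mult_ac)
qed

lemma coeff_coincidence_A:
  assumes "q > 1"
  shows "coeff (coincidence_A q d r a) j
    = (\<Sum>i\<le>r. if q ^ i - 1 = j then smult (a i) (geometric_poly q (geometric_weight q i d)) else 0)"
  by (simp add: coincidence_A_def coeff_sum coeff_monom)

lemma power_minus_1_eq_iff: "q ^ i - 1 = q ^ j - 1 \<longleftrightarrow> i = j" if "q > 1" for q i j :: nat
proof -
  have "q ^ i \<ge> 1" "q ^ j \<ge> 1" using that by simp_all
  then have "q ^ i - 1 = q ^ j - 1 \<longleftrightarrow> q ^ i = q ^ j" by linarith
  then show ?thesis using that by (simp add: power_inject_exp)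
qed

lemma coeff_coincidence_A_power:
  assumes "q > 1" "i \<le> r"
  shows "coeff (coincidence_A q d r a) (q ^ i - 1) = smult (a i) (geometric_poly q (geometric_weight q i d))"
proof -
  have "coeff (coincidence_A q d r a) (q ^ i - 1) = (\<Sum>l\<le>r. if l = i then smult (a l) (geometric_poly q (geometric_weight q l d)) else 0)"
    unfolding coeff_coincidence_A[OF assms(1)] by (simp only: power_minus_1_eq_iff[OF assms(1)])
  then show ?thesis using assms by simp
qed

lemma degree_coincidence_A_le: "degree (coincidence_A q d r a) \<le> q ^ r - 1" if "q > 1"
  unfolding coincidence_A_def
proof (intro degree_sum_le)
  fix i assume "i \<in> {..r}"
  then have "q ^ i - 1 \<le> q ^ r - 1" using that by (intro diff_le_mono power_increasing) auto
  then show "degree (monom (smult (a i) (geometric_poly q (geometric_weight q i d))) (q ^ i - 1)) \<le> q ^ r - 1"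
    using degree_monom_le le_trans by blast
qed simp

text \<open>The reduction of \<open>f = swap_vars (coincidence_A q d r a)\<close> at a root of \<open>l x / x\<close> is divisible by
  a high power of \<open>k\<close>. This leaves no room for two factors that are nonconstant at \<open>k = 0\<close>,
  while a factor that is constant there does not involve \<open>x\<close> at all.\<close>

lemma irreducible_coincidence_A:
  fixes a :: "nat \<Rightarrow> 'a::alg_closed_field"
  assumes q: "q > 2" "of_nat q = (0 :: 'a)" and inf: "infinite (UNIV :: 'a set)"
    and r: "0 < r" "r < d" "coprime r d" and a: "a 0 \<noteq> 0" "a r \<noteq> 0"
  shows "lead_coeff (swap_vars (coincidence_A q d r a)) = [:a 0:]"
    and "degree (swap_vars (coincidence_A q d r a)) = q ^ d - q"
    and "irreducible (swap_vars (coincidence_A q d r a))"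
proof -
  have q1: "q > 1" using q by simp
  define A where "A = coincidence_A q d r a"
  define f where "f = swap_vars A"
  let ?g = "\<lambda>i. geometric_poly q (geometric_weight q i d) :: 'a poly"
  have w: "(q - 1) * geometric_weight q i d = q ^ d - q ^ i" if "i \<le> r" for i
    using geometric_weight[of i d q] that r q by simp
  have cg: "coeff (?g i) s = (if (q - 1) dvd s \<and> s < q ^ d - q ^ i then 1 else 0)" if "i \<le> r" for i s
    using coeff_geometric_poly[OF q1, where 'a='a, of "geometric_weight q i d" s] w[OF that] by simp
  have qd: "q < q ^ d" using power_strict_increasing[of 1 d q] r q1 by simp
  have qi: "q \<le> q ^ i" if "i > 0" for i using that q by (cases i) auto
  have cf: "coeff (coeff f s) j = coeff (\<Sum>i\<le>r. if q ^ i - 1 = j then smult (a i) (?g i) else 0) s" for s j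
    unfolding f_def coeff_swap_vars A_def coeff_coincidence_A[OF q1] ..
  have top: "coeff f (q ^ d - q) = [:a 0:]"
  proof (rule poly_eqI)
    fix j
    have 0: "(q - 1) dvd q ^ d - q" using w[of 1] r by (metis dvd_triv_left less_eq_Suc_le One_nat_def power_one_right)
    have "coeff (coeff f (q ^ d - q)) j = (\<Sum>i\<le>r. if q ^ i - 1 = j then a i * coeff (?g i) (q ^ d - q) else 0)"
      unfolding cf coeff_sum by (intro sum.cong) auto
    also have "\<dots> = (\<Sum>i\<le>r. if i = 0 then if j = 0 then a 0 else 0 else 0)"
    proof (intro sum.cong refl)
      fix i assume i: "i \<in> {..r}"
      show "(if q ^ i - 1 = j then a i * coeff (?g i) (q ^ d - q) else 0)
          = (if i = 0 then if j = 0 then a 0 else 0 else 0)"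
        using cg[of i "q ^ d - q"] i 0 qi[of i] qd q1 by (cases "i = 0") auto
    qed
    finally show "coeff (coeff f (q ^ d - q)) j = coeff [:a 0:] j"
      by (cases j) auto
  qed
  have above: "coeff f s = 0" if "s > q ^ d - q" for s
  proof (rule poly_eqI)
    fix j
    have "coeff (?g i) s = 0" if "i \<le> r" for i
    proof (cases "i = 0")
      case True
      have "\<not> ((q - 1) dvd s \<and> s < q ^ d - 1)"
      proof
        assume s: "(q - 1) dvd s \<and> s < q ^ d - 1"
        have "(q - 1) dvd q ^ d - 1" using w[of 0] by (metis dvd_triv_left power_0 zero_le)
        with s have "(q - 1) dvd (q ^ d - 1) - s" using dvd_diff_nat by blast
        then have "q - 1 \<le> (q ^ d - 1) - s" using s by (intro dvd_imp_le) auto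
        then show False using \<open>s > q ^ d - q\<close> qd s q1 by linarith
      qed
      then show ?thesis using cg[OF that, of s] True by simp
    next
      case False
      then show ?thesis using cg[OF that, of s] qi[of i] \<open>s > q ^ d - q\<close> by auto
    qed
    then show "coeff (coeff f s) j = coeff 0 j"
      unfolding cf coeff_sum by (auto intro!: sum.neutral)
  qed
  have df: "degree f = q ^ d - q"
    using top a(1) above by (intro antisym degree_le le_degree) auto
  show lf: "lead_coeff (swap_vars (coincidence_A q d r a)) = [:a 0:]"
    using df top by (simp add: f_def A_def)
  show "degree (swap_vars (coincidence_A q d r a)) = q ^ d - q" using df by (simp add: f_def A_def)
  have f0: "f \<noteq> 0" using df qd by auto
  define lam where "lam = coeff f 0"
  have lam_poly: "poly lam x = (\<Sum>i\<le>r. a i * x ^ (q ^ i - 1))" for x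
  proof -
    have g0: "poly (?g i) 0 = 1" if "i \<le> r" for i
    proof -
      have "q ^ i < q ^ d" using that r q1 by (intro power_strict_increasing) auto
      then show ?thesis using cg[OF that, of 0] by (simp add: poly_0_coeff_0)
    qed
    have "poly lam x = poly (poly A [:x:]) 0"
      using poly_swap_vars[of A 0 x] by (simp add: lam_def f_def poly_0_coeff_0)
    also have "\<dots> = (\<Sum>i\<le>r. a i * x ^ (q ^ i - 1))"
      by (simp add: A_def coincidence_A_def poly_sum poly_monom poly_const_pow g0 mult.commute)
    finally show ?thesis .
  qed
  have lam_eq: "[:0, 1:] * lam = (\<Sum>i\<le>r. monom (a i) (q ^ i))"
  proof (rule poly_eqI_infinite[OF inf])
    fix x :: 'a
    have xi: "x * (a i * x ^ (q ^ i - 1)) = a i * x ^ (q ^ i)" for i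
    proof -
      have "Suc (q ^ i - 1) = q ^ i" using q1 by simp
      then have "x * x ^ (q ^ i - 1) = x ^ (q ^ i)" by (simp flip: power_Suc)
      then show ?thesis by (simp add: mult.left_commute[of x])
    qed
    have "poly ([:0, 1:] * lam) x = x * (\<Sum>i\<le>r. a i * x ^ (q ^ i - 1))"
      by (simp add: lam_poly)
    also have "\<dots> = (\<Sum>i\<le>r. a i * x ^ (q ^ i))" unfolding sum_distrib_left xi ..
    finally show "poly ([:0, 1:] * lam) x = poly (\<Sum>i\<le>r. monom (a i) (q ^ i)) x"
      by (simp add: poly_sum poly_monom)
  qed
  have pd: "pderiv ([:0, 1:] * lam) = [:a 0:]"
  proof -
    have "pderiv (monom (a i) (q ^ i)) = (if i = 0 then [:a 0:] else 0)" for i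
      using q(2) by (auto simp: pderiv_monom monom_0 power_0_left)
    then show ?thesis unfolding lam_eq pderiv_sum_distrib by simp
  qed
  \<comment> \<open>The product \<open>[:0, 1:] * lam\<close> has the nonzero constant
    \<open>a 0\<close> as derivative, so the roots of \<open>lam\<close> are simple and each belongs
    to only one of two complementary factors.\<close>
  have lam_sep: "\<not> (poly (coeff S 0) x = 0 \<and> poly (coeff T 0) x = 0)" if "f = S * T" for S T x
  proof
    assume *: "poly (coeff S 0) x = 0 \<and> poly (coeff T 0) x = 0"
    have "lam = coeff S 0 * coeff T 0" using that by (simp add: lam_def coeff_mult)
    then have "poly (pderiv ([:0, 1:] * lam)) x = 0"
      using * by (simp add: pderiv_mult pderiv_add pderiv_pCons)
    then show False using a(1) unfolding pd by simp
  qed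
  \<comment> \<open>At a root \<open>x0\<close> of \<open>lam\<close> the terms \<open>- 1\<close>
    of the defining identity cancel and \<open>k ^ (q ^ d - q ^ r)\<close> splits off. The
    complementary factor does not vanish at \<open>k = 0\<close>, so this entire power divides
    \<open>S\<close> reduced at \<open>x0\<close>.\<close>
  have big: "q ^ d - q ^ r \<le> degree S" if ST: "f = S * T" and x0: "poly (coeff S 0) x0 = 0" for S T x0
  proof -
    let ?m = "map_poly (\<lambda>c. poly c x0)"
    define W where "W = (\<Sum>i\<le>r. monom (a i * x0 ^ (q ^ i - 1)) (q ^ r - q ^ i))"
    have "poly lam x0 = 0" using x0 ST by (simp add: lam_def coeff_mult)
    have eq: "?m S * (?m T * (monom 1 (q - 1) - 1)) = [:0, 1:] ^ (q ^ d - q ^ r) * W"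
    proof (rule poly_eqI_infinite[OF inf])
      fix k
      have "poly (?m S * (?m T * (monom 1 (q - 1) - 1))) k = (k ^ (q - 1) - 1) * poly (poly f [:k:]) x0"
        unfolding ST by (simp add: poly_poly_const[symmetric] poly_monom)
      also have "\<dots> = (k ^ (q - 1) - 1) * poly (poly A [:x0:]) k"
        by (simp add: f_def poly_swap_vars)
      also have "\<dots> = (\<Sum>i\<le>r. a i * x0 ^ (q ^ i - 1) * (k ^ (q ^ d - q ^ i) - 1))"
        unfolding A_def using r q1 by (intro poly_coincidence_A) auto
      also have "\<dots> = (\<Sum>i\<le>r. a i * x0 ^ (q ^ i - 1) * k ^ (q ^ d - q ^ i)) - poly lam x0"
        by (simp add: lam_poly right_diff_distrib sum_subtractf)
      also have "\<dots> = (\<Sum>i\<le>r. k ^ (q ^ d - q ^ r) * (a i * x0 ^ (q ^ i - 1) * k ^ (q ^ r - q ^ i)))"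
      proof -
        have "a i * x0 ^ (q ^ i - 1) * k ^ (q ^ d - q ^ i)
            = k ^ (q ^ d - q ^ r) * (a i * x0 ^ (q ^ i - 1) * k ^ (q ^ r - q ^ i))" if "i \<le> r" for i
        proof -
          have "q ^ i \<le> q ^ r" "q ^ r \<le> q ^ d" using that r q1 by (auto intro!: power_increasing)
          then have e: "q ^ d - q ^ i = (q ^ d - q ^ r) + (q ^ r - q ^ i)" by linarith
          show ?thesis by (subst e) (simp only: power_add mult_ac)
        qed
        then show ?thesis unfolding \<open>poly lam x0 = 0\<close> diff_0_right by (intro sum.cong) auto
      qed
      also have "\<dots> = poly ([:0, 1:] ^ (q ^ d - q ^ r) * W) k"
        by (simp add: W_def poly_sum poly_monom sum_distrib_left)
      finally show "poly (?m S * (?m T * (monom 1 (q - 1) - 1))) k = poly ([:0, 1:] ^ (q ^ d - q ^ r) * W) k" .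
    qed
    have nz: "?m S \<noteq> 0" "?m T \<noteq> 0"
    proof -
      have "?m f = ?m S * ?m T"
        by (rule poly_eqI_infinite[OF inf]) (simp add: ST poly_poly_const[symmetric])
      moreover have "coeff (?m f) (degree f) = a 0" using top by (simp add: coeff_map_poly df)
      ultimately show "?m S \<noteq> 0" "?m T \<noteq> 0" using a(1) by auto
    qed
    have u: "poly (?m T * (monom 1 (q - 1) - 1)) 0 \<noteq> 0"
    proof -
      have "poly (coeff T 0) x0 \<noteq> 0" using lam_sep[OF ST] x0 by blast
      moreover have "(0::'a) ^ (q - 1) = 0" using q1 by simp
      moreover have "poly (?m T) 0 = poly (coeff T 0) x0" by (simp add: poly_0_coeff_0 coeff_map_poly)
      ultimately show ?thesis by (simp add: poly_monom power_0_left)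
    qed
    then have u0: "?m T * (monom 1 (q - 1) - 1) \<noteq> 0" by auto
    have "[:-0, 1:] ^ (q ^ d - q ^ r) dvd ?m S * (?m T * (monom 1 (q - 1) - 1))"
      unfolding eq by simp
    then have "q ^ d - q ^ r \<le> order 0 (?m S * (?m T * (monom 1 (q - 1) - 1)))"
      using nz(1) u0 unfolding order_divides by simp
    also have "\<dots> = order 0 (?m S)" using u nz(1) u0 by (simp add: order_mult order_0I)
    also have "\<dots> \<le> degree (?m S)" using nz(1) by (rule order_degree)
    also have "\<dots> \<le> degree S" by (rule map_poly_degree_leq)
    finally show ?thesis .
  qed
  \<comment> \<open>The coefficient of the top power of x is nonzero at \<open>k = 0\<close>, so a
    factor keeps its x-degree there; a factor constant there is free of x. It then divides every
    coefficient, and a common zero \<open>k\<close> lies in F_(q^d) and F_(q^r), hence in F_q, where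
    the coefficient for \<open>i = 0\<close> equals \<open>a 0\<close>.\<close>
  have const: "S dvd 1" if ST: "f = S * T" and c: "degree (coeff S 0) = 0" for S T
  proof -
    define S' T' where "S' = swap_vars S" and "T' = swap_vars T"
    have A: "A = S' * T'"
      using ST swap_vars_mult[OF inf, of S T] unfolding S'_def T'_def f_def
      by (metis swap_vars_swap_vars)
    have lA: "coeff A (q ^ r - 1) = smult (a r) (?g r)" unfolding A_def by (rule coeff_coincidence_A_power[OF q1 order_refl])
    have gr0: "coeff (?g r) 0 = 1"
    proof -
      have "q ^ r < q ^ d" using r q1 by (intro power_strict_increasing) auto
      then show ?thesis using cg[of r 0] by simp
    qed
    have "coeff A (q ^ r - 1) \<noteq> 0"
    proof
      assume "coeff A (q ^ r - 1) = 0"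
      then have "coeff (smult (a r) (?g r)) 0 = 0" by (simp only: lA coeff_0)
      then show False using gr0 a(2) by simp
    qed
    then have dA: "degree A = q ^ r - 1"
      using degree_coincidence_A_le[OF q1, of d r a] by (intro antisym le_degree) (auto simp: A_def)
    have "coeff (lead_coeff A) 0 \<noteq> 0" unfolding dA lA using gr0 a(2) by simp
    then have "coeff (lead_coeff S') 0 \<noteq> 0" unfolding A lead_coeff_mult by (auto simp: coeff_mult)
    then have "coeff (coeff S 0) (degree S') \<noteq> 0" by (simp add: S'_def coeff_swap_vars)
    then have "degree S' = 0" using c le_degree by fastforce
    then obtain s where s: "S' = [:s:]" by (rule degree_eq_zeroE)
    have dv: "s dvd coeff A i" for i unfolding A s by simp
    have "degree s = 0"
    proof (rule ccontr)
      assume "degree s \<noteq> 0"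
      then obtain k where k: "poly s k = 0" using alg_closed_imp_poly_has_root[of s] by auto
      have gk: "poly (?g i) k = 0" if "i \<le> r" "a i \<noteq> 0" for i
      proof -
        have "s dvd smult (a i) (?g i)" using dv[of "q ^ i - 1"] coeff_coincidence_A_power[OF q1 that(1), of d a] by (simp add: A_def)
        then have "poly s k dvd poly (smult (a i) (?g i)) k" by (rule poly_dvd_poly)
        then show ?thesis using k that by simp
      qed
      have kd: "k ^ (q ^ d - q ^ i) = 1" if "i \<le> r" "a i \<noteq> 0" for i
        using poly_geometric_poly[of k q "geometric_weight q i d"] gk[OF that] w[OF that(1)] by simp
      have k0: "k ^ (q ^ d) = k"
      proof -
        have "k ^ (q ^ d) = k ^ (q ^ d - q ^ 0) * k" using power_minus_mult[of "q ^ d" k] q1 by simp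
        then show ?thesis using kd[of 0] a by simp
      qed
      have "k ^ (q ^ d) = k ^ (q ^ d - q ^ r) * k ^ (q ^ r)"
        using r q1 by (simp flip: power_add)
      then have kr: "k ^ (q ^ r) = k" using kd[of r] a k0 by simp
      have "k \<noteq> 0" using kd[of 0] a qd q1 by (auto simp: power_0_left split: if_splits)
      have "k ^ q = k" by (rule frobenius_fixed_coprime[OF kr k0 r(3,1)])
      then have "k ^ (q - 1) * k = 1 * k" using power_minus_mult[of q k] q1 by simp
      then have "k ^ (q - 1) = 1" using \<open>k \<noteq> 0\<close> mult_right_cancel by blast
      then have "poly (?g 0) k = 1"
        using of_nat_geometric_weight_0[OF q(2), of d] r by (simp add: poly_geometric_poly_eq_1)
      then show False using gk[of 0] a by simp
    qed
    then obtain c where "s = [:c:]" by (rule degree_eq_zeroE)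
    moreover have "S' \<noteq> 0" using f0 ST by (auto simp: S'_def)
    ultimately have "S' dvd 1" unfolding is_unit_poly_poly_iff using s by auto
    then show ?thesis unfolding S'_def swap_vars_unit_iff[OF inf] .
  qed
  show "irreducible (swap_vars (coincidence_A q d r a))"
    unfolding A_def[symmetric] f_def[symmetric]
  proof (rule irreducibleI)
    show "f \<noteq> 0" by (rule f0)
    show "\<not> f dvd 1" using df qd by (auto simp: is_unit_poly_poly_iff)
    fix S T assume ST: "f = S * T"
    then have TS: "f = T * S" by (simp add: mult.commute)
    have "degree (coeff S 0) = 0 \<or> degree (coeff T 0) = 0"
    proof (rule ccontr)
      assume "\<not> ?thesis"
      then obtain x0 x1 where "poly (coeff S 0) x0 = 0" "poly (coeff T 0) x1 = 0"
        using alg_closed_imp_poly_has_root[of "coeff S 0"] alg_closed_imp_poly_has_root[of "coeff T 0"] by auto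
      then have "q ^ d - q ^ r \<le> degree S" "q ^ d - q ^ r \<le> degree T" using big ST TS by blast+
      moreover have "degree S + degree T = q ^ d - q"
        using f0 ST df by (simp add: degree_mult_eq)
      \<comment> \<open>By \<open>q > 2\<close>, twice \<open>q ^ d - q ^ r\<close> exceeds the
        total degree \<open>q ^ d - q\<close>.\<close>
      moreover have "3 * q ^ r \<le> q ^ d"
      proof -
        have "3 * q ^ r \<le> q * q ^ r" using q(1) by (intro mult_le_mono1) simp
        also have "\<dots> = q ^ Suc r" by simp
        also have "\<dots> \<le> q ^ d" using r q1 by (intro power_increasing) auto
        finally show ?thesis .
      qed
      moreover have "q ^ r > 0" using q1 by simp
      ultimately show False using q1 by linarith
    qed
    then show "S dvd 1 \<or> T dvd 1" using const ST TS by blast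
  qed
qed

section \<open>Irreducibility for r = d\<close>

lemma geometric_weight_Suc: "geometric_weight q 0 (Suc n) = 1 + q * geometric_weight q 0 n"
  unfolding geometric_weight_def atLeast0LessThan sum.lessThan_Suc_shift by (simp add: sum_distrib_left)

lemma geometric_weight_add:
  "geometric_weight q 0 (m + n) = geometric_weight q 0 m + q ^ m * geometric_weight q 0 n"
  by (induction m) (simp_all add: geometric_weight_Suc algebra_simps, simp add: geometric_weight_def)

lemma geometric_weight_shift:
  assumes "t \<le> d"
  shows "geometric_weight q t d = q ^ t * geometric_weight q 0 (d - t)"
proof -
  have "geometric_weight q t d = (\<Sum>i=0 + t..<(d - t) + t. q ^ i)"
    using assms by (simp add: geometric_weight_def)
  also have "\<dots> = (\<Sum>i=0..<d - t. q ^ (i + t))" by (rule sum.shift_bounds_nat_ivl)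
  finally show ?thesis by (simp add: geometric_weight_def sum_distrib_left power_add mult.commute)
qed

text \<open>A common divisor divides the weights of all multiples of \<open>m\<close> and of
  \<open>n\<close>; for two multiples that differ by one, \<open>geometric_weight_Suc\<close> makes
  it divide 1.\<close>

lemma coprime_geometric_weight:
  assumes "coprime m n" "m > 0"
  shows "coprime (geometric_weight q 0 m) (geometric_weight q 0 n)"
proof (rule coprimeI)
  fix g assume g: "g dvd geometric_weight q 0 m" "g dvd geometric_weight q 0 n"
  have multi: "g dvd geometric_weight q 0 (k * u)" if "g dvd geometric_weight q 0 k" for k u
  proof (induction u)
    case (Suc u)
    have "geometric_weight q 0 (k * Suc u) = geometric_weight q 0 k + q ^ k * geometric_weight q 0 (k * u)"
      using geometric_weight_add[of q k "k * u"] by simp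
    then show ?case using that Suc by simp
  qed (simp add: geometric_weight_def)
  obtain u v where uv: "m * u = n * v + 1" using bezout_nat[of m n] assms by auto
  have "g dvd 1 + q * geometric_weight q 0 (n * v)"
    using multi[OF g(1), of u] unfolding uv by (simp add: geometric_weight_Suc)
  moreover have "g dvd q * geometric_weight q 0 (n * v)" using multi[OF g(2)] by simp
  ultimately show "is_unit g" using dvd_add_left_iff by blast
qed

section \<open>Edges of the Newton polygon under translation, scaling and inversion\<close>

lemma poly_poly_sum_coeff:
  "poly (poly P [:y:]) x = (\<Sum>j\<le>degree P. poly (coeff P j) x * y ^ j)"
  for P :: "'a::comm_ring_1 poly poly"
  unfolding poly_altdef[of P] by (simp add: poly_sum poly_const_pow mult.commute)

text \<open>The leading coefficient of \<open>weighted_subst m1 m2 P\<close> is the part of \<open>P\<close> on the edge of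
  its Newton polygon that maximizes \<open>m1 * j + m2 * i\<close> over the monomials \<open>x\<^sup>i y\<^sup>j\<close>.\<close>

definition weighted_subst :: "nat \<Rightarrow> nat \<Rightarrow> 'a::comm_ring_1 poly poly \<Rightarrow> 'a poly poly" where
  "weighted_subst m1 m2 P =
     (\<Sum>j\<le>degree P. map_poly (\<lambda>c. monom c j) (pcompose (coeff P j) (monom 1 m2)) * monom 1 (m1 * j))"

lemma poly_weighted_subst:
  "poly (poly (weighted_subst m1 m2 P) [:T:]) x = poly (poly P [:x * T ^ m1:]) (T ^ m2)"
  unfolding poly_poly_sum_coeff[of P]
  by (simp add: weighted_subst_def poly_sum poly_map_poly_monom poly_monom poly_const_pow poly_pcompose
      power_mult_distrib mult_ac flip: power_mult)

lemma weighted_subst_mult: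
  fixes P Q :: "'a::idom poly poly"
  assumes "infinite (UNIV :: 'a set)"
  shows "weighted_subst m1 m2 (P * Q) = weighted_subst m1 m2 P * weighted_subst m1 m2 Q"
  by (rule poly_poly_eqI[OF assms assms]) (simp add: poly_weighted_subst)

lemma inner_degree_weighted_subst: "inner_degree_le (degree P) (weighted_subst m1 m2 P)"
  for P :: "'a::comm_ring_1 poly poly"
  unfolding weighted_subst_def
proof (intro inner_degree_le_sum)
  fix j assume j: "j \<in> {..degree P}"
  have "inner_degree_le j (map_poly (\<lambda>c. monom c j) (pcompose (coeff P j) (monom 1 m2)))"
    by (simp add: inner_degree_le_def coeff_map_poly degree_monom_le)
  moreover have "inner_degree_le 0 (monom 1 (m1 * j) :: 'a poly poly)"
    by (intro inner_degree_le_monom) simp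
  ultimately have "inner_degree_le (j + 0) (map_poly (\<lambda>c. monom c j) (pcompose (coeff P j) (monom 1 m2)) * monom 1 (m1 * j))"
    by (rule inner_degree_le_mult)
  then show "inner_degree_le (degree P) (map_poly (\<lambda>c. monom c j) (pcompose (coeff P j) (monom 1 m2)) * monom 1 (m1 * j))"
    using j by (auto intro: inner_degree_le_mono)
qed

lemma coeff_pcompose_monom:
  fixes p :: "'a::comm_ring_1 poly"
  assumes "m > 0"
  shows "coeff (pcompose p (monom 1 m)) k = (if m dvd k then coeff p (k div m) else 0)"
proof (induction p arbitrary: k)
  case (pCons a p)
  have "coeff (pcompose (pCons a p) (monom 1 m)) k
      = coeff [:a:] k + (if m \<le> k then coeff (pcompose p (monom 1 m)) (k - m) else 0)"
    by (simp add: pcompose_pCons coeff_monom_mult)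
  also have "\<dots> = (if m dvd k then coeff (pCons a p) (k div m) else 0)"
  proof (cases "m \<le> k")
    case True
    then have "k > 0" "m dvd k \<longleftrightarrow> m dvd (k - m)" "k div m = Suc ((k - m) div m)"
      using assms by (auto simp: le_div_geq dvd_minus_self)
    then show ?thesis using True pCons.IH[of "k - m"] by (auto simp: coeff_pCons split: nat.splits)
  next
    case False
    then have "m dvd k \<longleftrightarrow> k = 0" using assms by (auto dest: dvd_imp_le)
    then show ?thesis using False assms by (auto simp: coeff_pCons split: nat.splits)
  qed
  finally show ?case .
qed simp

lemma coeff_weighted_subst:
  fixes P :: "'a::comm_ring_1 poly poly"
  assumes "m2 > 0"
  shows "coeff (coeff (weighted_subst m1 m2 P) k) j
    = (if m1 * j \<le> k \<and> m2 dvd (k - m1 * j) then coeff (coeff P j) ((k - m1 * j) div m2) else 0)"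
proof -
  have "coeff (coeff (weighted_subst m1 m2 P) k) j
      = (\<Sum>l\<le>degree P. if l = j then (if m1 * j \<le> k \<and> m2 dvd (k - m1 * j) then coeff (coeff P j) ((k - m1 * j) div m2) else 0) else 0)"
    unfolding weighted_subst_def coeff_sum
    by (intro sum.cong refl)
      (auto simp: mult.commute[of _ "monom _ _"] coeff_monom_mult coeff_map_poly coeff_monom coeff_pcompose_monom[OF assms])
  also have "\<dots> = (if m1 * j \<le> k \<and> m2 dvd (k - m1 * j) then coeff (coeff P j) ((k - m1 * j) div m2) else 0)"
    by (auto simp: coeff_eq_0)
  finally show ?thesis .
qed

lemma coeff_pcompose_shift:
  fixes p :: "'a::idom poly"
  assumes "degree p \<le> i"
  shows "coeff (pcompose p [:c, 1:]) i = coeff p i"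
proof -
  have d: "degree (pcompose p [:c, 1:]) = degree p" by (simp add: degree_pcompose)
  show ?thesis
  proof (cases "i = degree p")
    case True
    have "lead_coeff (pcompose p [:c, 1:]) = lead_coeff p" by (subst lead_coeff_comp) auto
    then show ?thesis using True d by simp
  next
    case False
    then show ?thesis using assms d by (simp add: coeff_eq_0)
  qed
qed

definition shift_inner :: "'a::comm_ring_1 \<Rightarrow> 'a poly poly \<Rightarrow> 'a poly poly" where
  "shift_inner c P = map_poly (\<lambda>p. pcompose p [:c, 1:]) P"

lemma coeff_shift_inner: "coeff (shift_inner c P) j = pcompose (coeff P j) [:c, 1:]"
  by (simp add: shift_inner_def coeff_map_poly)

lemma degree_shift_inner: "degree (shift_inner c P) = degree P" for P :: "'a::idom poly poly"
proof -
  have "pcompose p [:c, 1:] = 0 \<longleftrightarrow> p = 0" for p :: "'a poly" by (simp add: pcompose_eq_0_iff)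
  then show ?thesis unfolding shift_inner_def by (cases "P = 0") (auto intro!: map_poly_degree_eq)
qed

lemma poly_shift_inner: "poly (poly (shift_inner c P) [:y:]) x = poly (poly P [:y:]) (x + c)"
  for P :: "'a::idom poly poly"
  unfolding poly_poly_sum_coeff degree_shift_inner
  by (simp add: coeff_shift_inner poly_pcompose add.commute)

text \<open>Expanding a power of x + c only adds monomials with a smaller exponent of x, whose
  weight is smaller since \<open>m2 > 0\<close>.\<close>

lemma lead_coeff_weighted_subst_shift:
  fixes P :: "'a::idom poly poly"
  assumes "m2 > 0" "P \<noteq> 0"
  shows "lead_coeff (weighted_subst m1 m2 (shift_inner c P)) = lead_coeff (weighted_subst m1 m2 P)"
proof -
  define W where "W = degree (weighted_subst m1 m2 P)"
  have le: "m2 * degree (coeff P j) + m1 * j \<le> W" if "coeff P j \<noteq> 0" for j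
  proof -
    have "coeff (coeff (weighted_subst m1 m2 P) (m2 * degree (coeff P j) + m1 * j)) j \<noteq> 0"
      using that assms(1) by (simp add: coeff_weighted_subst)
    then have "coeff (weighted_subst m1 m2 P) (m2 * degree (coeff P j) + m1 * j) \<noteq> 0" by auto
    then show ?thesis unfolding W_def by (rule le_degree)
  qed
  have eq: "coeff (weighted_subst m1 m2 (shift_inner c P)) k = coeff (weighted_subst m1 m2 P) k" if "k \<ge> W" for k
  proof (rule poly_eqI)
    fix j
    show "coeff (coeff (weighted_subst m1 m2 (shift_inner c P)) k) j = coeff (coeff (weighted_subst m1 m2 P) k) j"
    proof (cases "coeff P j \<noteq> 0 \<and> m1 * j \<le> k \<and> m2 dvd (k - m1 * j)")
      case True
      have "degree (coeff P j) \<le> (k - m1 * j) div m2"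
      proof -
        have "m2 * degree (coeff P j) \<le> k - m1 * j" using le[of j] True that by linarith
        then show ?thesis using assms(1) by (simp add: less_eq_div_iff_mult_less_eq mult.commute)
      qed
      then show ?thesis using True assms(1) by (simp add: coeff_weighted_subst coeff_shift_inner coeff_pcompose_shift)
    qed (auto simp: coeff_weighted_subst[OF assms(1)] coeff_shift_inner)
  qed
  have nz: "weighted_subst m1 m2 P \<noteq> 0"
  proof -
    have "coeff (coeff (weighted_subst m1 m2 P) (m2 * degree (lead_coeff P) + m1 * degree P)) (degree P) \<noteq> 0"
      using assms by (simp add: coeff_weighted_subst)
    then show ?thesis by auto
  qed
  have "degree (weighted_subst m1 m2 (shift_inner c P)) = W"
  proof (intro antisym degree_le le_degree allI impI)
    show "coeff (weighted_subst m1 m2 (shift_inner c P)) k = 0" if "k > W" for k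
      using eq[of k] that by (simp add: W_def coeff_eq_0)
    show "coeff (weighted_subst m1 m2 (shift_inner c P)) W \<noteq> 0"
      using eq[of W] nz by (simp add: W_def)
  qed
  then show ?thesis using eq[of W] by (simp add: W_def)
qed

definition scale_vars :: "'a::comm_ring_1 \<Rightarrow> 'a \<Rightarrow> 'a poly poly \<Rightarrow> 'a poly poly" where
  "scale_vars u v P = (\<Sum>j\<le>degree P. monom (smult (v ^ j) (pcompose (coeff P j) [:0, u:])) j)"

lemma coeff_scale_vars: "coeff (scale_vars u v P) j = smult (v ^ j) (pcompose (coeff P j) [:0, u:])"
proof -
  have "coeff (scale_vars u v P) j
      = (\<Sum>l\<le>degree P. if l = j then smult (v ^ l) (pcompose (coeff P l) [:0, u:]) else 0)"
    by (simp add: scale_vars_def coeff_sum coeff_monom)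
  then show ?thesis by (auto simp: coeff_eq_0)
qed

lemma degree_scale_vars:
  fixes P :: "'a::idom poly poly"
  assumes "u \<noteq> 0" "v \<noteq> 0"
  shows "degree (scale_vars u v P) = degree P"
proof -
  have "coeff (scale_vars u v P) j = 0 \<longleftrightarrow> coeff P j = 0" for j
    using assms by (simp add: coeff_scale_vars pcompose_eq_0_iff)
  then show ?thesis by (simp add: degree_def)
qed

lemma poly_scale_vars:
  fixes P :: "'a::idom poly poly"
  assumes "u \<noteq> 0" "v \<noteq> 0"
  shows "poly (poly (scale_vars u v P) [:y:]) x = poly (poly P [:v * y:]) (u * x)"
  unfolding poly_poly_sum_coeff degree_scale_vars[OF assms]
  by (simp add: coeff_scale_vars poly_pcompose power_mult_distrib mult_ac)

text \<open>The inner variable is \<open>T ^ m2\<close>, so replacing \<open>T\<close> by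
  \<open>\<sigma> * T\<close> accounts for \<open>u\<close>; on the edge there remains a dilation by
  \<open>v / \<sigma> ^ m1\<close>.\<close>

lemma lead_coeff_weighted_subst_scale:
  fixes P :: "'a::field poly poly"
  assumes inf: "infinite (UNIV :: 'a set)" and nz: "u \<noteq> 0" "v \<noteq> 0" "\<sigma> \<noteq> 0" "\<sigma> ^ m2 = u"
  shows "\<exists>c. c \<noteq> 0 \<and> (\<forall>x. poly (lead_coeff (weighted_subst m1 m2 (scale_vars u v P))) x
           = c * poly (lead_coeff (weighted_subst m1 m2 P)) (v * x / \<sigma> ^ m1))"
proof -
  let ?S = "weighted_subst m1 m2 (scale_vars u v P)" and ?P = "weighted_subst m1 m2 P"
  have eq: "poly (coeff ?S k) x = \<sigma> ^ k * poly (coeff ?P k) (v * x / \<sigma> ^ m1)" for k x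
  proof -
    have "map_poly (\<lambda>c. poly c x) ?S = pcompose (map_poly (\<lambda>c. poly c (v * x / \<sigma> ^ m1)) ?P) [:0, \<sigma>:]"
    proof (rule poly_eqI_infinite[OF inf])
      fix T
      have "poly (poly ?S [:T:]) x = poly (poly ?P [:\<sigma> * T:]) (v * x / \<sigma> ^ m1)"
        using nz by (simp add: poly_weighted_subst poly_scale_vars power_mult_distrib field_simps)
      then show "poly (map_poly (\<lambda>c. poly c x) ?S) T
          = poly (pcompose (map_poly (\<lambda>c. poly c (v * x / \<sigma> ^ m1)) ?P) [:0, \<sigma>:]) T"
        by (simp add: poly_poly_const poly_pcompose mult.commute)
    qed
    then have "coeff (map_poly (\<lambda>c. poly c x) ?S) k
        = coeff (pcompose (map_poly (\<lambda>c. poly c (v * x / \<sigma> ^ m1)) ?P) [:0, \<sigma>:]) k" by simp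
    then show ?thesis by (simp add: coeff_map_poly coeff_pcompose_linear)
  qed
  have z: "coeff ?S k = 0 \<longleftrightarrow> coeff ?P k = 0" for k
  proof
    assume 0: "coeff ?S k = 0"
    show "coeff ?P k = 0"
    proof (rule poly_eqI_infinite[OF inf])
      fix x
      have "x = v * (x * \<sigma> ^ m1 / v) / \<sigma> ^ m1" using nz by simp
      then have "\<sigma> ^ k * poly (coeff ?P k) x = poly (coeff ?S k) (x * \<sigma> ^ m1 / v)" using eq by simp
      then show "poly (coeff ?P k) x = poly 0 x" using 0 nz by simp
    qed
  next
    assume "coeff ?P k = 0"
    then show "coeff ?S k = 0" by (intro poly_eqI_infinite[OF inf]) (simp add: eq)
  qed
  then have "degree ?S = degree ?P" by (simp add: degree_def)
  then show ?thesis using eq nz by (intro exI[of _ "\<sigma> ^ degree ?P"]) simp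
qed

text \<open>For large \<open>N\<close> this is P(1 / x, y / x) multiplied by \<open>x ^ N\<close> to
  clear denominators. If the inner variable is a slope y / x and the outer one 1 / x, it amounts to
  exchanging the coordinates of the plane.\<close>

definition invert_vars :: "nat \<Rightarrow> 'a::field poly poly \<Rightarrow> 'a poly poly" where
  "invert_vars N P = (\<Sum>j\<le>degree P. monom (monom 1 (N - j - degree (coeff P j)) * reflect_poly (coeff P j)) j)"

lemma coeff_invert_vars:
  "coeff (invert_vars N P) j
     = (if j \<le> degree P then monom 1 (N - j - degree (coeff P j)) * reflect_poly (coeff P j) else 0)"
proof -
  have "coeff (invert_vars N P) j = (\<Sum>l\<le>degree P. if l = j then monom 1 (N - l - degree (coeff P l)) * reflect_poly (coeff P l) else 0)"
    by (simp add: invert_vars_def coeff_sum coeff_monom)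
  then show ?thesis by auto
qed

lemma degree_invert_vars: "degree (invert_vars N P) = degree P"
proof (cases "P = 0")
  case True
  then show ?thesis by (simp add: invert_vars_def)
next
  case False
  then show ?thesis by (intro antisym degree_le le_degree) (auto simp: coeff_invert_vars)
qed

lemma poly_coeff_invert_vars:
  assumes "x \<noteq> 0" "inner_degree_le m P" "degree P + m \<le> N" "j \<le> degree P"
  shows "poly (coeff (invert_vars N P) j) x = x ^ (N - j) * poly (coeff P j) (inverse x)"
proof -
  have "N - j = (N - j - degree (coeff P j)) + degree (coeff P j)"
    using inner_degree_leD[OF assms(2), of j] assms(3,4) by linarith
  then have "x ^ (N - j) = x ^ (N - j - degree (coeff P j)) * x ^ degree (coeff P j)"
    by (metis power_add)
  then show ?thesis
    using assms(1,4) by (simp add: coeff_invert_vars poly_monom poly_reflect_poly_nz)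
qed

lemma poly_invert_vars:
  assumes "x \<noteq> 0" "inner_degree_le m P" "degree P + m \<le> N"
  shows "poly (poly (invert_vars N P) [:y:]) x = x ^ N * poly (poly P [:y / x:]) (inverse x)"
proof -
  have "x ^ (N - j) * poly (coeff P j) (inverse x) * y ^ j = x ^ N * (poly (coeff P j) (inverse x) * (y / x) ^ j)"
    if "j \<le> degree P" for j
  proof -
    have "x ^ N = x ^ (N - j) * x ^ j" using that assms(3) by (simp flip: power_add)
    then show ?thesis using assms(1) by (simp add: power_divide field_simps)
  qed
  then show ?thesis
    unfolding poly_poly_sum_coeff degree_invert_vars
    by (auto simp: poly_coeff_invert_vars[OF assms] sum_distrib_left intro!: sum.cong)
qed

text \<open>The quotient of \<open>h ^ (q ^ i) - h ^ (q ^ t)\<close> by \<open>h ^ q - h\<close>;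
  the sign depends on which exponent is larger.\<close>

definition difference_poly :: "nat \<Rightarrow> nat \<Rightarrow> nat \<Rightarrow> 'a::comm_ring_1 poly" where
  "difference_poly q t i =
     (if t < i then monom 1 (q ^ t - 1) * geometric_poly q (geometric_weight q t i)
      else if i < t then - (monom 1 (q ^ i - 1) * geometric_poly q (geometric_weight q i t))
      else 0)"

lemma poly_difference_poly:
  assumes "q > 1"
  shows "(h ^ q - h) * poly (difference_poly q t i) h = h ^ (q ^ i) - h ^ (q ^ t)"
proof -
  have *: "(h ^ q - h) * (h ^ (q ^ i - 1) * poly (geometric_poly q (geometric_weight q i j)) h)
      = h ^ (q ^ j) - h ^ (q ^ i)" if "i < j" for i j
  proof -
    have w: "(q - 1) * geometric_weight q i j + q ^ i = q ^ j"
      using that assms by (intro geometric_weight) auto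
    have 1: "h ^ q - h = h * (h ^ (q - 1) - 1)"
      using power_minus_mult[of q h] assms by (simp add: algebra_simps)
    have 2: "h * h ^ (q ^ i - 1) = h ^ (q ^ i)"
      using power_minus_mult[of "q ^ i" h] assms by (simp add: mult.commute)
    have "(h ^ q - h) * (h ^ (q ^ i - 1) * poly (geometric_poly q (geometric_weight q i j)) h)
        = (h * h ^ (q ^ i - 1)) * ((h ^ (q - 1) - 1) * poly (geometric_poly q (geometric_weight q i j)) h)"
      unfolding 1 by (simp only: mult_ac)
    also have "\<dots> = h ^ (q ^ i) * (h ^ ((q - 1) * geometric_weight q i j) - 1)"
      unfolding 2 poly_geometric_poly ..
    also have "\<dots> = h ^ ((q - 1) * geometric_weight q i j + q ^ i) - h ^ (q ^ i)"
      by (simp add: power_add right_diff_distrib mult.commute)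
    finally show ?thesis unfolding w .
  qed
  show ?thesis
    using *[of t i] *[of i t] by (auto simp: difference_poly_def poly_monom nat_neq_iff)
qed

lemma degree_geometric_poly_le: "degree (geometric_poly q n) \<le> (q - 1) * (n - 1)"
  unfolding geometric_poly_def
proof (intro degree_sum_le)
  fix j assume "j \<in> {..<n}"
  then have "(q - 1) * j \<le> (q - 1) * (n - 1)" by (intro mult_le_mono2) auto
  then show "degree (monom 1 ((q - 1) * j)) \<le> (q - 1) * (n - 1)" using degree_monom_le le_trans by blast
qed simp

lemma coeff_geometric_poly_top:
  assumes "q > 1" "n > 0"
  shows "coeff (geometric_poly q n) ((q - 1) * (n - 1)) = 1"
proof -
  have "(q - 1) * (n - 1) < (q - 1) * n" using assms by (intro mult_less_mono2) auto
  then show ?thesis using assms by (simp add: coeff_geometric_poly)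
qed

lemma difference_poly_degree:
  fixes i t q :: nat
  assumes "q > 1" "i \<noteq> t"
  defines "m \<equiv> max i t"
  shows "degree (difference_poly q t i :: 'a::comm_ring_1 poly) \<le> q ^ m - q"
    and "coeff (difference_poly q t i :: 'a poly) (q ^ m - q) = (if t < i then 1 else - 1)"
proof -
  have *: "degree (monom 1 (q ^ a - 1) * geometric_poly q (geometric_weight q a b) :: 'a poly) \<le> q ^ b - q \<and>
      coeff (monom 1 (q ^ a - 1) * geometric_poly q (geometric_weight q a b) :: 'a poly) (q ^ b - q) = 1"
    if ab: "a < b" for a b
  proof -
    let ?n = "geometric_weight q a b"
    have n: "?n > 0" using ab assms by (intro geometric_weight_pos) auto
    have w: "(q - 1) * ?n + q ^ a = q ^ b" using ab assms by (intro geometric_weight) auto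
    have "(q - 1) * (?n - 1) + (q - 1) = (q - 1) * ?n" using n by (cases ?n) auto
    moreover have "q ^ a \<ge> 1" using assms by simp
    ultimately have e: "q ^ b - q = (q ^ a - 1) + (q - 1) * (?n - 1)"
      using w assms by linarith
    have "degree (monom 1 (q ^ a - 1) * geometric_poly q ?n :: 'a poly)
        \<le> degree (monom 1 (q ^ a - 1) :: 'a poly) + degree (geometric_poly q ?n :: 'a poly)"
      by (rule degree_mult_le)
    also have "\<dots> \<le> (q ^ a - 1) + (q - 1) * (?n - 1)"
      by (intro add_mono degree_monom_le degree_geometric_poly_le)
    finally show ?thesis using coeff_geometric_poly_top[OF assms(1) n] by (simp add: e coeff_monom_mult)
  qed
  show "degree (difference_poly q t i :: 'a poly) \<le> q ^ m - q"
    "coeff (difference_poly q t i :: 'a poly) (q ^ m - q) = (if t < i then 1 else - 1)"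
    using *[of t i] *[of i t] assms(2) by (auto simp: difference_poly_def m_def max_def)
qed

lemma difference_poly_0_at_fixed:
  assumes "q > 1" "of_nat q = (0 :: 'a::field)" "t > 0" "(h :: 'a) ^ q = h"
  shows "poly (difference_poly q t 0) h = - 1"
proof -
  have e: "poly (difference_poly q t 0) h = - poly (geometric_poly q (geometric_weight q 0 t)) h"
    using assms(3) by (simp add: difference_poly_def)
  show ?thesis
  proof (cases "h = 0")
    case True
    have "geometric_weight q 0 t > 0" using assms by (intro geometric_weight_pos) auto
    then show ?thesis unfolding e using assms(1) True by (simp add: poly_0_coeff_0 coeff_geometric_poly)
  next
    case False
    have "h ^ (q - 1) * h = 1 * h" using power_minus_mult[of q h] assms by simp
    then have "h ^ (q - 1) = 1" using False mult_right_cancel by blast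
    then show ?thesis unfolding e using of_nat_geometric_weight_0[OF assms(2,3)]
      by (simp add: poly_geometric_poly_eq_1)
  qed
qed

text \<open>The polynomial \<open>coincidence_B\<close> in \<open>w\<close> (outer) and \<open>h\<close> (inner) satisfies
  \<open>(h ^ q - h) * coincidence_B = \<Sum>i\<le>d. a i * (h ^ q ^ i - h ^ q ^ t) * w ^ (q ^ d - q ^ i)\<close>;
  it vanishes at \<open>h = y / x\<close>, \<open>w = 1 / x\<close> if \<open>l y * x ^ (q ^ t) = l x * y ^ (q ^ t)\<close>.\<close>

definition coincidence_B :: "nat \<Rightarrow> nat \<Rightarrow> nat \<Rightarrow> (nat \<Rightarrow> 'a::comm_ring_1) \<Rightarrow> 'a poly poly" where
  "coincidence_B q d t a = (\<Sum>i\<le>d. monom (smult (a i) (difference_poly q t i)) (q ^ d - q ^ i))"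

lemma poly_coincidence_B:
  assumes "q > 1"
  shows "(h ^ q - h) * poly (poly (coincidence_B q d t a) [:w:]) h
           = (\<Sum>i\<le>d. a i * (h ^ (q ^ i) - h ^ (q ^ t)) * w ^ (q ^ d - q ^ i))"
proof -
  have "(h ^ q - h) * poly (poly (coincidence_B q d t a) [:w:]) h
      = (\<Sum>i\<le>d. a i * ((h ^ q - h) * poly (difference_poly q t i) h) * w ^ (q ^ d - q ^ i))"
    by (simp add: coincidence_B_def poly_sum poly_monom poly_const_pow sum_distrib_left mult_ac)
  then show ?thesis unfolding poly_difference_poly[OF assms] .
qed

lemma power_diff_inj:
  fixes q d :: nat
  assumes "q > 1" "i \<le> d" "j \<le> d"
  shows "q ^ d - q ^ i = q ^ d - q ^ j \<longleftrightarrow> i = j"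
proof -
  have "q ^ i \<le> q ^ d" "q ^ j \<le> q ^ d" using assms by (auto intro!: power_increasing)
  then have "q ^ d - q ^ i = q ^ d - q ^ j \<longleftrightarrow> q ^ i = q ^ j" by linarith
  then show ?thesis using assms(1) by (simp add: power_inject_exp)
qed

lemma coeff_coincidence_B_power:
  assumes "q > 1" "i \<le> d"
  shows "coeff (coincidence_B q d t a) (q ^ d - q ^ i) = smult (a i) (difference_poly q t i)"
proof -
  have "coeff (coincidence_B q d t a) (q ^ d - q ^ i)
      = (\<Sum>l\<le>d. if l = i then smult (a l) (difference_poly q t l) else 0)"
    unfolding coincidence_B_def coeff_sum coeff_monom
    using power_diff_inj[OF assms(1) _ assms(2)] by (intro sum.cong) auto
  then show ?thesis using assms by simp
qed

lemma degree_coincidence_B_le: "degree (coincidence_B q d t a) \<le> q ^ d - 1" if "q > 1"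
  unfolding coincidence_B_def
proof (intro degree_sum_le)
  fix i assume "i \<in> {..d}"
  have "q ^ d - q ^ i \<le> q ^ d - 1" using that by (intro diff_le_mono2) simp
  then show "degree (monom (smult (a i) (difference_poly q t i)) (q ^ d - q ^ i)) \<le> q ^ d - 1"
    using degree_monom_le le_trans by blast
qed simp

lemma poly_poly_eqI_off_fixed_points:
  fixes P S :: "'a::idom poly poly"
  assumes inf: "infinite (UNIV :: 'a set)" and q: "q > 1"
    and eq: "\<And>h w. h ^ q \<noteq> h \<Longrightarrow> poly (poly P [:w:]) h = poly (poly S [:w:]) h"
  shows "P = S"
proof (rule poly_poly_eqI[OF _ inf])
  let ?p = "monom 1 q - [:0, 1:] :: 'a poly"
  have "coeff ?p q = 1" using q by (simp add: coeff_pCons split: nat.splits)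
  then have "?p \<noteq> 0" by (metis coeff_0 zero_neq_one)
  then have "finite {h. poly ?p h = 0}" by (rule poly_roots_finite)
  then have "finite {h::'a. h ^ q = h}" by (simp add: poly_monom)
  then have "infinite (UNIV - {h::'a. h ^ q = h})" using inf by (simp add: Diff_infinite_finite)
  moreover have "UNIV - {h::'a. h ^ q = h} = {h. h ^ q \<noteq> h}" by auto
  ultimately show "infinite {h::'a. h ^ q \<noteq> h}" by simp
qed (use eq in auto)

section \<open>Two families of simple roots that tell the factors apart: slopes at the origin and
  roots on the edge\<close>

locale case_B =
  fixes q d t e :: nat
    and a :: "nat \<Rightarrow> 'a::{alg_closed_field, euclidean_ring_gcd, semiring_gcd_mult_normalize}"
  assumes char: "prime CHAR('a)" and q_char: "q = CHAR('a) ^ e" and odd_q: "odd q" and q1: "q > 1"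
    and inf: "infinite (UNIV :: 'a set)"
    and t: "2 \<le> t" "t < d" "coprime t d" and odd_d: "odd d"
    and a0: "a 0 \<noteq> 0" and ad: "a d \<noteq> 0"
begin

abbreviation "Phi \<equiv> coincidence_B q d t a"
abbreviation "m1 \<equiv> geometric_weight q t d"
abbreviation "m2 \<equiv> geometric_weight q 0 d"
abbreviation "edge P \<equiv> lead_coeff (weighted_subst m1 m2 P)"

lemma of_nat_q: "of_nat q = (0 :: 'a)"
proof -
  have "e \<noteq> 0" using q1 q_char by (cases e) auto
  then show ?thesis by (simp add: q_char)
qed

lemma frob_add: "(x + y) ^ (q ^ i) = x ^ (q ^ i) + y ^ (q ^ i)" for x y :: 'a
  using char by (intro freshmans_dream'[where n = "e * i"]) (simp_all add: q_char power_mult)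

lemma m_rel: "(q - 1) * m1 + q ^ t = q ^ d" "(q - 1) * m2 + 1 = q ^ d"
  using geometric_weight[of t d q] geometric_weight[of 0 d q] t q1 by auto

lemma m_pos: "m1 > 0" "m2 > 0" "m1 < m2"
proof -
  show "m1 > 0" "m2 > 0" using t q1 by (auto intro!: geometric_weight_pos)
  have "q ^ t > 1" using t q1 by (intro one_less_power) auto
  then have "(q - 1) * m1 < (q - 1) * m2" using m_rel by linarith
  then show "m1 < m2" by simp
qed

text \<open>\<open>m2\<close> is a sum of \<open>d\<close> odd terms with \<open>d\<close> odd, it
  is 1 modulo \<open>q\<close>, and \<open>m1\<close> is \<open>q ^ t\<close> times a weight of
  length \<open>d - t\<close>, which is prime to \<open>d\<close>. The factor 2 is included because
  only scalings of slopes by squares will be known to fix a factor.\<close>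

lemma coprime_m: "coprime (2 * m1) m2"
proof -
  have "odd m2" unfolding geometric_weight_def
    using odd_q odd_d by (simp add: even_sum_iff atLeast0LessThan card_Collect_less_nat)
  then have "coprime 2 m2" by (simp add: coprime_left_2_iff_odd)
  moreover have "coprime q m2"
  proof -
    obtain d' where "d = Suc d'" using t by (cases d) auto
    then have m2: "m2 = 1 + q * geometric_weight q 0 d'" by (simp add: geometric_weight_Suc)
    show ?thesis
    proof (rule coprimeI)
      fix c assume c: "c dvd q" "c dvd m2"
      then have "c dvd q * geometric_weight q 0 d'" by simp
      then show "is_unit c" using c(2) unfolding m2 using dvd_add_left_iff by blast
    qed
  qed
  moreover have "coprime (geometric_weight q 0 (d - t)) m2"
  proof (rule coprime_geometric_weight)
    show "d - t > 0" using t by simp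
    show "coprime (d - t) d"
    proof (rule coprimeI)
      fix c assume c: "c dvd d - t" "c dvd d"
      have "c dvd d - (d - t)" using c(2,1) by (rule dvd_diff_nat)
      then have "c dvd t" using t by simp
      then show "is_unit c" using c(2) by (rule coprime_common_divisor[OF t(3)])
    qed
  qed
  ultimately show ?thesis using t by (simp add: geometric_weight_shift[of t d])
qed

lemma degree_Phi: "degree Phi = q ^ d - 1" and lead_Phi: "lead_coeff Phi = smult (a 0) (difference_poly q t 0)"
proof -
  have c: "coeff Phi (q ^ d - 1) = smult (a 0) (difference_poly q t 0)"
    using coeff_coincidence_B_power[OF q1, of 0 d t a] by simp
  have "coeff (difference_poly q t 0 :: 'a poly) (q ^ t - q) \<noteq> 0"
    using difference_poly_degree(2)[OF q1, of 0 t, where 'a='a] t by simp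
  then have "difference_poly q t 0 \<noteq> (0 :: 'a poly)" by auto
  then have "coeff Phi (q ^ d - 1) \<noteq> 0" using a0 c by simp
  then show d: "degree Phi = q ^ d - 1" using degree_coincidence_B_le[OF q1] by (intro antisym le_degree) auto
  show "lead_coeff Phi = smult (a 0) (difference_poly q t 0)" using c d by simp
qed

lemma qd2: "q ^ d > 2"
proof -
  have "q ^ 1 < q ^ d" using q1 t by (intro power_strict_increasing) auto
  then show ?thesis using q1 by simp
qed

lemma Phi_nonzero: "Phi \<noteq> 0"
  using degree_Phi qd2 by auto

text \<open>Zeros of the leading coefficient in w = 1 / x are the slopes of the branches at the
  origin. At elements of F_q the quotient equals -1, so only the other fixed points of the
  \<open>t\<close>-th Frobenius power remain.\<close>

lemma theta_iff: "poly (difference_poly q t 0) \<theta> = 0 \<longleftrightarrow> \<theta> ^ (q ^ t) = \<theta> \<and> \<theta> ^ q \<noteq> \<theta>" for \<theta> :: 'a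
proof -
  have p: "(\<theta> ^ q - \<theta>) * poly (difference_poly q t 0) \<theta> = \<theta> - \<theta> ^ (q ^ t)"
    using poly_difference_poly[OF q1, of \<theta> t 0] by simp
  show ?thesis
  proof (cases "\<theta> ^ q = \<theta>")
    case True
    then show ?thesis using difference_poly_0_at_fixed[OF q1 of_nat_q _ True, of t] t by simp
  next
    case False
    then show ?thesis using p by auto
  qed
qed

text \<open>Multiplied by \<open>h ^ q - h\<close>, the leading coefficient becomes a constant
  multiple of \<open>h - h ^ (q ^ t)\<close>, whose derivative is constant and nonzero. So each
  slope belongs to one factor only.\<close>

lemma theta_simple:
  assumes "Phi = S * T" "poly (lead_coeff S) \<theta> = 0" "poly (lead_coeff T) \<theta> = 0"
  shows False
proof -
  let ?c = "difference_poly q t 0 :: 'a poly"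
  have l: "lead_coeff S * lead_coeff T = smult (a 0) ?c"
    using assms(1) lead_Phi by (simp add: lead_coeff_mult)
  then have "poly (lead_coeff S * lead_coeff T) \<theta> = poly (smult (a 0) ?c) \<theta>" by simp
  then have c0: "poly ?c \<theta> = 0" using assms a0 by simp
  from l have "poly (pderiv (lead_coeff S * lead_coeff T)) \<theta> = poly (pderiv (smult (a 0) ?c)) \<theta>" by simp
  then have c1: "poly (pderiv ?c) \<theta> = 0" using assms a0 by (simp add: pderiv_mult pderiv_smult)
  have "(monom 1 q - [:0, 1:]) * ?c = [:0, 1:] - monom 1 (q ^ t)"
    using poly_difference_poly[OF q1, of _ t 0] by (intro poly_eqI_infinite[OF inf]) (simp add: poly_monom)
  then have "poly (pderiv ((monom 1 q - [:0, 1:]) * ?c)) \<theta> = poly (pderiv ([:0, 1:] - monom 1 (q ^ t))) \<theta>"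
    by simp
  then have "0 = poly (pderiv ([:0, 1:] - monom 1 (q ^ t))) \<theta>"
    using c0 c1 by (simp add: pderiv_mult)
  also have "\<dots> = 1" using of_nat_q t by (simp add: pderiv_diff pderiv_monom pderiv_pCons power_0_left)
  finally show False by simp
qed

lemma edge_mult: "edge (P * S) = edge P * edge S" for P S :: "'a poly poly"
  by (simp add: weighted_subst_mult[OF inf] lead_coeff_mult)

text \<open>The weights are made for the two monomials \<open>h ^ (q ^ d - q)\<close> from
  \<open>i = d\<close> and \<open>h ^ (q ^ t - q) * w ^ (q ^ d - 1)\<close> from
  \<open>i = 0\<close>: both attain the weight \<open>W\<close>, and nothing else does.\<close>

lemma edge_Phi: "edge Phi = [:a d:] - monom (a 0) (q ^ d - 1)"
proof -
  define W where "W = m2 * (q ^ d - q)"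
  define term' where "term' = (\<lambda>i. map_poly (\<lambda>c. monom c (q ^ d - q ^ i))
      (pcompose (smult (a i) (difference_poly q t i)) (monom 1 m2)) * monom 1 (m1 * (q ^ d - q ^ i)) :: 'a poly poly)"
  have W: "weighted_subst m1 m2 Phi = (\<Sum>i\<le>d. term' i)"
    by (rule poly_poly_eqI[OF inf inf])
      (simp add: poly_weighted_subst coincidence_B_def term'_def poly_sum poly_monom poly_const_pow
        poly_map_poly_monom poly_pcompose power_mult_distrib mult_ac flip: power_mult)
  have ct: "coeff (term' i) k = (if m1 * (q ^ d - q ^ i) \<le> k \<and> m2 dvd (k - m1 * (q ^ d - q ^ i))
      then monom (a i * coeff (difference_poly q t i) ((k - m1 * (q ^ d - q ^ i)) div m2)) (q ^ d - q ^ i) else 0)" for i k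
    using m_pos(2)
    by (auto simp: term'_def mult.commute[of _ "monom 1 _"] coeff_monom_mult coeff_map_poly coeff_pcompose_monom)
  have low: "coeff (term' i) k = 0"
    if i: "i \<noteq> t" "i \<le> d" "m2 * (q ^ max i t - q) + m1 * (q ^ d - q ^ i) < k" for i k
  proof -
    have "coeff (difference_poly q t i :: 'a poly) ((k - m1 * (q ^ d - q ^ i)) div m2) = 0"
      if "m2 dvd (k - m1 * (q ^ d - q ^ i))"
    proof (rule coeff_eq_0)
      have "m2 * (q ^ max i t - q) < k - m1 * (q ^ d - q ^ i)" using i(3) by linarith
      also have "\<dots> = m2 * ((k - m1 * (q ^ d - q ^ i)) div m2)" using that by simp
      finally have "q ^ max i t - q < (k - m1 * (q ^ d - q ^ i)) div m2" by simp
      then show "degree (difference_poly q t i :: 'a poly) < (k - m1 * (q ^ d - q ^ i)) div m2"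
        using difference_poly_degree(1)[OF q1 i(1), where 'a='a] by linarith
    qed
    then show ?thesis by (simp add: ct)
  qed
  have qmono: "q ^ i < q ^ j" if "i < j" for i j using that q1 by (intro power_strict_increasing) auto
  have key: "m2 * (q ^ d - q ^ t) = m1 * (q ^ d - 1)"
  proof -
    have "q ^ d - q ^ t = (q - 1) * m1" "q ^ d - 1 = (q - 1) * m2" using m_rel by linarith+
    then show ?thesis by (simp only: mult_ac)
  qed
  have W0: "m2 * (q ^ t - q) + m1 * (q ^ d - 1) = W"
  proof -
    have "q ^ 1 < q ^ t" using t by (intro qmono) auto
    then have "(q ^ t - q) + (q ^ d - q ^ t) = q ^ d - q" using qmono[of t d] t by simp
    then show ?thesis unfolding W_def key[symmetric] by (simp flip: distrib_left)
  qed
  \<comment> \<open>Below \<open>t\<close> the degree in h is that of \<open>i = 0\<close> and the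
    degree in w is smaller. Above \<open>t\<close> the two degrees add up to
    \<open>q ^ d - q\<close> as for \<open>i = d\<close>, but part of it counts with weight
    \<open>m1 < m2\<close>.\<close>
  have mid: "m2 * (q ^ max i t - q) + m1 * (q ^ d - q ^ i) < W" if i: "i \<noteq> t" "0 < i" "i < d" for i
  proof (cases "i < t")
    case True
    have "1 < q ^ i" "q ^ i < q ^ d" using qmono[of 0 i] qmono[of i d] i by auto
    then have "m1 * (q ^ d - q ^ i) < m1 * (q ^ d - 1)" using m_pos by (intro mult_less_mono2) auto
    moreover have "max i t = t" using True by simp
    ultimately show ?thesis using W0 by presburger
  next
    case False
    then have "max i t = i" by simp
    have "q ^ 1 \<le> q ^ i" using i q1 by (intro power_increasing) auto
    then have s: "(q ^ i - q) + (q ^ d - q ^ i) = q ^ d - q" using qmono[OF i(3)] by simp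
    have "m1 * (q ^ d - q ^ i) < m2 * (q ^ d - q ^ i)" using m_pos qmono[OF i(3)] by simp
    then have "m2 * (q ^ i - q) + m1 * (q ^ d - q ^ i) < m2 * (q ^ i - q) + m2 * (q ^ d - q ^ i)" by simp
    also have "\<dots> = W" unfolding W_def distrib_left[symmetric] s ..
    finally show ?thesis using \<open>max i t = i\<close> by simp
  qed
  have at_t: "term' t = 0" by (simp add: term'_def difference_poly_def)
  have above: "coeff (term' i) k = 0" if ki: "k > W" "i \<le> d" for i k
  proof -
    consider "i = t" | "i = 0" | "i = d" | "i \<noteq> t" "0 < i" "i < d" using ki by linarith
    then show ?thesis
    proof cases
      case 2
      then show ?thesis using W0 ki t by (intro low) auto
    next
      case 3
      then show ?thesis using ki t by (intro low) (auto simp: W_def max_def)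
    next
      case 4
      then show ?thesis using mid[OF 4] ki by (intro low) auto
    qed (simp add: at_t)
  qed
  have cW: "coeff (weighted_subst m1 m2 Phi) W = [:a d:] - monom (a 0) (q ^ d - 1)"
  proof -
    have "coeff (weighted_subst m1 m2 Phi) W = (\<Sum>i\<in>{0, d}. coeff (term' i) W)"
      unfolding W coeff_sum
    proof (intro sum.mono_neutral_right ballI)
      fix i assume "i \<in> {..d} - {0, d}"
      then show "coeff (term' i) W = 0" using mid[of i] low[of i W] at_t by (cases "i = t") auto
    qed auto
    also have "\<dots> = coeff (term' 0) W + coeff (term' d) W" using t by simp
    also have "coeff (term' d) W = [:a d:]"
      using difference_poly_degree(2)[OF q1, of d t, where 'a='a] t m_pos
      by (simp add: ct W_def monom_0 max_def)
    also have "coeff (term' 0) W = - monom (a 0) (q ^ d - 1)"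
    proof -
      have "W - m1 * (q ^ d - 1) = m2 * (q ^ t - q)" "m1 * (q ^ d - 1) \<le> W" using W0 by linarith+
      then show ?thesis using difference_poly_degree(2)[OF q1, of 0 t, where 'a='a] t m_pos
        by (simp add: ct minus_monom)
    qed
    finally show ?thesis by simp
  qed
  have "coeff ([:a d:] - monom (a 0) (q ^ d - 1)) 0 = a d" using qd2 by simp
  then have "[:a d:] - monom (a 0) (q ^ d - 1) \<noteq> 0" using ad by (metis coeff_0)
  then have "degree (weighted_subst m1 m2 Phi) = W"
    using cW above unfolding W by (intro antisym degree_le le_degree) (auto simp: coeff_sum)
  then show ?thesis using cW by simp
qed

text \<open>The exponent \<open>q ^ d - 1\<close> is -1 in the field and \<open>a d\<close> is
  nonzero, so the edge polynomial of \<open>Phi\<close> is separable.\<close>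

lemma omega_simple:
  assumes "Phi = S * T" "poly (edge S) x = 0" "poly (edge T) x = 0"
  shows False
proof -
  have e: "edge S * edge T = [:a d:] - monom (a 0) (q ^ d - 1)"
    using edge_Phi edge_mult assms(1) by metis
  then have "poly (edge S * edge T) x = poly ([:a d:] - monom (a 0) (q ^ d - 1)) x" by simp
  then have 1: "a d = a 0 * x ^ (q ^ d - 1)" using assms(2,3) by (simp add: poly_monom)
  from e have "poly (pderiv (edge S * edge T)) x = poly (pderiv ([:a d:] - monom (a 0) (q ^ d - 1))) x" by simp
  then have "poly (pderiv ([:a d:] - monom (a 0) (q ^ d - 1))) x = 0"
    using assms(2,3) by (simp add: pderiv_mult)
  moreover have "of_nat (q ^ d - 1) = (- 1 :: 'a)"
  proof -
    have "of_nat (q ^ d - 1) = (of_nat (q ^ d) - of_nat 1 :: 'a)" using q1 by (intro of_nat_diff) simp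
    then show ?thesis using of_nat_q t by (simp add: power_0_left)
  qed
  ultimately have "a 0 * x ^ (q ^ d - 1 - 1) = 0"
    by (simp add: pderiv_diff pderiv_monom pderiv_pCons poly_monom)
  then have "x = 0" using a0 by auto
  then show False using 1 ad qd2 by (simp add: power_0_left)
qed

text \<open>An edge never has larger degree than its polynomial; for \<open>Phi\<close> both are
  \<open>q ^ d - 1\<close>, and additivity forces equality for every factor.\<close>

lemma edge_degree:
  assumes "Phi = S * T"
  shows "degree (edge S) = degree S"
proof -
  have le: "degree (edge P) \<le> degree P" for P :: "'a poly poly"
    using inner_degree_weighted_subst by (rule inner_degree_leD)
  have nz: "S \<noteq> 0" "T \<noteq> 0" using assms Phi_nonzero by auto
  have "degree ([:a d:] - monom (a 0) (q ^ d - 1)) = q ^ d - 1"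
  proof (intro antisym le_degree degree_diff_le)
    show "coeff ([:a d:] - monom (a 0) (q ^ d - 1)) (q ^ d - 1) \<noteq> 0"
      using a0 qd2 by (simp add: coeff_pCons split: nat.splits)
  qed (auto intro: degree_monom_le)
  then have "degree (edge S * edge T) = q ^ d - 1" using edge_Phi edge_mult assms by metis
  moreover have "edge S \<noteq> 0" "edge T \<noteq> 0"
    using calculation qd2 by auto
  ultimately have "degree (edge S) + degree (edge T) = degree S + degree T"
    using assms degree_Phi nz by (metis degree_mult_eq)
  then show ?thesis using le[of S] le[of T] by linarith
qed

text \<open>By \<open>edge_degree\<close> only a factor free of w could lack a root. It would divide
  all coefficients, and a common zero lies in F_(q^t) and F_(q^d), hence in F_q, which
  \<open>theta_iff\<close> excludes.\<close>

lemma omega_exists: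
  assumes "Phi = S * T" "\<not> S dvd 1"
  obtains x where "poly (edge S) x = 0"
proof -
  have "degree S \<noteq> 0"
  proof
    assume "degree S = 0"
    then obtain s where s: "S = [:s:]" by (rule degree_eq_zeroE)
    have dv: "s dvd coeff Phi i" for i using assms(1) s by simp
    have "degree s \<noteq> 0"
    proof
      assume "degree s = 0"
      then obtain c where "s = [:c:]" by (rule degree_eq_zeroE)
      then show False using assms s Phi_nonzero by (auto simp: is_unit_poly_poly_iff)
    qed
    then obtain h where h: "poly s h = 0" using alg_closed_imp_poly_has_root[of s] by auto
    have z: "poly (coeff Phi i) h = 0" for i using poly_dvd_poly[OF dv, of h i] h by simp
    have "poly (difference_poly q t 0) h = 0"
      using z[of "q ^ d - q ^ 0"] a0 unfolding coeff_coincidence_B_power[OF q1 le0] by simp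
    then have h1: "h ^ (q ^ t) = h" "h ^ q \<noteq> h" by (simp_all add: theta_iff)
    have "poly (difference_poly q t d) h = 0"
      using z[of "q ^ d - q ^ d"] ad unfolding coeff_coincidence_B_power[OF q1 order_refl] by simp
    then have "h ^ (q ^ d) = h" using poly_difference_poly[OF q1, of h t d] h1 by simp
    then show False using frobenius_fixed_coprime[OF h1(1) _ t(3)] t h1(2) by simp
  qed
  then have "degree (edge S) > 0" using edge_degree[OF assms(1)] by simp
  then show ?thesis using alg_closed_imp_poly_has_root that by blast
qed

end

section \<open>The group GL_2 over F_q and its effect on the factors\<close>

context case_B
begin

lemma shift_Phi: "c ^ q = c \<Longrightarrow> shift_inner c Phi = Phi"
proof (rule poly_poly_eqI_off_fixed_points[OF inf q1])
  fix h w :: 'a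
  assume c: "c ^ q = c" and h: "h ^ q \<noteq> h"
  have cq: "c ^ (q ^ i) = c" for i
    by (induction i) (simp_all add: c power_mult)
  have hq: "(h + c) ^ q = h ^ q + c" using frob_add[of h c 1] c by simp
  have "(h ^ q - h) * poly (poly Phi [:w:]) (h + c) = ((h + c) ^ q - (h + c)) * poly (poly Phi [:w:]) (h + c)"
    unfolding hq by simp
  also have "\<dots> = (h ^ q - h) * poly (poly Phi [:w:]) h"
    unfolding poly_coincidence_B[OF q1] by (simp add: frob_add cq)
  finally show "poly (poly (shift_inner c Phi) [:w:]) h = poly (poly Phi [:w:]) h"
    using h by (simp add: poly_shift_inner)
qed

lemma scale_Phi:
  assumes "u ^ q = u" "v ^ q = v" "u \<noteq> 0" "v \<noteq> 0"
  shows "scale_vars u v Phi = Phi"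
proof (rule poly_poly_eqI_off_fixed_points[OF inf q1])
  fix h w :: 'a
  assume h: "h ^ q \<noteq> h"
  have uq: "u ^ (q ^ i) = u" for i
    by (induction i) (simp_all add: assms power_mult)
  have v1: "v ^ (q - 1) = 1"
  proof -
    have "v ^ (q - 1) * v = 1 * v" using power_minus_mult[of q v] q1 assms by simp
    then show ?thesis using assms mult_right_cancel by blast
  qed
  have vq: "v ^ (q ^ d - q ^ i) = 1" if "i \<le> d" for i
  proof -
    have "q ^ d - q ^ i = (q - 1) * geometric_weight q i d"
      using geometric_weight[of i d q] that q1 by simp
    then show ?thesis by (simp only: power_mult v1 power_one)
  qed
  have "u * ((h ^ q - h) * poly (poly Phi [:v * w:]) (u * h))
      = ((u * h) ^ q - u * h) * poly (poly Phi [:v * w:]) (u * h)"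
    by (simp add: power_mult_distrib assms algebra_simps)
  also have "\<dots> = u * ((h ^ q - h) * poly (poly Phi [:w:]) h)"
    unfolding poly_coincidence_B[OF q1] sum_distrib_left
    by (intro sum.cong) (auto simp: power_mult_distrib uq vq algebra_simps)
  finally show "poly (poly (scale_vars u v Phi) [:w:]) h = poly (poly Phi [:w:]) h"
    using h assms by (simp add: poly_scale_vars)
qed

text \<open>Exchanging x and y sends (h, w) to (1 / h, w / h). The numerator thereby picks up the
  exponent \<open>q ^ t + q ^ d\<close>, the denominator \<open>h ^ q - h\<close> the exponent
  \<open>q + 1\<close>.\<close>

lemma invert_Phi:
  assumes "h ^ q \<noteq> h"
  shows "h ^ (q ^ t + q ^ d - q - 1) * poly (poly Phi [:w / h:]) (inverse h) = poly (poly Phi [:w:]) h"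
proof -
  have h: "h \<noteq> 0" using assms q1 by (auto simp: power_0_left)
  have ihq: "inverse h ^ q - inverse h = - (h ^ q - h) / h ^ (q + 1)"
    using h by (simp add: field_simps)
  have trm: "(inverse h ^ (q ^ i) - inverse h ^ (q ^ t)) * (w / h) ^ (q ^ d - q ^ i)
      = - ((h ^ (q ^ i) - h ^ (q ^ t)) * w ^ (q ^ d - q ^ i) / h ^ (q ^ t + q ^ d))" if "i \<le> d" for i
  proof -
    have "q ^ i \<le> q ^ d" using that q1 by (intro power_increasing) auto
    then have e: "h ^ (q ^ d) = h ^ (q ^ d - q ^ i) * h ^ (q ^ i)" by (simp flip: power_add)
    show ?thesis unfolding power_add e using h by (simp add: power_divide field_simps)
  qed
  have "- (h ^ q - h) / h ^ (q + 1) * poly (poly Phi [:w / h:]) (inverse h)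
      = (\<Sum>i\<le>d. a i * ((inverse h ^ (q ^ i) - inverse h ^ (q ^ t)) * (w / h) ^ (q ^ d - q ^ i)))"
    unfolding ihq[symmetric] poly_coincidence_B[OF q1] by (simp only: mult.assoc)
  also have "\<dots> = (\<Sum>i\<le>d. - (a i * (h ^ (q ^ i) - h ^ (q ^ t)) * w ^ (q ^ d - q ^ i) / h ^ (q ^ t + q ^ d)))"
    by (intro sum.cong) (auto simp: trm mult.assoc)
  also have "\<dots> = - ((h ^ q - h) * poly (poly Phi [:w:]) h) / h ^ (q ^ t + q ^ d)"
    unfolding poly_coincidence_B[OF q1] by (simp add: sum_divide_distrib sum_negf)
  finally have eq: "- (h ^ q - h) / h ^ (q + 1) * poly (poly Phi [:w / h:]) (inverse h)
      = - ((h ^ q - h) * poly (poly Phi [:w:]) h) / h ^ (q ^ t + q ^ d)" .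
  have cross: "A * (x * C) = A * (y * B)" if "- A / B * x = - (A * y) / C" "B \<noteq> 0" "C \<noteq> 0"
    for A B C x y :: 'a
    using that by (simp add: field_simps)
  have "(h ^ q - h) * (poly (poly Phi [:w / h:]) (inverse h) * h ^ (q ^ t + q ^ d))
      = (h ^ q - h) * (poly (poly Phi [:w:]) h * h ^ (q + 1))"
    using h by (intro cross[OF eq]) auto
  then have 1: "poly (poly Phi [:w / h:]) (inverse h) * h ^ (q ^ t + q ^ d) = poly (poly Phi [:w:]) h * h ^ (q + 1)"
    using assms by simp
  have "q ^ 1 \<le> q ^ t" "q ^ 1 \<le> q ^ d" using t q1 by (intro power_increasing; simp)+
  then have "q ^ t + q ^ d = (q ^ t + q ^ d - q - 1) + (q + 1)" using q1 by simp
  then have "h ^ (q ^ t + q ^ d) = h ^ (q ^ t + q ^ d - q - 1) * h ^ (q + 1)" by (metis power_add)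
  with 1 show ?thesis using h by (simp add: mult_ac)
qed

text \<open>Two branches at the origin, given by their slopes, lie on the same component.\<close>

definition linked :: "'a \<Rightarrow> 'a \<Rightarrow> bool" where
  "linked x y \<longleftrightarrow> (\<exists>P. prime_elem P \<and> P dvd Phi \<and> poly (lead_coeff P) x = 0 \<and> poly (lead_coeff P) y = 0)"

lemma prime_factor_at:
  assumes "poly (difference_poly q t 0) \<theta> = 0"
  obtains P where "prime_elem P" "P dvd Phi" "poly (lead_coeff P) \<theta> = 0"
proof -
  have "\<exists>P. prime_elem P \<and> P dvd A \<and> poly (lead_coeff P) \<theta> = 0"
    if "A \<noteq> 0" "poly (lead_coeff A) \<theta> = 0" for A :: "'a poly poly"
    using that
  proof (induction A rule: prime_divisors_induct)
    case zero
    then show ?case by simp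
  next
    case (unit A)
    then show ?case by (auto simp: is_unit_poly_poly_iff)
  next
    case (factor p A)
    then have "p \<noteq> 0" "A \<noteq> 0" by auto
    show ?case
    proof (cases "poly (lead_coeff p) \<theta> = 0")
      case True
      then show ?thesis using factor by (intro exI[of _ p]) auto
    next
      case False
      then have "poly (lead_coeff A) \<theta> = 0" using factor.prems by (simp add: lead_coeff_mult)
      then show ?thesis using factor.IH[OF \<open>A \<noteq> 0\<close>] by auto
    qed
  qed
  from this[OF Phi_nonzero] show ?thesis using that assms lead_Phi by auto
qed

lemma lead_coeff_dvd_root:
  fixes P S :: "'a poly poly"
  assumes "P dvd S" "poly (lead_coeff P) x = 0"
  shows "poly (lead_coeff S) x = 0"
  using assms by (auto simp: lead_coeff_mult elim!: dvdE)

text \<open>A slope shared with \<open>S\<close> cannot also belong to \<open>T\<close>, by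
  \<open>theta_simple\<close>.\<close>

lemma prime_dvd_of_shared_theta:
  assumes "prime_elem P" "P dvd Phi" "Phi = S * T" "poly (lead_coeff P) \<theta> = 0" "poly (lead_coeff S) \<theta> = 0"
  shows "P dvd S"
proof (rule ccontr)
  assume "\<not> P dvd S"
  moreover have "P dvd S * T" using assms(2,3) by simp
  ultimately have "P dvd T" using assms(1) prime_elem_dvd_multD by blast
  then have "poly (lead_coeff T) \<theta> = 0" using assms(4) by (rule lead_coeff_dvd_root)
  then show False using theta_simple assms(3,5) by blast
qed

lemma linked_trans:
  assumes "linked x y" "linked y z"
  shows "linked x z"
proof -
  from assms(1) obtain P where P: "prime_elem P" "P dvd Phi" "poly (lead_coeff P) x = 0" "poly (lead_coeff P) y = 0"
    by (auto simp: linked_def)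
  from assms(2) obtain S where S: "prime_elem S" "S dvd Phi" "poly (lead_coeff S) y = 0" "poly (lead_coeff S) z = 0"
    by (auto simp: linked_def)
  from P(2) obtain T where "Phi = P * T" by (elim dvdE)
  then have "S dvd P" using prime_dvd_of_shared_theta[OF S(1,2)] S(3) P(4) by blast
  then have "poly (lead_coeff P) z = 0" using S(4) by (rule lead_coeff_dvd_root)
  then show ?thesis using P by (auto simp: linked_def)
qed

text \<open>A translation does not change the edge, and edge roots are simple, so the translate of
  \<open>P\<close> must contain \<open>P\<close> again. Comparing leading coefficients moves the
  slope by \<open>c\<close>.\<close>

lemma linked_shift:
  assumes "poly (difference_poly q t 0) \<theta> = 0" "c ^ q = c"
  shows "linked \<theta> (\<theta> + c)"
proof -
  obtain P where P: "prime_elem P" "P dvd Phi" "poly (lead_coeff P) \<theta> = 0"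
    using prime_factor_at[OF assms(1)] .
  from P(2) obtain T where PT: "Phi = P * T" by (elim dvdE)
  have P0: "P \<noteq> 0" "\<not> P dvd 1" using P(1) by auto
  obtain x where x: "poly (edge P) x = 0" using omega_exists[OF PT P0(2)] .
  let ?s = "shift_inner c"
  have s: "Phi = ?s P * ?s T"
  proof -
    have "?s (P * T) = ?s P * ?s T"
      by (rule poly_poly_eqI[OF inf inf]) (simp add: poly_shift_inner)
    then show ?thesis using shift_Phi[OF assms(2)] PT by simp
  qed
  have sx: "poly (edge (?s P)) x = 0"
    using lead_coeff_weighted_subst_shift[OF m_pos(2) P0(1), of m1 c] x by simp
  have "P dvd ?s P"
  proof (rule ccontr)
    assume "\<not> P dvd ?s P"
    moreover have "P dvd ?s P * ?s T" using P(2) s by simp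
    ultimately have "P dvd ?s T" using P(1) prime_elem_dvd_multD by blast
    then obtain Z where "?s T = P * Z" by (elim dvdE)
    then have "poly (edge (?s T)) x = 0" using x by (simp add: edge_mult)
    then show False using omega_simple[OF s sx] by blast
  qed
  then have "poly (lead_coeff (?s P)) \<theta> = 0" using P(3) by (rule lead_coeff_dvd_root)
  then have "poly (lead_coeff P) (\<theta> + c) = 0"
    by (simp add: degree_shift_inner coeff_shift_inner poly_pcompose add.commute)
  then show ?thesis using P by (auto simp: linked_def)
qed

lemma theta_inverse:
  fixes \<theta> :: 'a
  assumes "poly (difference_poly q t 0) \<theta> = 0"
  shows "\<theta> \<noteq> 0" "poly (difference_poly q t 0) (inverse \<theta>) = 0"
proof -
  show "\<theta> \<noteq> 0" using assms q1 by (auto simp: theta_iff power_0_left)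
  show "poly (difference_poly q t 0) (inverse \<theta>) = 0" using assms
    by (simp add: theta_iff power_inverse)
qed

lemma theta_shift:
  fixes \<theta> c :: 'a
  assumes "poly (difference_poly q t 0) \<theta> = 0" "c ^ q = c"
  shows "poly (difference_poly q t 0) (\<theta> + c) = 0"
proof -
  have "c ^ (q ^ i) = c" for i by (induction i) (simp_all add: assms(2) power_mult)
  then show ?thesis using assms frob_add[of \<theta> c t] frob_add[of \<theta> c 1] by (simp add: theta_iff)
qed

text \<open>Inversion maps factors to factors up to powers of h, so slopes on one component go to
  slopes on one component, possibly a different one.\<close>

lemma linked_inverse:
  assumes "linked \<theta> \<theta>'"
  shows "linked (inverse \<theta>) (inverse \<theta>')"
proof -
  from assms obtain P where P: "prime_elem P" "P dvd Phi" "poly (lead_coeff P) \<theta> = 0" "poly (lead_coeff P) \<theta>' = 0"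
    by (auto simp: linked_def)
  have th: "poly (difference_poly q t 0) \<theta> = 0" "poly (difference_poly q t 0) \<theta>' = 0"
    using lead_coeff_dvd_root[OF P(2)] P(3,4) lead_Phi a0 by auto
  note nz = theta_inverse(1)[OF th(1)] theta_inverse(1)[OF th(2)]
  obtain S where S: "prime_elem S" "S dvd Phi" "poly (lead_coeff S) (inverse \<theta>) = 0"
    using prime_factor_at[OF theta_inverse(2)[OF th(1)]] .
  from S(2) obtain T where ST: "Phi = S * T" by (elim dvdE)
  obtain s where s: "inner_degree_le s S" using inner_degree_le_exists by blast
  obtain u where u: "inner_degree_le u T" using inner_degree_le_exists by blast
  define M where "M = q ^ t + q ^ d - q - 1"
  \<comment> \<open>The summand \<open>M\<close> keeps the subtraction in \<open>N1 + N2 - M\<close>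
    from truncating.\<close>
  define N1 where "N1 = degree S + s + M"
  define N2 where "N2 = degree T + u"
  define S' where "S' = invert_vars N1 S"
  define T' where "T' = invert_vars N2 T"
  have le: "degree S + s \<le> N1" "degree T + u \<le> N2" by (auto simp: N1_def N2_def)
  have "S' * T' = [:monom 1 (N1 + N2 - M):] * Phi"
  proof (rule poly_poly_eqI_off_fixed_points[OF inf q1])
    fix h w :: 'a assume h: "h ^ q \<noteq> h"
    then have h0: "h \<noteq> 0" using q1 by (auto simp: power_0_left)
    have "poly (poly (S' * T') [:w:]) h = h ^ (N1 + N2) * poly (poly Phi [:w / h:]) (inverse h)"
      unfolding S'_def T'_def ST
      by (simp add: poly_invert_vars[OF h0 s le(1)] poly_invert_vars[OF h0 u le(2)] power_add mult_ac)
    also have "h ^ (N1 + N2) = h ^ (N1 + N2 - M) * h ^ M"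
      by (simp add: N1_def add_ac flip: power_add)
    also have "\<dots> * poly (poly Phi [:w / h:]) (inverse h) = h ^ (N1 + N2 - M) * poly (poly Phi [:w:]) h"
      using invert_Phi[OF h, of w] by (simp only: M_def mult.assoc)
    finally show "poly (poly (S' * T') [:w:]) h = poly (poly ([:monom 1 (N1 + N2 - M):] * Phi) [:w:]) h"
      by (simp add: poly_monom)
  qed
  then have "P dvd S' * T'" using P(2) by (simp add: dvd_smult)
  then have "P dvd S' \<or> P dvd T'" using P(1) by (rule prime_elem_dvd_multD[rotated])
  moreover have "\<not> P dvd T'"
  proof
    assume "P dvd T'"
    then have "poly (lead_coeff T') \<theta> = 0" using P(3) by (rule lead_coeff_dvd_root)
    then have "poly (lead_coeff T) (inverse \<theta>) = 0"
      unfolding T'_def degree_invert_vars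
      using poly_coeff_invert_vars[OF nz(1) u le(2) order_refl] nz by simp
    then show False using theta_simple[OF ST S(3)] by blast
  qed
  ultimately have "P dvd S'" by blast
  then have "poly (lead_coeff S') \<theta>' = 0" using P(4) by (rule lead_coeff_dvd_root)
  then have "poly (lead_coeff S) (inverse \<theta>') = 0"
    unfolding S'_def degree_invert_vars
    using poly_coeff_invert_vars[OF nz(2) s le(1) order_refl] nz by simp
  then show ?thesis using S by (auto simp: linked_def)
qed

text \<open>Translations by \<open>c\<close> and \<open>c\<close>, separated by a translation by \<open>- 1 / c\<close> conjugated
  with inversion, compose to \<open>\<theta> \<mapsto> - c\<^sup>2 / \<theta>\<close>.\<close>

lemma linked_neg_inverse:
  assumes th: "poly (difference_poly q t 0) \<theta> = 0" and c: "c ^ q = c" "c \<noteq> 0"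
  shows "linked \<theta> (- (c ^ 2) / \<theta>)"
proof -
  define \<theta>1 where "\<theta>1 = \<theta> + c"
  have t0: "\<theta> \<noteq> 0" using theta_inverse[OF th] by simp
  have th1: "poly (difference_poly q t 0) \<theta>1 = 0" unfolding \<theta>1_def using theta_shift[OF th c(1)] .
  have t10: "\<theta>1 \<noteq> 0" using theta_inverse[OF th1] by simp
  have c': "(- inverse c) ^ q = - inverse c" using c odd_q by (simp add: power_inverse)
  define \<theta>2 where "\<theta>2 = inverse (inverse \<theta>1 + (- inverse c))"
  have "linked (inverse \<theta>1) (inverse \<theta>1 + (- inverse c))"
    by (rule linked_shift[OF theta_inverse(2)[OF th1] c'])
  from linked_inverse[OF this] have l2: "linked \<theta>1 \<theta>2" by (simp add: \<theta>2_def)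
  have th2: "poly (difference_poly q t 0) \<theta>2 = 0" unfolding \<theta>2_def
    by (intro theta_inverse(2) theta_shift c' th1)
  have "inverse \<theta>1 + (- inverse c) = - \<theta> / (c * \<theta>1)"
    using c t10 by (simp add: \<theta>1_def field_simps)
  then have e2: "\<theta>2 = - (c * \<theta>1) / \<theta>" by (simp add: \<theta>2_def)
  have "\<theta>2 + c = - (c ^ 2) / \<theta>"
    using t0 unfolding e2 \<theta>1_def by (simp add: field_simps power2_eq_square)
  then have "linked \<theta>2 (- (c ^ 2) / \<theta>)" using linked_shift[OF th2 c(1)] by simp
  then show ?thesis using linked_shift[OF th c(1)] l2 linked_trans unfolding \<theta>1_def by blast
qed

text \<open>\<open>linked_neg_inverse\<close>, once with 1 and once with \<open>c\<close>, leads
  from \<open>\<theta>\<close> through \<open>- 1 / \<theta>\<close> to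
  \<open>c ^ 2 * \<theta>\<close>.\<close>

lemma linked_square:
  assumes th: "poly (difference_poly q t 0) \<theta> = 0" and c: "c ^ q = c" "c \<noteq> 0"
  shows "linked \<theta> (c ^ 2 * \<theta>)"
proof -
  define \<phi> where "\<phi> = - inverse \<theta>"
  have "- (1 ^ 2) / \<theta> = \<phi>" by (simp add: \<phi>_def field_simps)
  then have 1: "linked \<theta> \<phi>" using linked_neg_inverse[OF th, of 1] by simp
  have "poly (difference_poly q t 0) \<phi> = 0"
    using theta_inverse(2)[OF th] odd_q q1 by (simp add: theta_iff \<phi>_def)
  from linked_neg_inverse[OF this c] have "linked \<phi> (c ^ 2 * \<theta>)" by (simp add: \<phi>_def divide_inverse)
  with 1 show ?thesis by (rule linked_trans)
qed

text \<open>Scalings of h by squares and of w by arbitrary nonzero elements of F_q fix the prime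
  factor \<open>P\<close>, since linked slopes lie on it together. These scalings act transitively
  on the edge roots of \<open>Phi\<close>, so \<open>P\<close> has all of them and nothing is left
  for a cofactor.\<close>

theorem irreducible_Phi: "irreducible Phi"
proof -
  have "\<exists>\<theta>. poly (difference_poly q t 0) \<theta> = (0 :: 'a)"
  proof (rule alg_closed_imp_poly_has_root)
    have "coeff (difference_poly q t 0 :: 'a poly) (q ^ t - q) \<noteq> 0"
      using difference_poly_degree(2)[OF q1, of 0 t, where 'a='a] t by simp
    then have "q ^ t - q \<le> degree (difference_poly q t 0 :: 'a poly)" by (rule le_degree)
    moreover have "q ^ 1 < q ^ t" using t q1 by (intro power_strict_increasing) auto
    ultimately show "degree (difference_poly q t 0 :: 'a poly) > 0" by simp
  qed
  then obtain \<theta> where th: "poly (difference_poly q t 0) \<theta> = (0 :: 'a)" by blast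
  obtain P where P: "prime_elem P" "P dvd Phi" "poly (lead_coeff P) \<theta> = 0"
    using prime_factor_at[OF th] .
  from P(2) obtain T where PT: "Phi = P * T" by (elim dvdE)
  have P0: "P \<noteq> 0" "\<not> P dvd 1" using P(1) by auto
  have stable: "P dvd scale_vars (\<nu> ^ 2) v P"
    if \<nu>: "\<nu> ^ q = \<nu>" "\<nu> \<noteq> 0" and v: "v ^ q = v" "v \<noteq> 0" for \<nu> v
  proof -
    let ?s = "scale_vars (\<nu> ^ 2) v"
    have u: "(\<nu> ^ 2) ^ q = \<nu> ^ 2" "\<nu> ^ 2 \<noteq> 0" using \<nu> by (simp_all add: power_mult[symmetric] mult.commute)
      (simp add: power_mult)
    have "?s (P * T) = ?s P * ?s T"
      by (rule poly_poly_eqI[OF inf inf]) (simp add: poly_scale_vars u v \<nu>)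
    then have s: "Phi = ?s P * ?s T" using scale_Phi[OF u(1) v(1) u(2) v(2)] PT by simp
    obtain S where S: "prime_elem S" "S dvd Phi" "poly (lead_coeff S) \<theta> = 0" "poly (lead_coeff S) (\<nu> ^ 2 * \<theta>) = 0"
      using linked_square[OF th \<nu>] by (auto simp: linked_def)
    have "S dvd P" using prime_dvd_of_shared_theta[OF S(1,2) PT S(3) P(3)] .
    then have "poly (lead_coeff P) (\<nu> ^ 2 * \<theta>) = 0" using S(4) by (rule lead_coeff_dvd_root)
    then have "poly (lead_coeff (?s P)) \<theta> = 0"
      using u v by (simp add: degree_scale_vars coeff_scale_vars poly_pcompose mult.commute)
    then show ?thesis using prime_dvd_of_shared_theta[OF P(1,2) s P(3)] by blast
  qed
  have "T dvd 1"
  proof (rule ccontr)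
    assume T: "\<not> T dvd 1"
    obtain x where x: "poly (edge P) x = 0" using omega_exists[OF PT P0(2)] .
    have TP: "Phi = T * P" using PT by (simp add: mult.commute)
    obtain y where y: "poly (edge T) y = 0" using omega_exists[OF TP T] .
    have e: "edge P * edge T = [:a d:] - monom (a 0) (q ^ d - 1)"
      using edge_Phi edge_mult PT by metis
    have xy: "a d = a 0 * z ^ (q ^ d - 1)" if "poly (edge P) z = 0 \<or> poly (edge T) z = 0" for z
    proof -
      have "poly (edge P * edge T) z = poly ([:a d:] - monom (a 0) (q ^ d - 1)) z" by (simp only: e)
      then show ?thesis using that by (auto simp: poly_monom)
    qed
    have nz: "x \<noteq> 0" "y \<noteq> 0" using xy[of x] xy[of y] x y ad qd2 by (auto simp: power_0_left)
    define \<rho> where "\<rho> = x / y"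
    have "x ^ (q ^ d - 1) = y ^ (q ^ d - 1)" using xy[of x] xy[of y] x y a0 by simp
    then have \<rho>1: "\<rho> ^ (q ^ d - 1) = 1" using nz by (simp add: \<rho>_def power_divide)
    have \<rho>0: "\<rho> \<noteq> 0" using nz by (simp add: \<rho>_def)
    \<comment> \<open>Scaling by (u, v) evaluates the edge at \<open>v * x / \<sigma> ^ m1\<close>,
      where \<open>\<sigma> ^ m2 = u\<close>. With \<open>\<sigma> = \<rho> ^ (2 * \<alpha>)\<close>
      and \<open>v = \<kappa> ^ \<beta>\<close>, the Bezout relation makes the multiplier
      \<open>1 / \<rho>\<close>, which turns \<open>x\<close> into \<open>y\<close>; both
      \<open>u\<close> and \<open>v\<close> are powers of \<open>\<kappa>\<close>, hence in
      F_q.\<close>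
    obtain \<alpha> \<beta> where ab: "2 * m1 * \<alpha> = m2 * \<beta> + 1"
      using bezout_nat[of "2 * m1" m2] coprime_m m_pos by auto
    define \<kappa> where "\<kappa> = \<rho> ^ m2"
    have "\<kappa> ^ (q - 1) = 1"
    proof -
      have "m2 * (q - 1) = q ^ d - 1" using m_rel(2) by (simp add: mult.commute)
      then show ?thesis using \<rho>1 by (simp add: \<kappa>_def flip: power_mult)
    qed
    then have \<kappa>q: "\<kappa> ^ q = \<kappa>" using power_minus_mult[of q \<kappa>] q1 by simp
    have \<kappa>0: "\<kappa> \<noteq> 0" using \<rho>0 by (simp add: \<kappa>_def)
    have pw: "(\<kappa> ^ n) ^ q = \<kappa> ^ n" "\<kappa> ^ n \<noteq> 0" for n
    proof -
      have "(\<kappa> ^ n) ^ q = (\<kappa> ^ q) ^ n" by (simp add: mult.commute flip: power_mult)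
      then show "(\<kappa> ^ n) ^ q = \<kappa> ^ n" by (simp add: \<kappa>q)
      show "\<kappa> ^ n \<noteq> 0" using \<kappa>0 by simp
    qed
    define \<sigma> where "\<sigma> = \<rho> ^ (2 * \<alpha>)"
    have \<sigma>: "\<sigma> \<noteq> 0" "\<sigma> ^ m2 = (\<kappa> ^ \<alpha>) ^ 2"
      using \<rho>0 by (auto simp: \<sigma>_def \<kappa>_def mult_ac simp flip: power_mult)
    have "P dvd scale_vars ((\<kappa> ^ \<alpha>) ^ 2) (\<kappa> ^ \<beta>) P" by (rule stable[OF pw pw])
    then obtain Z where Z: "scale_vars ((\<kappa> ^ \<alpha>) ^ 2) (\<kappa> ^ \<beta>) P = P * Z" by (elim dvdE)
    have "poly (edge (scale_vars ((\<kappa> ^ \<alpha>) ^ 2) (\<kappa> ^ \<beta>) P)) x = 0"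
      unfolding Z edge_mult using x by simp
    moreover obtain c where "c \<noteq> 0" "\<And>x. poly (edge (scale_vars ((\<kappa> ^ \<alpha>) ^ 2) (\<kappa> ^ \<beta>) P)) x
        = c * poly (edge P) (\<kappa> ^ \<beta> * x / \<sigma> ^ m1)"
      using lead_coeff_weighted_subst_scale[OF inf power_not_zero[OF pw(2)[of \<alpha>]] pw(2)[of \<beta>] \<sigma>, of m1 P]
      by blast
    ultimately have "poly (edge P) (\<kappa> ^ \<beta> * x / \<sigma> ^ m1) = 0" by simp
    moreover have "\<kappa> ^ \<beta> * x / \<sigma> ^ m1 = y"
    proof -
      have "\<sigma> ^ m1 = \<rho> ^ (2 * m1 * \<alpha>)" by (simp add: \<sigma>_def mult_ac flip: power_mult)
      also have "\<dots> = \<kappa> ^ \<beta> * \<rho>" unfolding ab by (simp add: \<kappa>_def mult_ac flip: power_mult)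
      finally show ?thesis using \<rho>0 \<kappa>0 nz by (simp add: \<rho>_def)
    qed
    ultimately have "poly (edge P) y = 0" by simp
    then show False using omega_simple[OF PT] y by blast
  qed
  then show ?thesis
    using prime_elem_imp_irreducible[OF P(1)] irreducible_mult_unit_left[of T P]
    unfolding PT by (simp only: mult.commute)
qed

end

section \<open>Rational points and the theorem\<close>

lemma rational_point_on_curve:
  fixes F :: "'a::{alg_closed_field, euclidean_ring_gcd, semiring_gcd_mult_normalize} poly poly"
  assumes char: "prime CHAR('a)" and inf: "infinite (UNIV :: 'a set)"
    and F: "lead_coeff F = [:c:]" "c \<noteq> 0" "degree F > 0" "irreducible F"
    and bad: "finite bad"
    and sep: "\<And>x y. x \<notin> bad \<Longrightarrow> poly (poly F [:y:]) x = 0 \<Longrightarrow> poly (poly (pderiv F) [:y:]) x \<noteq> 0"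
  obtains Q0 where "\<And>e Q. Q = CHAR('a) ^ e \<Longrightarrow> Q \<ge> Q0 \<Longrightarrow> card {x::'a. x ^ Q = x} = Q \<Longrightarrow>
    (\<And>x y. x \<notin> bad \<Longrightarrow> x ^ Q = x \<Longrightarrow> poly (poly F [:y:]) x = 0 \<Longrightarrow> poly (poly F [:y ^ Q:]) x = 0) \<Longrightarrow>
    (\<exists>x y. x \<notin> bad \<and> x ^ Q = x \<and> poly (poly F [:y:]) x = 0 \<and> y ^ Q = y)"
proof -
  define f where "f = smult [:inverse c:] F"
  have ev: "poly (poly f [:y:]) x = inverse c * poly (poly F [:y:]) x" for x y
    by (simp add: f_def)
  have "lead_coeff f = 1" "degree f > 0" using F by (simp_all add: f_def one_pCons)
  moreover have "prime_elem f"
  proof -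
    have "[:[:inverse c:]:] dvd (1 :: 'a poly poly)" using F(2) by (auto simp: is_unit_poly_poly_iff)
    then have "irreducible ([:[:inverse c:]:] * F)" using F(4) by (subst irreducible_mult_unit_left)
    then show ?thesis by (simp add: f_def irreducible_imp_prime_elem)
  qed
  moreover have "poly (poly (pderiv f) [:y:]) x \<noteq> 0" if "x \<notin> bad" "poly (poly f [:y:]) x = 0" for x y
    using sep[OF that(1), of y] that(2) F(2) by (simp add: ev) (simp add: f_def pderiv_smult)
  ultimately obtain Q0 where Q0: "\<And>e Q. Q = CHAR('a) ^ e \<Longrightarrow> Q \<ge> Q0 \<Longrightarrow> card {x::'a. x ^ Q = x} = Q \<Longrightarrow>
    (\<And>x y. x \<notin> bad \<Longrightarrow> x ^ Q = x \<Longrightarrow> poly (poly f [:y:]) x = 0 \<Longrightarrow> poly (poly f [:y ^ Q:]) x = 0) \<Longrightarrow>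
    (\<exists>x y. x \<notin> bad \<and> x ^ Q = x \<and> poly (poly f [:y:]) x = 0 \<and> y ^ Q = y)"
    using stepanov_rational_point[OF char _ _ _ bad _ inf, of f] by blast
  have "poly (poly f [:y:]) x = 0 \<longleftrightarrow> poly (poly F [:y:]) x = 0" for x y
    using F(2) by (simp add: ev)
  from Q0[unfolded this] show ?thesis by (rule that)
qed

text \<open>No independent \<open>x\<close>, \<open>y = h * x\<close> over the field with \<open>Q\<close> elements satisfy
  \<open>l y * x ^ q ^ t = l x * y ^ q ^ t\<close>, where \<open>l x = (\<Sum>i\<le>r. a i * x ^ q ^ i)\<close>.\<close>

definition coincidence_free :: "nat \<Rightarrow> nat \<Rightarrow> nat \<Rightarrow> (nat \<Rightarrow> 'a::field) \<Rightarrow> nat \<Rightarrow> bool" where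
  "coincidence_free q r t a Q \<longleftrightarrow>
     (\<forall>h x. h ^ Q = h \<longrightarrow> h ^ q \<noteq> h \<longrightarrow> x ^ Q = x \<longrightarrow> x \<noteq> 0 \<longrightarrow>
        (\<Sum>i\<le>r. a i * (h ^ (q ^ i) - h ^ (q ^ t)) * x ^ (q ^ i)) \<noteq> 0)"

lemma of_nat_power_diff:
  assumes "of_nat q = (0 :: 'a::comm_ring_1)" "i < d" "q > 1"
  shows "of_nat (q ^ d - q ^ i) = (if i = 0 then - 1 else 0 :: 'a)"
proof -
  have "q ^ i \<le> q ^ d" using assms by (intro power_increasing) auto
  then have "of_nat (q ^ d - q ^ i) = (of_nat (q ^ d) - of_nat (q ^ i) :: 'a)" by (rule of_nat_diff)
  then show ?thesis using assms by (simp add: power_0_left)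
qed

lemma not_coincidence_free_A:
  fixes a :: "nat \<Rightarrow> 'a::{alg_closed_field, euclidean_ring_gcd, semiring_gcd_mult_normalize}"
  assumes char: "prime CHAR('a)" and inf: "infinite (UNIV :: 'a set)"
    and q: "q = CHAR('a) ^ e" "q > 2"
    and r: "0 < r" "r < d" "coprime r d" and a: "a 0 \<noteq> 0" "a r \<noteq> 0"
  obtains Q0 where "\<And>E Q. Q = CHAR('a) ^ E \<Longrightarrow> Q \<ge> Q0 \<Longrightarrow> card {x::'a. x ^ Q = x} = Q \<Longrightarrow>
    (\<And>i. a i ^ Q = a i) \<Longrightarrow> \<not> coincidence_free q r d a Q"
proof -
  have q1: "q > 1" using q by simp
  have oq: "of_nat q = (0 :: 'a)"
  proof -
    have "e \<noteq> 0" using q by (cases e) auto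
    then show ?thesis by (simp add: q)
  qed
  define A where "A = coincidence_A q d r a"
  define f where "f = swap_vars A"
  note irr = irreducible_coincidence_A[OF q(2) oq inf r a]
  \<comment> \<open>The zeros of \<open>l\<close>; only over these can \<open>k = 0\<close> lie on
    the curve.\<close>
  define bad where "bad = {x. (\<Sum>i\<le>r. a i * x ^ (q ^ i)) = 0}"
  have bad0: "x \<noteq> 0" if "x \<notin> bad" for x
    using that q1 by (auto simp: bad_def power_0_left)
  have "finite bad"
  proof -
    let ?p = "\<Sum>i\<le>r. monom (a i) (q ^ i)"
    have "coeff ?p 1 = (\<Sum>i\<le>r. if i = 0 then a 0 else 0)"
      unfolding coeff_sum coeff_monom using q1 by (intro sum.cong) auto
    then have "coeff ?p 1 \<noteq> 0" using a by simp
    then have "?p \<noteq> 0" by (metis coeff_0)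
    then have "finite {x. poly ?p x = 0}" by (rule poly_roots_finite)
    then show ?thesis by (simp add: bad_def poly_sum poly_monom)
  qed
  have ev: "poly (poly f [:k:]) x = poly (poly A [:x:]) k" for k x by (simp add: f_def poly_swap_vars)
  have id: "(k ^ (q - 1) - 1) * poly (poly f [:k:]) x = (\<Sum>i\<le>r. a i * x ^ (q ^ i - 1) * (k ^ (q ^ d - q ^ i) - 1))"
    for k x unfolding ev A_def using r q1 by (intro poly_coincidence_A) auto
  \<comment> \<open>The identity \<open>id\<close> differentiated in \<open>k\<close>: in the field
    the exponents \<open>q ^ d - q ^ i\<close> are zero except for \<open>i = 0\<close>. At a point
    with nonzero \<open>k\<close> this shows at once that \<open>k\<close> is not in F_q and that
    the point is a simple root.\<close>
  have diff: "of_nat (q - 1) * k ^ (q - 1 - 1) * poly (poly f [:k:]) x + (k ^ (q - 1) - 1) * poly (poly (pderiv f) [:k:]) x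
      = - (a 0 * k ^ (q ^ d - 1 - 1))" for k x
  proof -
    let ?g = "map_poly (\<lambda>c. poly c x) f"
    have "(monom 1 (q - 1) - 1) * ?g = (\<Sum>i\<le>r. smult (a i * x ^ (q ^ i - 1)) (monom 1 (q ^ d - q ^ i) - 1))"
      using id[of _ x]
      by (intro poly_eqI_infinite[OF inf]) (simp add: poly_monom poly_sum poly_poly_const)
    then have "pderiv ((monom 1 (q - 1) - 1) * ?g)
        = (\<Sum>i\<le>r. smult (a i * x ^ (q ^ i - 1)) (monom (of_nat (q ^ d - q ^ i)) (q ^ d - q ^ i - 1)))"
      by (simp add: pderiv_sum_distrib pderiv_smult pderiv_diff pderiv_monom)
    also have "\<dots> = (\<Sum>i\<le>r. if i = 0 then monom (- a 0) (q ^ d - 1 - 1) else 0)"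
    proof (intro sum.cong refl)
      fix i assume "i \<in> {..r}"
      then have "i < d" using r by simp
      then show "smult (a i * x ^ (q ^ i - 1)) (monom (of_nat (q ^ d - q ^ i)) (q ^ d - q ^ i - 1))
          = (if i = 0 then monom (- a 0) (q ^ d - 1 - 1) else 0)"
        using of_nat_power_diff[OF oq \<open>i < d\<close> q1] by (cases "i = 0") (simp_all only:, simp_all add: smult_monom)
    qed
    also have "\<dots> = monom (- a 0) (q ^ d - 1 - 1)" by simp
    finally have "poly (pderiv ((monom 1 (q - 1) - 1) * ?g)) k = - (a 0 * k ^ (q ^ d - 1 - 1))"
      by (simp add: poly_monom)
    then show ?thesis
      by (simp add: pderiv_mult pderiv_diff pderiv_monom poly_monom poly_poly_const pderiv_map_poly_poly mult_ac add_ac)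
  qed
  have root: "k \<noteq> 0" "k ^ (q - 1) \<noteq> 1" "poly (poly (pderiv f) [:k:]) x \<noteq> 0"
    if x: "x \<notin> bad" and k: "poly (poly f [:k:]) x = 0" for x k
  proof -
    show k0: "k \<noteq> 0"
    proof
      assume k: "k = 0"
      have e: "(0::'a) ^ (q ^ d - q ^ i) = 0" if "i \<le> r" for i
      proof -
        have "q ^ i < q ^ d" using that r q1 by (intro power_strict_increasing) auto
        then show ?thesis by (simp add: power_0_left)
      qed
      have "0 = (\<Sum>i\<le>r. a i * x ^ (q ^ i - 1) * (0 ^ (q ^ d - q ^ i) - 1))"
        using id[of 0 x] \<open>poly (poly f [:k:]) x = 0\<close> k by simp
      also have "\<dots> = - (\<Sum>i\<le>r. a i * x ^ (q ^ i - 1))"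
        unfolding sum_negf[symmetric] by (intro sum.cong) (auto simp: e)
      finally have 0: "(\<Sum>i\<le>r. a i * x ^ (q ^ i - 1)) = 0" by simp
      have "(\<Sum>i\<le>r. a i * x ^ (q ^ i)) = (\<Sum>i\<le>r. a i * (x ^ (q ^ i - 1) * x))"
        using power_minus_mult[of _ x] q1 by simp
      also have "\<dots> = (\<Sum>i\<le>r. a i * x ^ (q ^ i - 1)) * x"
        by (simp add: sum_distrib_left mult_ac)
      finally show False using 0 x by (simp add: bad_def)
    qed
    have "(k ^ (q - 1) - 1) * poly (poly (pderiv f) [:k:]) x = - (a 0 * k ^ (q ^ d - 1 - 1))"
      using diff[of k x] k by simp
    moreover have "- (a 0 * k ^ (q ^ d - 1 - 1)) \<noteq> 0" using a k0 by simp
    ultimately have "(k ^ (q - 1) - 1) * poly (poly (pderiv f) [:k:]) x \<noteq> 0" by simp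
    then show "k ^ (q - 1) \<noteq> 1" "poly (poly (pderiv f) [:k:]) x \<noteq> 0" by auto
  qed
  have dpos: "degree f > 0"
  proof -
    have "q ^ 1 < q ^ d" using q1 r by (intro power_strict_increasing) auto
    then show ?thesis using irr(2) by (simp add: f_def A_def)
  qed
  obtain Q0 where Q0: "\<And>E Q. Q = CHAR('a) ^ E \<Longrightarrow> Q \<ge> Q0 \<Longrightarrow> card {x::'a. x ^ Q = x} = Q \<Longrightarrow>
    (\<And>x y. x \<notin> bad \<Longrightarrow> x ^ Q = x \<Longrightarrow> poly (poly f [:y:]) x = 0 \<Longrightarrow> poly (poly f [:y ^ Q:]) x = 0) \<Longrightarrow>
    (\<exists>x y. x \<notin> bad \<and> x ^ Q = x \<and> poly (poly f [:y:]) x = 0 \<and> y ^ Q = y)"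
    using rational_point_on_curve[OF char inf irr(1)[folded A_def, folded f_def] a(1) dpos
        irr(3)[folded A_def, folded f_def] \<open>finite bad\<close> root(3)] by blast
  show ?thesis
  proof (rule that[of Q0])
    fix E Q
    assume Q: "Q = CHAR('a) ^ E" "Q \<ge> Q0" "card {x::'a. x ^ Q = x} = Q" and aQ: "\<And>i. a i ^ Q = a i"
    have frob: "(\<Sum>i\<in>I. g i) ^ Q = (\<Sum>i\<in>I. g i ^ Q)" for I and g :: "nat \<Rightarrow> 'a"
      by (rule freshmans_dream_sum'[OF char Q(1)])
    have Qpos: "Q > 0" using char Q(1) by (simp add: prime_gt_0_nat)
    have frobd: "(x - y) ^ Q = x ^ Q - y ^ Q" for x y :: 'a
      using freshmans_dream'[OF char Q(1), of "x - y" y] by (simp add: algebra_simps)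
    have conj: "poly (poly f [:y ^ Q:]) x = 0"
      if x: "x \<notin> bad" "x ^ Q = x" and y: "poly (poly f [:y:]) x = 0" for x y
    proof -
      have "((y ^ Q) ^ (q - 1) - 1) * poly (poly f [:y ^ Q:]) x
          = (\<Sum>i\<le>r. a i ^ Q * (x ^ Q) ^ (q ^ i - 1) * ((y ^ Q) ^ (q ^ d - q ^ i) - 1))"
        unfolding id by (simp add: aQ x)
      also have "\<dots> = (\<Sum>i\<le>r. a i * x ^ (q ^ i - 1) * (y ^ (q ^ d - q ^ i) - 1)) ^ Q"
        unfolding frob by (simp add: power_mult_distrib frobd mult.commute flip: power_mult)
      also have "\<dots> = 0" unfolding id[symmetric] y using Qpos by simp
      finally have "((y ^ Q) ^ (q - 1) - 1) * poly (poly f [:y ^ Q:]) x = 0" .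
      moreover have "(y ^ Q) ^ (q - 1) - 1 = (y ^ (q - 1) - 1) ^ Q"
        by (simp add: frobd mult.commute flip: power_mult)
      then have "(y ^ Q) ^ (q - 1) - 1 \<noteq> 0" using root(2)[OF x(1) y] by simp
      ultimately show ?thesis using mult_eq_0_iff by blast
    qed
    from Q0[OF Q conj] obtain x k where xk: "x \<notin> bad" "x ^ Q = x" "poly (poly f [:k:]) x = 0" "k ^ Q = k"
      by blast
    note k = root[OF xk(1,3)]
    define h where "h = inverse k"
    have hQ: "h ^ Q = h" using xk by (simp add: h_def power_inverse)
    have hq: "h ^ q \<noteq> h"
    proof
      assume "h ^ q = h"
      then have "k ^ q = k" by (simp add: h_def power_inverse)
      then have "k ^ (q - 1) * k = 1 * k" using power_minus_mult[of q k] q1 by simp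
      then show False using k by simp
    qed
    have "0 = (\<Sum>i\<le>r. a i * x ^ (q ^ i - 1) * (k ^ (q ^ d - q ^ i) - 1)) * (x * h ^ (q ^ d))"
      using id[of k x] xk by simp
    also have "\<dots> = (\<Sum>i\<le>r. a i * (h ^ (q ^ i) - h ^ (q ^ d)) * x ^ (q ^ i))"
      unfolding sum_distrib_right
    proof (intro sum.cong refl)
      fix i assume "i \<in> {..r}"
      then have "q ^ i \<le> q ^ d" using r q1 by (intro power_increasing) auto
      then have "h ^ (q ^ d) = h ^ (q ^ d - q ^ i) * h ^ (q ^ i)" by (simp flip: power_add)
      then have "(k ^ (q ^ d - q ^ i) - 1) * h ^ (q ^ d) = h ^ (q ^ i) - h ^ (q ^ d)"
        using k by (simp add: h_def power_inverse left_diff_distrib)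
      moreover have "x ^ (q ^ i - 1) * x = x ^ (q ^ i)" using power_minus_mult[of "q ^ i" x] q1 by simp
      moreover have "a i * x ^ (q ^ i - 1) * (k ^ (q ^ d - q ^ i) - 1) * (x * h ^ (q ^ d))
          = a i * ((k ^ (q ^ d - q ^ i) - 1) * h ^ (q ^ d)) * (x ^ (q ^ i - 1) * x)"
        by (simp only: mult_ac)
      ultimately show "a i * x ^ (q ^ i - 1) * (k ^ (q ^ d - q ^ i) - 1) * (x * h ^ (q ^ d))
          = a i * (h ^ (q ^ i) - h ^ (q ^ d)) * x ^ (q ^ i)" by simp
    qed
    finally show "\<not> coincidence_free q r d a Q"
      unfolding coincidence_free_def using hQ hq xk(2) bad0[OF xk(1)] by metis
  qed
qed

text \<open>Only \<open>i = d\<close> reaches the degree \<open>q ^ d - q\<close> in h, and it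
  carries no w. So the curve is monic in h up to a constant, as Stepanov's method requires, whereas
  its leading coefficient in w varies with h.\<close>

lemma (in case_B) lead_coeff_swap_Phi:
  "degree (swap_vars Phi) = q ^ d - q" "lead_coeff (swap_vars Phi) = [:a d:]"
proof -
  have cf: "coeff (coeff (swap_vars Phi) s) j
      = (\<Sum>i\<le>d. if q ^ d - q ^ i = j then a i * coeff (difference_poly q t i) s else 0)" for s j
    unfolding coeff_swap_vars coincidence_B_def coeff_sum coeff_monom
    by (auto simp: coeff_sum intro!: sum.cong)
  have zero: "coeff (difference_poly q t i :: 'a poly) s = 0" if i: "i < d" "s \<ge> q ^ d - q" for i s
  proof (cases "i = t")
    case False
    have "q ^ 1 \<le> q ^ max i t" using t q1 by (intro power_increasing) auto
    moreover have "q ^ max i t < q ^ d" using t i q1 by (intro power_strict_increasing) auto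
    ultimately have "degree (difference_poly q t i :: 'a poly) < s"
      using difference_poly_degree(1)[OF q1 False, where 'a='a] i(2) by simp
    then show ?thesis by (rule coeff_eq_0)
  qed (simp add: difference_poly_def)
  have top: "coeff (swap_vars Phi) (q ^ d - q) = [:a d:]"
  proof (rule poly_eqI)
    fix j
    have "coeff (coeff (swap_vars Phi) (q ^ d - q)) j = (\<Sum>i\<le>d. if i = d then if j = 0 then a d else 0 else 0)"
      unfolding cf
    proof (intro sum.cong refl)
      fix i assume "i \<in> {..d}"
      then show "(if q ^ d - q ^ i = j then a i * coeff (difference_poly q t i) (q ^ d - q) else 0)
          = (if i = d then if j = 0 then a d else 0 else 0)"
        using zero[of i "q ^ d - q"] difference_poly_degree(2)[OF q1, of d t, where 'a='a] t
        by (cases "i = d") (auto simp: max_def)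
    qed
    then show "coeff (coeff (swap_vars Phi) (q ^ d - q)) j = coeff [:a d:] j" by (cases j) auto
  qed
  have above: "coeff (swap_vars Phi) s = 0" if "s > q ^ d - q" for s
  proof (rule poly_eqI)
    fix j
    have "coeff (difference_poly q t i :: 'a poly) s = 0" if "i \<le> d" for i
    proof (cases "i = d")
      case True
      have "max d t = d" using t by simp
      then show ?thesis
        using difference_poly_degree(1)[OF q1, of d t, where 'a='a] t \<open>s > q ^ d - q\<close> True
        by (intro coeff_eq_0) auto
    next
      case False
      then show ?thesis using zero[of i s] that \<open>s > q ^ d - q\<close> by simp
    qed
    then show "coeff (coeff (swap_vars Phi) s) j = coeff 0 j" unfolding cf by (auto intro!: sum.neutral)
  qed
  show d: "degree (swap_vars Phi) = q ^ d - q"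
    using top above ad by (intro antisym degree_le le_degree) auto
  then show "lead_coeff (swap_vars Phi) = [:a d:]" using top by simp
qed

lemma (in case_B) not_coincidence_free_B:
  obtains Q0 where "\<And>E Q. Q = CHAR('a) ^ E \<Longrightarrow> Q \<ge> Q0 \<Longrightarrow> card {x::'a. x ^ Q = x} = Q \<Longrightarrow>
    (\<And>i. a i ^ Q = a i) \<Longrightarrow> \<not> coincidence_free q d t a Q"
proof -
  define f where "f = swap_vars Phi"
  have ev: "poly (poly f [:h:]) w = poly (poly Phi [:w:]) h" for h w by (simp add: f_def poly_swap_vars)
  have id: "(h ^ q - h) * poly (poly f [:h:]) w = (\<Sum>i\<le>d. a i * (h ^ (q ^ i) - h ^ (q ^ t)) * w ^ (q ^ d - q ^ i))"
    for h w unfolding ev by (rule poly_coincidence_B[OF q1])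
  \<comment> \<open>All powers of h on the right of \<open>id\<close> have derivative zero except
    the one for \<open>i = 0\<close>; so off \<open>w = 0\<close> every point is simple and has
    \<open>h\<close> outside F_q.\<close>
  have diff: "- poly (poly f [:h:]) w + (h ^ q - h) * poly (poly (pderiv f) [:h:]) w = a 0 * w ^ (q ^ d - 1)" for h w
  proof -
    let ?g = "map_poly (\<lambda>c. poly c w) f"
    have pm: "pderiv (monom 1 (q ^ i) :: 'a poly) = (if i = 0 then 1 else 0)" for i
      using of_nat_q by (auto simp: pderiv_monom monom_0 power_0_left one_pCons)
    have "(monom 1 q - [:0, 1:]) * ?g = (\<Sum>i\<le>d. smult (a i * w ^ (q ^ d - q ^ i)) (monom 1 (q ^ i) - monom 1 (q ^ t)))"
      using id[of _ w]
      by (intro poly_eqI_infinite[OF inf]) (simp add: poly_monom poly_sum poly_poly_const mult_ac)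
    then have "pderiv ((monom 1 q - [:0, 1:]) * ?g)
        = (\<Sum>i\<le>d. smult (a i * w ^ (q ^ d - q ^ i)) (if i = 0 then 1 else 0))"
      using t by (simp add: pderiv_sum_distrib pderiv_smult pderiv_diff pm)
    also have "\<dots> = (\<Sum>i\<le>d. if i = 0 then smult (a 0 * w ^ (q ^ d - 1)) 1 else 0)"
      by (intro sum.cong) auto
    also have "\<dots> = [:a 0 * w ^ (q ^ d - 1):]" by (simp add: one_pCons)
    finally have "poly (pderiv ((monom 1 q - [:0, 1:]) * ?g)) h = a 0 * w ^ (q ^ d - 1)" by simp
    moreover have "pderiv (monom 1 q - [:0, 1:] :: 'a poly) = - 1"
      using pm[of 1] by (simp add: pderiv_diff pderiv_pCons one_pCons)
    ultimately show ?thesis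
      unfolding pderiv_mult by (simp add: poly_monom poly_poly_const pderiv_map_poly_poly algebra_simps)
  qed
  have root: "h ^ q \<noteq> h" "poly (poly (pderiv f) [:h:]) w \<noteq> 0"
    if w: "w \<notin> {0}" and h: "poly (poly f [:h:]) w = 0" for w h
  proof -
    have "(h ^ q - h) * poly (poly (pderiv f) [:h:]) w = a 0 * w ^ (q ^ d - 1)" using diff[of h w] h by simp
    moreover have "a 0 * w ^ (q ^ d - 1) \<noteq> 0" using a0 w by simp
    ultimately have "(h ^ q - h) * poly (poly (pderiv f) [:h:]) w \<noteq> 0" by simp
    then show "h ^ q \<noteq> h" "poly (poly (pderiv f) [:h:]) w \<noteq> 0" by auto
  qed
  have dpos: "degree f > 0"
  proof -
    have "q ^ 1 < q ^ d" using q1 t by (intro power_strict_increasing) auto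
    then show ?thesis using lead_coeff_swap_Phi(1) by (simp add: f_def)
  qed
  obtain Q0 where Q0: "\<And>E Q. Q = CHAR('a) ^ E \<Longrightarrow> Q \<ge> Q0 \<Longrightarrow> card {x::'a. x ^ Q = x} = Q \<Longrightarrow>
    (\<And>x y. x \<notin> {0} \<Longrightarrow> x ^ Q = x \<Longrightarrow> poly (poly f [:y:]) x = 0 \<Longrightarrow> poly (poly f [:y ^ Q:]) x = 0) \<Longrightarrow>
    (\<exists>x y. x \<notin> {0} \<and> x ^ Q = x \<and> poly (poly f [:y:]) x = 0 \<and> y ^ Q = y)"
    using rational_point_on_curve[OF char inf lead_coeff_swap_Phi(2)[folded f_def] ad dpos
        irreducible_swap_vars[OF inf irreducible_Phi, folded f_def] _ root(2)] by blast
  show ?thesis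
  proof (rule that[of Q0])
    fix E Q
    assume Q: "Q = CHAR('a) ^ E" "Q \<ge> Q0" "card {x::'a. x ^ Q = x} = Q" and aQ: "\<And>i. a i ^ Q = a i"
    have frob: "(\<Sum>i\<in>I. g i) ^ Q = (\<Sum>i\<in>I. g i ^ Q)" for I and g :: "nat \<Rightarrow> 'a"
      by (rule freshmans_dream_sum'[OF char Q(1)])
    have Qpos: "Q > 0" using char Q(1) by (simp add: prime_gt_0_nat)
    have frobd: "(x - y) ^ Q = x ^ Q - y ^ Q" for x y :: 'a
      using freshmans_dream'[OF char Q(1), of "x - y" y] by (simp add: algebra_simps)
    have conj: "poly (poly f [:y ^ Q:]) x = 0"
      if x: "x \<notin> {0}" "x ^ Q = x" and y: "poly (poly f [:y:]) x = 0" for x y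
    proof -
      have "((y ^ Q) ^ q - y ^ Q) * poly (poly f [:y ^ Q:]) x
          = (\<Sum>i\<le>d. a i ^ Q * ((y ^ Q) ^ (q ^ i) - (y ^ Q) ^ (q ^ t)) * (x ^ Q) ^ (q ^ d - q ^ i))"
        unfolding id by (simp add: aQ x)
      also have "\<dots> = (\<Sum>i\<le>d. a i * (y ^ (q ^ i) - y ^ (q ^ t)) * x ^ (q ^ d - q ^ i)) ^ Q"
        unfolding frob by (simp add: power_mult_distrib frobd mult.commute flip: power_mult)
      also have "\<dots> = 0" unfolding id[symmetric] y using Qpos by simp
      finally have "((y ^ Q) ^ q - y ^ Q) * poly (poly f [:y ^ Q:]) x = 0" .
      moreover have "(y ^ Q) ^ q - y ^ Q = (y ^ q - y) ^ Q"
        by (simp add: frobd mult.commute flip: power_mult)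
      then have "(y ^ Q) ^ q - y ^ Q \<noteq> 0" using root(1)[OF x(1) y] by simp
      ultimately show ?thesis using mult_eq_0_iff by blast
    qed
    from Q0[OF Q conj] obtain w h where wh: "w \<notin> {0}" "w ^ Q = w" "poly (poly f [:h:]) w = 0" "h ^ Q = h"
      by blast
    define x where "x = inverse w"
    have x: "x ^ Q = x" "x \<noteq> 0" using wh by (auto simp: x_def power_inverse)
    have "0 = (\<Sum>i\<le>d. a i * (h ^ (q ^ i) - h ^ (q ^ t)) * w ^ (q ^ d - q ^ i)) * x ^ (q ^ d)"
      using id[of h w] wh by simp
    also have "\<dots> = (\<Sum>i\<le>d. a i * (h ^ (q ^ i) - h ^ (q ^ t)) * x ^ (q ^ i))"
      unfolding sum_distrib_right
    proof (intro sum.cong refl)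
      fix i assume "i \<in> {..d}"
      then have "q ^ i \<le> q ^ d" using q1 by (intro power_increasing) auto
      then have "x ^ (q ^ d) = x ^ (q ^ d - q ^ i) * x ^ (q ^ i)" by (simp flip: power_add)
      then have "w ^ (q ^ d - q ^ i) * x ^ (q ^ d) = x ^ (q ^ i)"
        using wh by (simp add: x_def power_inverse)
      then show "a i * (h ^ (q ^ i) - h ^ (q ^ t)) * w ^ (q ^ d - q ^ i) * x ^ (q ^ d)
          = a i * (h ^ (q ^ i) - h ^ (q ^ t)) * x ^ (q ^ i)" by (simp add: mult.assoc)
    qed
    finally show "\<not> coincidence_free q d t a Q"
      unfolding coincidence_free_def using wh(4) root(1)[OF wh(1,3)] x by metis
  qed
qed

text \<open>The \<open>q\<close>-polynomial \<open>\<Sum>i\<le>d. a i * (h ^ q ^ i - h ^ q ^ t) * x ^ q ^ i\<close> permutes the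
  field with \<open>Q\<close> elements, hence so does its adjoint with respect to the trace form.\<close>

lemma coincidence_free_adjoint:
  fixes a :: "nat \<Rightarrow> 'a::field"
  assumes char: "prime CHAR('a)" and q: "q = CHAR('a) ^ e" "q > 1"
    and Q: "Q = q ^ N" "N > 0" "card {x::'a. x ^ Q = x} = Q"
    and aQ: "\<And>i. a i ^ Q = a i" and t: "t \<le> d"
    and cf: "coincidence_free q d t a Q"
  shows "coincidence_free q d (d - t) (\<lambda>j. a (d - j) ^ (q ^ j)) Q"
  unfolding coincidence_free_def
proof (intro allI impI notI)
  fix H z :: 'a
  assume H: "H ^ Q = H" "H ^ q \<noteq> H" and z: "z ^ Q = z" "z \<noteq> 0"
    and sum0: "(\<Sum>j\<le>d. a (d - j) ^ (q ^ j) * (H ^ (q ^ j) - H ^ (q ^ (d - t))) * z ^ (q ^ j)) = 0"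
  define K where "K = {x::'a. x ^ Q = x}"
  have "Q > 0" unfolding Q(1) using q(2) by simp
  then have "card K > 0" using Q(3) by (simp add: K_def)
  then have finK: "finite K" by (rule card_ge_0_finite)
  have qi: "q ^ i = CHAR('a) ^ (e * i)" for i by (simp add: q power_mult)
  have add: "(x + y) ^ (q ^ i) = x ^ (q ^ i) + y ^ (q ^ i)" for x y :: 'a and i
    by (rule freshmans_dream'[OF char qi])
  have sub: "(x - y) ^ (q ^ i) = x ^ (q ^ i) - y ^ (q ^ i)" for x y :: 'a and i
    using add[of "x - y" y i] by (simp add: algebra_simps)
  have sum: "(\<Sum>i\<in>I. g i) ^ (q ^ i) = (\<Sum>j\<in>I. g j ^ (q ^ i))" for I and g :: "nat \<Rightarrow> 'a" and i
    by (rule freshmans_dream_sum'[OF char qi])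
  have Kpow: "x ^ n \<in> K" if "x \<in> K" for x n
  proof -
    have "(x ^ n) ^ Q = (x ^ Q) ^ n" by (simp add: mult.commute flip: power_mult)
    then show ?thesis using that by (simp add: K_def)
  qed
  have Kmult: "x * y \<in> K" if "x \<in> K" "y \<in> K" for x y using that by (simp add: K_def power_mult_distrib)
  have Ksub: "x - y \<in> K" if "x \<in> K" "y \<in> K" for x y using that by (simp add: K_def Q(1) sub)
  have Ksum: "(\<Sum>i\<in>I. g i) \<in> K" if "\<And>i. i \<in> I \<Longrightarrow> g i \<in> K" for I and g :: "nat \<Rightarrow> 'a"
    using that by (simp add: K_def Q(1) sum)
  have aK: "a i \<in> K" for i using aQ by (simp add: K_def)
  define T where "T = (\<lambda>u::'a. \<Sum>k<N. u ^ (q ^ k))"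
  have T_frob1: "T (u ^ q) = T u" if "u \<in> K" for u
  proof -
    have "T (u ^ q) + u = (\<Sum>k<Suc N. u ^ (q ^ k))"
      unfolding T_def sum.lessThan_Suc_shift by (simp flip: power_mult)
    also have "\<dots> = T u + u" using that by (simp add: T_def K_def Q(1))
    finally show ?thesis by simp
  qed
  have T_frob: "T (u ^ (q ^ j)) = T u" if "u \<in> K" for u j
  proof (induction j)
    case (Suc j)
    have "u ^ (q ^ Suc j) = (u ^ (q ^ j)) ^ q" by (simp add: mult.commute flip: power_mult)
    then show ?case using Suc T_frob1[OF Kpow[OF that]] by simp
  qed simp
  have T_sum: "T (\<Sum>i\<in>I. g i) = (\<Sum>i\<in>I. T (g i))" for I and g :: "nat \<Rightarrow> 'a"
    unfolding T_def sum by (rule sum.swap)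
  \<comment> \<open>The root of exponent \<open>q ^ t\<close> of \<open>H\<close>, found by going
    around the Frobenius cycle of length \<open>N\<close>.\<close>
  define h where "h = H ^ (q ^ (t * (N - 1)))"
  have hH: "h ^ (q ^ t) = H"
  proof -
    have HN: "H ^ (q ^ (N * i)) = H" for i
    proof (induction i)
      case (Suc i)
      have "H ^ (q ^ (N * Suc i)) = (H ^ (q ^ N)) ^ (q ^ (N * i))" by (simp add: power_add flip: power_mult)
      then show ?case using Suc H(1) by (simp add: Q(1))
    qed simp
    have "t * (N - 1) + t = N * t" using Q(2) by (cases N) auto
    then have "h ^ (q ^ t) = H ^ (q ^ (N * t))" by (simp add: h_def flip: power_mult power_add)
    then show ?thesis by (simp add: HN)
  qed
  have hK: "h \<in> K" unfolding h_def using H by (intro Kpow) (simp add: K_def)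
  have hq: "h ^ q \<noteq> h"
  proof
    assume "h ^ q = h"
    then have "(h ^ q) ^ (q ^ t) = h ^ (q ^ t)" by simp
    then have "(h ^ (q ^ t)) ^ q = h ^ (q ^ t)" by (simp add: mult.commute flip: power_mult)
    then show False using H(2) hH by simp
  qed
  define f where "f = (\<lambda>x. \<Sum>i\<le>d. a i * (h ^ (q ^ i) - h ^ (q ^ t)) * x ^ (q ^ i))"
  have fK: "f x \<in> K" if "x \<in> K" for x
    unfolding f_def using that hK by (intro Ksum Kmult Ksub Kpow aK) auto
  have "inj_on f K"
  proof (rule inj_onI)
    fix x y assume xy: "x \<in> K" "y \<in> K" "f x = f y"
    have "f (x - y) = f x - f y" by (simp add: f_def sub right_diff_distrib sum_subtractf)
    then have "f (x - y) = 0" using xy by simp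
    then show "x = y"
      using cf hK hq Ksub[OF xy(1,2)] unfolding coincidence_free_def f_def K_def by force
  qed
  then have surj: "f ` K = K" using fK by (intro endo_inj_surj[OF finK]) auto
  \<comment> \<open>The trace is unchanged when the \<open>i\<close>-th summand is raised to the
    power \<open>q ^ (d - i)\<close>. Afterwards all summands share \<open>x ^ (q ^ d)\<close>, and
    its cofactor is, up to sign, the adjoint sum, which is zero.\<close>
  have Tf: "T (z * f x) = 0" if x: "x \<in> K" for x
  proof -
    define u where "u = (\<lambda>i. z * (a i * (h ^ (q ^ i) - h ^ (q ^ t)) * x ^ (q ^ i)))"
    have uK: "u i \<in> K" for i
      unfolding u_def using x hK z by (intro Kmult Ksub Kpow aK) (auto simp: K_def)
    have "T (z * f x) = (\<Sum>i\<le>d. T (u i))" by (simp add: f_def u_def sum_distrib_left T_sum)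
    also have "\<dots> = (\<Sum>i\<le>d. T (u i ^ (q ^ (d - i))))" by (simp add: T_frob[OF uK])
    also have "\<dots> = T (\<Sum>i\<le>d. u i ^ (q ^ (d - i)))" by (simp add: T_sum)
    also have "(\<Sum>i\<le>d. u i ^ (q ^ (d - i))) = (\<Sum>j\<le>d. u (d - j) ^ (q ^ j))"
      by (rule sum.reindex_bij_witness[of _ "\<lambda>j. d - j" "\<lambda>j. d - j"]) auto
    also have "\<dots> = (\<Sum>j\<le>d. - (x ^ (q ^ d)) * (a (d - j) ^ (q ^ j) * (H ^ (q ^ j) - H ^ (q ^ (d - t))) * z ^ (q ^ j)))"
    proof (intro sum.cong refl)
      fix j assume "j \<in> {..d}"
      then have j: "q ^ (d - j) * q ^ j = q ^ d" by (simp flip: power_add)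
      have tt: "q ^ t * q ^ (d - t) = q ^ d" using t by (simp flip: power_add)
      have 1: "(h ^ (q ^ (d - j))) ^ (q ^ j) = H ^ (q ^ (d - t))"
      proof -
        have "(h ^ (q ^ (d - j))) ^ (q ^ j) = h ^ (q ^ t * q ^ (d - t))"
          by (simp only: power_mult[symmetric] j tt)
        also have "\<dots> = H ^ (q ^ (d - t))" unfolding power_mult hH ..
        finally show ?thesis .
      qed
      have 2: "(h ^ (q ^ t)) ^ (q ^ j) = H ^ (q ^ j)" by (simp add: hH)
      have 3: "(x ^ (q ^ (d - j))) ^ (q ^ j) = x ^ (q ^ d)" by (simp add: j flip: power_mult)
      have "u (d - j) ^ (q ^ j) = z ^ (q ^ j) * (a (d - j) ^ (q ^ j) * (H ^ (q ^ (d - t)) - H ^ (q ^ j)) * x ^ (q ^ d))"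
        unfolding u_def power_mult_distrib sub 1 2 3 ..
      then show "u (d - j) ^ (q ^ j)
          = - (x ^ (q ^ d)) * (a (d - j) ^ (q ^ j) * (H ^ (q ^ j) - H ^ (q ^ (d - t))) * z ^ (q ^ j))"
        by (simp add: algebra_simps)
    qed
    also have "\<dots> = 0" unfolding sum_distrib_left[symmetric] sum0 by simp
    also have "T 0 = 0" using q(2) by (simp add: T_def power_0_left)
    finally show ?thesis .
  qed
  \<comment> \<open>Since \<open>f\<close> is onto \<open>K\<close>, the trace would vanish on all
    \<open>Q\<close> elements, although it is a nonzero polynomial of degree at most
    \<open>q ^ (N - 1)\<close>.\<close>
  have "T v = 0" if v: "v \<in> K" for v
  proof -
    have "v / z \<in> K" using v z by (simp add: K_def power_divide)
    then obtain x where x: "x \<in> K" "v / z = f x" using surj by blast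
    have "v = z * (v / z)" using z(2) by simp
    then show ?thesis using Tf[OF x(1)] x(2) by simp
  qed
  moreover define p where "p = (\<Sum>k<N. monom 1 (q ^ k) :: 'a poly)"
  ultimately have "K \<subseteq> {v. poly p v = 0}" by (auto simp: T_def poly_sum poly_monom)
  moreover have p0: "p \<noteq> 0"
  proof -
    have "coeff p 1 = (\<Sum>k<N. if k = 0 then 1 else 0)"
      unfolding p_def coeff_sum coeff_monom using q(2) by (intro sum.cong) auto
    then have "coeff p 1 = 1" using Q(2) by simp
    then show ?thesis by (metis coeff_0 zero_neq_one)
  qed
  ultimately have "Q \<le> degree p"
    using card_mono[OF poly_roots_finite[OF p0], of K] card_poly_roots_bound[OF p0] Q(3) by (simp add: K_def)
  also have "\<dots> \<le> q ^ (N - 1)"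
    unfolding p_def
  proof (intro degree_sum_le)
    fix k assume "k \<in> {..<N}"
    then have "q ^ k \<le> q ^ (N - 1)" using q(2) by (intro power_increasing) auto
    then show "degree (monom 1 (q ^ k) :: 'a poly) \<le> q ^ (N - 1)" using degree_monom_le le_trans by blast
  qed simp
  also have "\<dots> < Q" unfolding Q(1) using Q(2) q(2) by (intro power_strict_increasing) auto
  finally show False by simp
qed

text \<open>A coincidence means that \<open>x\<close> and \<open>h * x\<close> give the same value
  \<open>s\<close> of l(u) / u^(q^t). The roots of \<open>l - s * x ^ (q ^ t)\<close> form an
  F_q-space, which then contains the span of \<open>x\<close> and \<open>h * x\<close>; as
  \<open>h\<close> is not in F_q, that span has \<open>q * q\<close> elements.\<close>

lemma scattered_imp_coincidence_free:
  fixes b :: "nat \<Rightarrow> 'a::finite_field"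
  assumes q: "primepow q" and card: "card (UNIV :: 'a set) = q ^ n"
    and l: "l = (\<Sum>i\<le>r. monom (b i) (q ^ i))" and sc: "scattered q n m t l" and m: "m > 0"
  shows "coincidence_free q r t (\<lambda>i. to_ac (b i)) (q ^ (n * m))"
  unfolding coincidence_free_def
proof (intro allI impI notI)
  fix h x :: "'a alg_closure"
  let ?Q = "q ^ (n * m)"
  let ?a = "\<lambda>i. to_ac (b i)"
  assume h: "h ^ ?Q = h" "h ^ q \<noteq> h" and x: "x ^ ?Q = x" "x \<noteq> 0"
    and 0: "(\<Sum>i\<le>r. ?a i * (h ^ (q ^ i) - h ^ (q ^ t)) * x ^ (q ^ i)) = 0"
  note sub = gf_subfield[OF q card]
  obtain e where e: "e > 0" "q = CHAR('a alg_closure) ^ e" using q_power_CHAR[OF q card] .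
  have q1: "q > 1" using primepow_gt_Suc_0[OF q] by simp
  have char: "prime CHAR('a alg_closure)" by (simp add: CHAR_prime)
  have qi: "q ^ i = CHAR('a alg_closure) ^ (e * i)" for i by (simp add: e power_mult)
  have addp: "(u + v) ^ (q ^ i) = u ^ (q ^ i) + v ^ (q ^ i)" for u v :: "'a alg_closure" and i
    by (rule freshmans_dream'[OF char qi])
  have L: "poly (map_poly to_ac l) y = (\<Sum>i\<le>r. ?a i * y ^ (q ^ i))" for y
  proof -
    have "map_poly to_ac (\<Sum>i\<in>I. monom (b i) (q ^ i)) = (\<Sum>i\<in>I. monom (?a i) (q ^ i))" for I :: "nat set"
      by (intro poly_eqI) (simp add: coeff_map_poly coeff_sum to_ac_sum coeff_monom if_distrib[of to_ac] cong: if_cong)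
    then show ?thesis unfolding l by (simp add: poly_sum poly_monom)
  qed
  define s where "s = (\<Sum>i\<le>r. ?a i * x ^ (q ^ i)) / x ^ (q ^ t)"
  have nm: "n * m > 0" using m exponent_pos[OF q card] by simp
  have fixpow: "u ^ (q ^ k) = u" if "u ^ q = u" for u :: "'a alg_closure" and k
    by (induction k) (simp_all add: that power_mult)
  have aQ: "?a i ^ ?Q = ?a i" for i
  proof -
    have "?a i \<in> gf (q ^ n)" using range_to_ac_eq_gf[OF q card] by blast
    then have "?a i ^ (q ^ n) = ?a i" by (simp add: gf_def)
    then have "?a i ^ ((q ^ n) ^ k) = ?a i" for k by (induction k) (simp_all add: power_mult)
    then show ?thesis by (simp add: power_mult)
  qed
  have "(\<Sum>i\<le>r. ?a i * x ^ (q ^ i)) ^ ?Q = (\<Sum>i\<le>r. ?a i * x ^ (q ^ i))"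
  proof -
    have "(x ^ k) ^ ?Q = x ^ k" for k
    proof -
      have "(x ^ k) ^ ?Q = (x ^ ?Q) ^ k" by (simp add: mult.commute flip: power_mult)
      then show ?thesis by (simp add: x)
    qed
    then show ?thesis
      unfolding freshmans_dream_sum'[OF char qi] by (simp add: power_mult_distrib aQ)
  qed
  then have "s ^ ?Q = s"
  proof -
    have "(x ^ (q ^ t)) ^ ?Q = x ^ (q ^ t)"
    proof -
      have "(x ^ (q ^ t)) ^ ?Q = (x ^ ?Q) ^ (q ^ t)" by (simp add: mult.commute flip: power_mult)
      then show ?thesis by (simp add: x)
    qed
    then show ?thesis using \<open>(\<Sum>i\<le>r. ?a i * x ^ (q ^ i)) ^ ?Q = (\<Sum>i\<le>r. ?a i * x ^ (q ^ i))\<close>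
      by (simp add: s_def power_divide)
  qed
  then have sgf: "s \<in> gf ?Q" by (simp add: gf_def)
  define F where "F = (\<lambda>y. (\<Sum>i\<le>r. ?a i * y ^ (q ^ i)) - s * y ^ (q ^ t))"
  let ?R = "{y \<in> gf ?Q. poly (map_poly to_ac l - monom s (q ^ t)) y = 0}"
  have R: "?R = {y. y ^ ?Q = y \<and> F y = 0}" by (auto simp: gf_def F_def L poly_monom)
  have Fx: "F x = 0" using x by (simp add: F_def s_def)
  have Fhx: "F (h * x) = 0"
  proof -
    have "(\<Sum>i\<le>r. ?a i * (h * x) ^ (q ^ i)) = (\<Sum>i\<le>r. h ^ (q ^ t) * (?a i * x ^ (q ^ i)))
        + (\<Sum>i\<le>r. ?a i * (h ^ (q ^ i) - h ^ (q ^ t)) * x ^ (q ^ i))"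
      unfolding sum.distrib[symmetric] by (intro sum.cong) (auto simp: power_mult_distrib algebra_simps)
    also have "\<dots> = h ^ (q ^ t) * (\<Sum>i\<le>r. ?a i * x ^ (q ^ i))" unfolding 0 by (simp add: sum_distrib_left)
    finally show ?thesis using x by (simp add: F_def s_def power_mult_distrib)
  qed
  have Flin: "F (\<alpha> * u + \<beta> * v) = \<alpha> * F u + \<beta> * F v" if "\<alpha> ^ q = \<alpha>" "\<beta> ^ q = \<beta>" for \<alpha> \<beta> u v
  proof -
    have "(\<alpha> * u + \<beta> * v) ^ (q ^ i) = \<alpha> * u ^ (q ^ i) + \<beta> * v ^ (q ^ i)" for i
      by (simp add: addp power_mult_distrib fixpow that)
    then show ?thesis by (simp add: F_def sum.distrib sum_distrib_left algebra_simps)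
  qed
  define E where "E = {u :: 'a alg_closure. u ^ q = u}"
  have cardE: "card E = q" using card_gf[OF q card, of 1] by (simp add: E_def gf_def)
  have finE: "finite E" using cardE q1 by (intro card_ge_0_finite) simp
  let ?g = "\<lambda>(\<alpha>, \<beta>). \<alpha> * x + \<beta> * (h * x)"
  have "inj_on ?g (E \<times> E)"
  proof (rule inj_onI, clarify)
    fix \<alpha> \<beta> \<alpha>' \<beta>'
    assume E: "\<alpha> \<in> E" "\<beta> \<in> E" "\<alpha>' \<in> E" "\<beta>' \<in> E"
      and eq: "\<alpha> * x + \<beta> * (h * x) = \<alpha>' * x + \<beta>' * (h * x)"
    then have "(\<alpha> + \<beta> * h) * x = (\<alpha>' + \<beta>' * h) * x" by (simp add: algebra_simps)
    then have "\<alpha> + \<beta> * h = \<alpha>' + \<beta>' * h" using x(2) by simp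
    then have 1: "\<alpha> - \<alpha>' = (\<beta>' - \<beta>) * h" by (simp add: algebra_simps)
    have "\<beta> = \<beta>'"
    proof (rule ccontr)
      assume "\<beta> \<noteq> \<beta>'"
      then have "h = (\<alpha> - \<alpha>') * inverse (\<beta>' - \<beta>)" using 1 by (simp add: field_simps)
      moreover have "\<alpha> \<in> gf (q ^ 1)" "\<beta> \<in> gf (q ^ 1)" "\<alpha>' \<in> gf (q ^ 1)" "\<beta>' \<in> gf (q ^ 1)"
        using E by (simp_all add: E_def gf_def)
      then have "(\<alpha> - \<alpha>') * inverse (\<beta>' - \<beta>) \<in> gf (q ^ 1)" by (intro sub)
      ultimately show False using h(2) by (simp add: gf_def)
    qed
    then show "\<alpha> = \<alpha>' \<and> \<beta> = \<beta>'" using 1 by simp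
  qed
  then have "card (?g ` (E \<times> E)) = q * q" using cardE by (simp add: card_image card_cartesian_product)
  moreover have "?g ` (E \<times> E) \<subseteq> ?R"
  proof (rule image_subsetI)
    fix p assume "p \<in> E \<times> E"
    then obtain \<alpha> \<beta> where p: "p = (\<alpha>, \<beta>)" and E: "\<alpha> \<in> E" "\<beta> \<in> E" by auto
    then have ab: "\<alpha> ^ q = \<alpha>" "\<beta> ^ q = \<beta>" by (simp_all add: E_def)
    have "(\<alpha> * x + \<beta> * (h * x)) ^ ?Q = \<alpha> * x + \<beta> * (h * x)"
      by (simp add: addp power_mult_distrib fixpow ab h(1) x(1))
    moreover have "F (\<alpha> * x + \<beta> * (h * x)) = 0" by (simp add: Flin[OF ab] Fx Fhx)
    ultimately show "?g p \<in> ?R" unfolding R p by simp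
  qed
  moreover have "finite ?R"
  proof -
    have "?Q > 1" using q1 nm by (rule one_less_power)
    then have "finite (gf ?Q :: 'a alg_closure set)" by (rule finite_gf)
    then show ?thesis by simp
  qed
  ultimately have "q * q \<le> card ?R" using card_mono[of ?R "?g ` (E \<times> E)"] by simp
  also have "\<dots> \<le> q" using sc sgf by (simp add: scattered_def)
  finally show False using q1 by simp
qed

theorem theorem1p2:
  fixes q n t r d :: nat and l :: "'a::finite_field poly"
  assumes "primepow q" and "odd q"
    and "n \<ge> 1" and "t \<ge> 1"
    and "card (UNIV :: 'a set) = q ^ n"
    and "q_linearized q l"
    and "has_linearized_degree q l r"
    and "t_normalized q t l"
    and "exceptional_scattered q n t l"
    and "d = max r t"
    and "prime d" and "odd d"
  shows "l = monom 1 1"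
proof -
  note q = assms(1) and card = assms(5)
  have q1: "q > 1" using primepow_gt_Suc_0[OF q] by simp
  then have q2: "q > 2" using assms(2) by (cases "q = 2") auto
  obtain e where e: "e > 0" "q = CHAR('a alg_closure) ^ e" using q_power_CHAR[OF q card] .
  have char: "prime CHAR('a alg_closure)" by (simp add: CHAR_prime)
  obtain b where l: "l = (\<Sum>i\<le>r. monom (b i) (q ^ i))" and br: "b r \<noteq> 0"
    using assms(7) by (auto simp: has_linearized_degree_def)
  have cl: "coeff l (q ^ i) = b i" if "i \<le> r" for i
  proof -
    have "coeff l (q ^ i) = (\<Sum>j\<le>r. if j = i then b j else 0)"
      unfolding l coeff_sum coeff_monom using q1 by (intro sum.cong) auto
    then show ?thesis using that by simp
  qed
  have norm: "lead_coeff l = 1" "coeff l (q ^ t) = 0" "coeff l 1 \<noteq> 0"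
    using assms(4,8) by (auto simp: t_normalized_def)
  have b0: "b 0 \<noteq> 0" using norm(3) cl[of 0] by simp
  have tr: "t \<noteq> r" using norm(2) cl[of r] br by auto
  define a where "a = (\<lambda>i. to_ac (b i))"
  have a0: "a 0 \<noteq> 0" "a r \<noteq> 0" using b0 br by (simp_all add: a_def)
  have cards: "card {x :: 'a alg_closure. x ^ (q ^ k) = x} = q ^ k" if "k > 0" for k
    using card_gf[OF q card that] by (simp add: gf_def)
  have inf: "infinite (UNIV :: 'a alg_closure set)"
  proof
    assume fin: "finite (UNIV :: 'a alg_closure set)"
    define k where "k = card (UNIV :: 'a alg_closure set)"
    have "k > 0" unfolding k_def using fin by (simp add: card_gt_0_iff)
    then have "q ^ k \<le> k" using cards[of k] card_mono[OF fin, of "{x. x ^ (q ^ k) = x}"] by (simp add: k_def)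
    moreover have "k < q ^ k" using q1 by (intro power_gt_expt) auto
    ultimately show False by simp
  qed
  have n0: "n > 0" using assms(3) by simp
  have aQ: "a i ^ (q ^ (n * m)) = a i" for i m
  proof -
    have "a i \<in> gf (q ^ n)" unfolding a_def using range_to_ac_eq_gf[OF q card] by blast
    then have "a i ^ (q ^ n) = a i" by (simp add: gf_def)
    then have "a i ^ ((q ^ n) ^ k) = a i" for k by (induction k) (simp_all add: power_mult)
    then show ?thesis by (simp add: power_mult)
  qed
  have large: "\<exists>m E. m > 0 \<and> q ^ (n * m) \<ge> Q0 \<and> q ^ (n * m) = CHAR('a alg_closure) ^ E \<and>
      coincidence_free q r t a (q ^ (n * m))" for Q0
  proof -
    have "infinite {m. m > 0 \<and> scattered q n m t l}" using assms(9) by (simp add: exceptional_scattered_def)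
    then obtain m where m: "m > Q0" "m > 0" "scattered q n m t l"
      unfolding infinite_nat_iff_unbounded by blast
    have "1 * m \<le> n * m" using n0 by (intro mult_le_mono1) simp
    then have "Q0 \<le> n * m" using m(1) by linarith
    also have "\<dots> < q ^ (n * m)" using q1 by (intro power_gt_expt) auto
    finally have "Q0 \<le> q ^ (n * m)" by simp
    moreover have "q ^ (n * m) = CHAR('a alg_closure) ^ (e * (n * m))" by (simp add: e power_mult)
    moreover have "coincidence_free q r t a (q ^ (n * m))"
      unfolding a_def by (rule scattered_imp_coincidence_free[OF q card l m(3,2)])
    ultimately show ?thesis using m(2) by blast
  qed
  show ?thesis
  proof (cases "r < t")
    case True
    then have d: "d = t" using assms(10) by simp
    show ?thesis
    proof (cases "r = 0")
      case True
      then have "l = monom (b 0) 1" using l by simp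
      moreover from this have "b 0 = 1" using norm(1) b0 by (simp add: degree_monom_eq)
      ultimately show ?thesis by simp
    next
      case False
      have "\<not> d dvd r" using False \<open>r < t\<close> d by (auto dest: dvd_imp_le)
      then have "coprime r d" using prime_imp_coprime[OF assms(11)] coprime_commute by blast
      then obtain Q0 where Q0: "\<And>E Q. Q = CHAR('a alg_closure) ^ E \<Longrightarrow> Q \<ge> Q0 \<Longrightarrow>
          card {x::'a alg_closure. x ^ Q = x} = Q \<Longrightarrow> (\<And>i. a i ^ Q = a i) \<Longrightarrow> \<not> coincidence_free q r d a Q"
        using not_coincidence_free_A[OF char inf e(2) q2, of r d a] False True d a0 by blast
      obtain m E where m: "m > 0" "q ^ (n * m) \<ge> Q0" "q ^ (n * m) = CHAR('a alg_closure) ^ E"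
        "coincidence_free q r t a (q ^ (n * m))" using large by blast
      have "\<not> coincidence_free q r d a (q ^ (n * m))"
        using m(1) n0 by (intro Q0[OF m(3,2)] cards aQ) simp
      then show ?thesis using m(4) d by simp
    qed
  next
    case False
    then have d: "d = r" "t < d" using assms(10) tr by auto
    have cop: "coprime k d" if "0 < k" "k < d" for k
    proof -
      have "\<not> d dvd k" using that by (auto dest: dvd_imp_le)
      then show ?thesis using prime_imp_coprime[OF assms(11)] coprime_commute by blast
    qed
    \<comment> \<open>Stated for arbitrary \<open>s\<close> and \<open>c\<close> because it is
      applied to \<open>l\<close> itself and, for \<open>t = 1\<close>, to its adjoint with
      \<open>s = d - 1\<close>, which is at least 2.\<close>
    have contra: False
      if s: "2 \<le> s" "s < d" and c: "c 0 \<noteq> 0" "c d \<noteq> 0"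
        and cQ: "\<And>i m. c i ^ (q ^ (n * m)) = c i"
        and cf: "\<And>m. m > 0 \<Longrightarrow> coincidence_free q r t a (q ^ (n * m)) \<Longrightarrow> coincidence_free q d s c (q ^ (n * m))"
      for s and c :: "nat \<Rightarrow> 'a alg_closure"
    proof -
      interpret case_B q d s e c
        using char e(2) assms(2,12) q1 inf s cop[of s] c by unfold_locales auto
      obtain Q0 where Q0: "\<And>E Q. Q = CHAR('a alg_closure) ^ E \<Longrightarrow> Q \<ge> Q0 \<Longrightarrow>
          card {x::'a alg_closure. x ^ Q = x} = Q \<Longrightarrow> (\<And>i. c i ^ Q = c i) \<Longrightarrow> \<not> coincidence_free q d s c Q"
        using not_coincidence_free_B by blast
      obtain m E where m: "m > 0" "q ^ (n * m) \<ge> Q0" "q ^ (n * m) = CHAR('a alg_closure) ^ E"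
        "coincidence_free q r t a (q ^ (n * m))" using large by blast
      have "\<not> coincidence_free q d s c (q ^ (n * m))"
        using m(1) n0 by (intro Q0[OF m(3,2)] cards cQ) simp
      then show False using cf[OF m(1,4)] by simp
    qed
    show ?thesis
    proof (cases "t \<ge> 2")
      case True
      then show ?thesis using contra[of t a] d a0 aQ by auto
    next
      case False
      then have t1: "t = 1" using assms(4) by simp
      have "d \<ge> 3" using assms(11,12) prime_ge_2_nat[of d] by (cases "d = 2") auto
      have powQ: "(a i ^ k) ^ (q ^ (n * m)) = a i ^ k" for i k m
      proof -
        have "(a i ^ k) ^ (q ^ (n * m)) = (a i ^ (q ^ (n * m))) ^ k" by (simp add: mult.commute flip: power_mult)
        then show ?thesis by (simp add: aQ)
      qed
      have False
      proof (rule contra[of "d - t" "\<lambda>j. a (d - j) ^ (q ^ j)"])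
        show "coincidence_free q d (d - t) (\<lambda>j. a (d - j) ^ (q ^ j)) (q ^ (n * m))"
          if "m > 0" "coincidence_free q r t a (q ^ (n * m))" for m
          using that n0 d by (intro coincidence_free_adjoint[OF char e(2) q1 refl _ cards aQ]) auto
      qed (use \<open>d \<ge> 3\<close> t1 a0 d powQ in auto)
      then show ?thesis ..
    qed
  qed
qed

end
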